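(* Let $X$ be an $n$-dimensional Banach space. Then, for every number $0<\lambda<\log^{-4}\!\big(n/I_2(X)^2\big)$, $$T_2(X) \le C\,\lambda^{-1/2}\cdot I_2^{(\lambda n)}(X),$$ where $C$ is an absolute constant.
   Context: Let $(g_i)$ be independent standard Gaussian random variables. $T_2(X)$ (the Gaussian type 2 constant) is the best possible (smallest) constant $M$ such that for all $m$ and all sequences of vectors $x_1,\dots,x_m\in X$, $$\mathbb{E}\Big\|\sum_{i=1}^m g_i x_i\Big\| \le M\Big(\sum_{i=1}^m\|x_i\|^2\Big)^{1/2}.$$ $I_2(X)$ (the infratype 2 constant) is the best possible constant $M$ such that for all $m$ and all sequences of vectors $x_1,\dots,x_m\in X$, $$\min_{\eta_i=\pm1}\Big\|\sum_{i=1}^m \eta_i x_i\Big\| \le M\Big(\sum_{i=1}^m\|x_i\|^2\Big)^{1/2}.$$ $I_2^{(m)}(X)$ denotes the best possible constant $M$ in this last inequality for sequences of $m$ vectors (that is, the infratype 2 constant computed on $m$ vectors); $I_2^{(\lambda n)}(X)$ is this quantity with $m=\lambda n$. The notation $\log^{-4}(u)$ means $(\log u)^{-4}$.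
   Formalization: Adds λ ≤ 1: without it the claim fails for l_p^2 as p→1, where n/I_2^2→1 permits arbitrarily large λ while T_2 ≥ √(2/π). Non-integer λn is rounded up, and X is taken, up to isometry, as a normed n-dimensional subspace of the finitely supported real sequences. *)

theory Defs
  imports
    "HOL-Analysis.Finite_Function_Topology"
    "HOL-Probability.Probability"
begin

text \<open>
  Normed spaces are given by a linear subspace V of an ambient real vector space together with a
  norm N on V. The library norm of the ambient type, if there is one, plays no role. With the
  ambient space of finitely supported real sequences, the pairs (V, N) with V of dimension n
  represent every n-dimensional real normed space up to linear isometry. Such spaces are complete,
  so they are exactly the n-dimensional real Banach spaces. A fixed ambient type is needed
  because HOL cannot quantify over types below the existential quantifier for an absolute
  constant.
\<close>

definition norm_on :: "'v::real_vector set \<Rightarrow> ('v \<Rightarrow> real) \<Rightarrow> bool" where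
  "norm_on V N \<longleftrightarrow>
     (\<forall>x\<in>V. 0 \<le> N x \<and> (N x = 0 \<longleftrightarrow> x = 0)) \<and>
     (\<forall>x\<in>V. \<forall>y\<in>V. N (x + y) \<le> N x + N y) \<and>
     (\<forall>a. \<forall>x\<in>V. N (a *\<^sub>R x) = \<bar>a\<bar> * N x)"

text \<open>
  \<^const>\<open>dim\<close> is also 0 for spaces without a finite basis, hence the condition on n.
\<close>

definition banach_space_of_dim :: "nat \<Rightarrow> 'v::real_vector set \<Rightarrow> ('v \<Rightarrow> real) \<Rightarrow> bool" where
  "banach_space_of_dim n V N \<longleftrightarrow> 1 \<le> n \<and> subspace V \<and> dim V = n \<and> norm_on V N"

text \<open>The coordinates of the product measure are the independent standard Gaussians.\<close>

definition gauss_average :: "('v::real_vector \<Rightarrow> real) \<Rightarrow> nat \<Rightarrow> (nat \<Rightarrow> 'v) \<Rightarrow> real" where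
  "gauss_average N m x =
     (\<integral>g. N (\<Sum>i<m. g i *\<^sub>R x i) \<partial>(Pi\<^sub>M {..<m} (\<lambda>_. std_normal_distribution)))"

definition min_sign_norm :: "('v::real_vector \<Rightarrow> real) \<Rightarrow> nat \<Rightarrow> (nat \<Rightarrow> 'v) \<Rightarrow> real" where
  "min_sign_norm N m x =
     Min ((\<lambda>\<eta>. N (\<Sum>i<m. \<eta> i *\<^sub>R x i)) ` ({..<m} \<rightarrow>\<^sub>E {-1, 1}))"

text \<open>
  The best constants below are infima in \<^typ>\<open>real\<close>. For finite-dimensional V the sets of
  admissible constants are nonempty and closed, so the infima are attained.
\<close>

definition type2_const :: "'v::real_vector set \<Rightarrow> ('v \<Rightarrow> real) \<Rightarrow> real" where
  "type2_const V N =
     Inf {M. 0 \<le> M \<and> (\<forall>m x. (\<forall>i<m. x i \<in> V) \<longrightarrow>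
               gauss_average N m x \<le> M * sqrt (\<Sum>i<m. (N (x i))\<^sup>2))}"

definition infratype2_const :: "'v::real_vector set \<Rightarrow> ('v \<Rightarrow> real) \<Rightarrow> real" where
  "infratype2_const V N =
     Inf {M. 0 \<le> M \<and> (\<forall>m x. (\<forall>i<m. x i \<in> V) \<longrightarrow>
               min_sign_norm N m x \<le> M * sqrt (\<Sum>i<m. (N (x i))\<^sup>2))}"

definition infratype2_const_on :: "nat \<Rightarrow> 'v::real_vector set \<Rightarrow> ('v \<Rightarrow> real) \<Rightarrow> real" where
  "infratype2_const_on m V N =
     Inf {M. 0 \<le> M \<and> (\<forall>x. (\<forall>i<m. x i \<in> V) \<longrightarrow>
               min_sign_norm N m x \<le> M * sqrt (\<Sum>i<m. (N (x i))\<^sup>2))}"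

text \<open>
  Extended-real valued, so that the value at u = 1 is infinity. This value occurs: the quotient
  of n by the squared infratype 2 constant is 1 for the n-dimensional l1 space.
\<close>

definition log_neg4 :: "real \<Rightarrow> ereal" where
  "log_neg4 u = inverse (ereal (ln u ^ 4))"

end

theory Submission
  imports Defs
begin

text \<open>
  By Hahn-Banach the Gaussian average of the norm is the expected supremum of a Gaussian process
  indexed by the dual ball, so by chaining it suffices to bound, at each scale r, the number of
  functionals in a ball of radius r that are r/2-separated in the L2 distance of the process.
  A derandomized sampling step first reduces to boundedly many (512n) vectors. Then the duality of
  entropy numbers through convexified packings (Artstein, Milman, Szarek and Tomczak-Jaegermann)
  turns separated functionals into N-separated linear combinations of these vectors. Finally the
  infratype inequality, used to round the coefficients of such combinations to coarser and coarser
  grids, bounds their number. The rounding only signs subsets, which are cut into blocks of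
  \<lambda>n vectors, and its accumulated error stays below the scale r, so no logarithm is lost
  near the smallest scale. Summing over the scales gives
  T \<le> C J (\<lambda>^(-1/2) + k^2), where J is the infratype constant on \<lambda>n vectors
  and k is about log (\<lambda>n / J^2). The same bound holds for random signs, hence for I, and
  this forces k^2 \<le> C \<lambda>^(-1/2) in the given range of \<lambda>.
\<close>

section \<open>Norms on subspaces and their dual balls\<close>

text \<open>Sampling does more than shorten the list: the new vectors all have norm at most
  \<open>sqrt (2 / M)\<close>, the uniform bound that the signings use, and M being of order n keeps
  the count of rounded vectors, about exp (M l / 2^l), under control. Duality is applied only to
  functionals whose Euclidean size is comparable to their separation. The ratio of diameter to gap
  is then an absolute constant, so averages of 4096 points and 257 cells suffice at every scale.
  This localization costs nothing, because half the difference of two elements of the dual ball lies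
  in it again. Chaining stops at \<open>base_scale\<close>, a multiple of J / sqrt (lam n). Below
  it, Cauchy-Schwarz in dimension n costs \<open>base_scale * sqrt n\<close> = 2048 J / sqrt lam,
  which is of the order aimed at. Above it, radius times root entropy at level j splits into a part
  summable in j and a part of order J j; the latter sums to J k^2. Randomness enters only through
  exponential moments. Suprema are replaced by explicit integrable majorants valid at every sample
  point, so the same argument serves Gaussians and signs.\<close>

locale normed_subspace =
  fixes V :: "'v::real_vector set" and N :: "'v \<Rightarrow> real"
  assumes subspace_V: "subspace V" and norm_on_V: "norm_on V N"
begin

lemma N_nonneg: "x \<in> V \<Longrightarrow> 0 \<le> N x"
  using norm_on_V by (auto simp: norm_on_def)

lemma N_eq_0_iff: "x \<in> V \<Longrightarrow> N x = 0 \<longleftrightarrow> x = 0"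
  using norm_on_V by (auto simp: norm_on_def)

lemma N_0 [simp]: "N 0 = 0"
  using N_eq_0_iff[of 0] subspace_0[OF subspace_V] by simp

lemma N_triangle: "x \<in> V \<Longrightarrow> y \<in> V \<Longrightarrow> N (x + y) \<le> N x + N y"
  using norm_on_V by (auto simp: norm_on_def)

lemma N_scaleR: "x \<in> V \<Longrightarrow> N (a *\<^sub>R x) = \<bar>a\<bar> * N x"
  using norm_on_V by (auto simp: norm_on_def)

lemma N_minus: "x \<in> V \<Longrightarrow> N (- x) = N x"
  using N_scaleR[of x "-1"] by simp

lemma N_diff: "x \<in> V \<Longrightarrow> y \<in> V \<Longrightarrow> N (x - y) \<le> N x + N y"
  using N_triangle[of x "- y"] N_minus[of y] subspace_neg[OF subspace_V, of y] by simp

lemma lincomb_in_V: "(\<And>i. i \<in> I \<Longrightarrow> x i \<in> V) \<Longrightarrow> (\<Sum>i\<in>I. a i *\<^sub>R x i) \<in> V"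
  by (intro subspace_sum subspace_scale subspace_V) auto

lemma N_sum: "(\<And>i. i \<in> I \<Longrightarrow> x i \<in> V) \<Longrightarrow> N (\<Sum>i\<in>I. a i *\<^sub>R x i) \<le> (\<Sum>i\<in>I. \<bar>a i\<bar> * N (x i))"
proof (induction I rule: infinite_finite_induct)
  case (insert j I)
  have "N (\<Sum>i\<in>insert j I. a i *\<^sub>R x i) \<le> N (a j *\<^sub>R x j) + N (\<Sum>i\<in>I. a i *\<^sub>R x i)"
    using insert by (auto intro!: N_triangle lincomb_in_V subspace_scale subspace_V)
  also have "\<dots> \<le> \<bar>a j\<bar> * N (x j) + (\<Sum>i\<in>I. \<bar>a i\<bar> * N (x i))"
    using insert.IH insert.prems by (intro add_mono) (simp_all add: N_scaleR)
  finally show ?case using insert.hyps by simp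
qed auto

text \<open>Functionals are linear on the whole ambient space but bounded only on V. Two elements
  may agree on V and still differ; packings and nets below measure distances through values at
  vectors of V, where this is invisible.\<close>

definition dual_ball :: "('v \<Rightarrow> real) set" where
  "dual_ball = {f. linear f \<and> (\<forall>x\<in>V. \<bar>f x\<bar> \<le> N x)}"

lemma dual_ball_linear: "f \<in> dual_ball \<Longrightarrow> linear f"
  by (auto simp: dual_ball_def)

lemma dual_ball_bound: "f \<in> dual_ball \<Longrightarrow> x \<in> V \<Longrightarrow> \<bar>f x\<bar> \<le> N x"
  by (auto simp: dual_ball_def)

lemma zero_in_dual_ball: "(\<lambda>_. 0) \<in> dual_ball"
  by (auto simp: dual_ball_def linear_iff intro: N_nonneg)

text \<open>This recentres a ball of radius 2r about a functional to the ball of radius r about 0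
  without leaving the dual ball.\<close>

lemma half_diff_in_dual_ball:
  assumes "f \<in> dual_ball" "g \<in> dual_ball"
  shows "(\<lambda>x. (f x - g x) / 2) \<in> dual_ball"
proof -
  have "\<bar>(f x - g x) / 2\<bar> \<le> N x" if "x \<in> V" for x
    using dual_ball_bound[OF assms(1) that] dual_ball_bound[OF assms(2) that]
    by (simp add: abs_le_iff)
  moreover have "linear (\<lambda>x. (f x - g x) / 2)"
    using assms by (auto simp: dual_ball_def linear_iff field_simps)
  ultimately show ?thesis by (auto simp: dual_ball_def)
qed

text \<open>The one-dimensional step of Hahn-Banach, with domination required on the subspaces
  only.\<close>

lemma extend_dominated:
  assumes W: "subspace W" "W \<subseteq> V" and b: "b \<in> V" "b \<notin> W"
    and f: "linear f" "\<And>x. x \<in> W \<Longrightarrow> f x \<le> N x"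
  shows "\<exists>g. linear g \<and> (\<forall>x\<in>W. g x = f x) \<and> (\<forall>x\<in>span (insert b W). g x \<le> N x)"
proof -
  obtain B where B: "B \<subseteq> W" "independent B" "W \<subseteq> span B" "card B = dim W"
    by (rule basis_exists[of W])
  have spanB: "span B = W"
    using B W by (simp add: span_subspace)
  have "independent (insert b B)"
    using B b spanB by (simp add: independent_insertI)
  \<comment> \<open>\<open>h\<close> is the coordinate along b that vanishes on W, so adding a
    multiple of it changes the value at b and nothing on W.\<close>
  from linear_independent_extend[OF this, of "\<lambda>x. if x = b then 1 else 0"]
  obtain h :: "'v \<Rightarrow> real" where h: "linear h" "\<forall>x\<in>insert b B. h x = (if x = b then 1 else 0)"
    by blast
  have hW: "h x = 0" if "x \<in> W" for x
  proof (rule linear_eq_0_on_span[OF h(1), of B])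
    show "h y = 0" if "y \<in> B" for y
      using h(2) that B(1) b(2) by auto
  qed (use that spanB in simp)
  have hb: "h b = 1" using h(2) by simp
  let ?S = "(\<lambda>w. f w - N (w - b)) ` W"
  have key: "f w - N (w - b) \<le> N (w' + b) - f w'" if "w \<in> W" "w' \<in> W" for w w'
  proof -
    have "f w + f w' = f (w + w')" using f(1) by (simp add: linear_add)
    also have "\<dots> \<le> N (w + w')" using that W by (intro f(2) subspace_add)
    also have "\<dots> = N ((w - b) + (w' + b))" by (simp add: algebra_simps)
    also have "\<dots> \<le> N (w - b) + N (w' + b)"
      using that W b subspace_V by (intro N_triangle) (auto intro: subspace_diff subspace_add)
    finally show ?thesis by simp
  qed
  have W0: "0 \<in> W" using W subspace_0 by blast
  have bdd: "bdd_above ?S"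
    using key[OF _ W0] by (intro bdd_aboveI[of _ "N (0 + b) - f 0"]) auto
  \<comment> \<open>By homogeneity, domination has to be checked only for multiples 1 and -1 of b.
    This confines the value at b to an interval, nonempty by \<open>key\<close>, whose left end is
    chosen.\<close>
  define \<alpha> where "\<alpha> = Sup ?S"
  have lo: "f w - N (w - b) \<le> \<alpha>" if "w \<in> W" for w
    unfolding \<alpha>_def using that bdd by (intro cSup_upper) auto
  have up: "\<alpha> \<le> N (w + b) - f w" if "w \<in> W" for w
    unfolding \<alpha>_def using that key W0 by (intro cSup_least) auto
  define g where "g x = f x + (\<alpha> - f b) * h x" for x
  have lin: "linear g"
    using f(1) h(1) unfolding g_def by (auto simp: linear_iff algebra_simps)
  have "g x \<le> N x" if x: "x \<in> span (insert b W)" for x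
  proof -
    obtain k where k: "x - k *\<^sub>R b \<in> W"
      using x W by (auto simp: span_breakdown_eq span_subspace span_eq_iff[THEN iffD2])
    define w where "w = x - k *\<^sub>R b"
    have w: "w \<in> W" "x = w + k *\<^sub>R b" using k by (auto simp: w_def)
    have gx: "g x = f w + k * \<alpha>"
      using w hW[OF w(1)] hb f(1) h(1)
      by (simp add: g_def linear_add linear_cmul algebra_simps)
    have scaled: "(1 / c) *\<^sub>R w \<in> W" for c using w W by (simp add: subspace_scale)
    have fs: "f ((1 / c) *\<^sub>R w) = f w / c" for c using f(1) by (simp add: linear_cmul)
    consider "k = 0" | "k > 0" | "k < 0" by linarith
    then show ?thesis
    proof cases
      case 1
      then show ?thesis using gx w f(2) by simp
    next
      case 2
      have "k * \<alpha> \<le> k * (N ((1 / k) *\<^sub>R w + b) - f w / k)"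
        using 2 up[OF scaled[of k]] fs[of k] by (intro mult_left_mono) auto
      also have "\<dots> = N (k *\<^sub>R ((1 / k) *\<^sub>R w + b)) - f w"
        using 2 scaled[of k] W b subspace_V
        by (subst N_scaleR) (auto intro: subspace_add simp: algebra_simps)
      also have "k *\<^sub>R ((1 / k) *\<^sub>R w + b) = x" using 2 w by (simp add: algebra_simps)
      finally show ?thesis using gx by simp
    next
      case 3
      define c where "c = - k"
      have c: "c > 0" "k = - c" using 3 by (auto simp: c_def)
      have "c * (f w / c - N ((1 / c) *\<^sub>R w - b)) \<le> c * \<alpha>"
        using c lo[OF scaled[of c]] fs[of c] by (intro mult_left_mono) auto
      moreover have "c * N ((1 / c) *\<^sub>R w - b) = N (c *\<^sub>R ((1 / c) *\<^sub>R w - b))"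
        using c scaled[of c] W b subspace_V
        by (subst N_scaleR) (auto intro: subspace_diff simp: algebra_simps)
      moreover have "c *\<^sub>R ((1 / c) *\<^sub>R w - b) = x" using c w by (simp add: algebra_simps)
      ultimately show ?thesis using gx c by (simp add: algebra_simps)
    qed
  qed
  moreover have "\<forall>x\<in>W. g x = f x" using hW by (simp add: g_def)
  ultimately show ?thesis using lin by blast
qed

text \<open>A functional norming z on its own line is extended along one spanning vector at a time;
  finite induction takes the place of Zorn's lemma.\<close>

lemma norming_functional:
  assumes B: "finite B" "V = span B" and z: "z \<in> V"
  shows "\<exists>f\<in>dual_ball. f z = N z"
proof -
  have "\<exists>f. linear f \<and> f z = N z \<and> (\<forall>x\<in>span (insert z C). f x \<le> N x)"
    if "finite C" "C \<subseteq> B" for C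
    using that
  proof (induction C rule: finite_induct)
    case empty
    have "\<exists>f::'v \<Rightarrow> real. linear f \<and> f z = N z"
    proof (cases "z = 0")
      case True
      then show ?thesis by (intro exI[of _ "\<lambda>_. 0"]) (auto simp: linear_iff)
    next
      case False
      then have "independent {z}" by simp
      from linear_independent_extend[OF this, of "\<lambda>_. N z"] show ?thesis by auto
    qed
    then obtain f :: "'v \<Rightarrow> real" where f: "linear f" "f z = N z" by blast
    have "f x \<le> N x" if "x \<in> span {z}" for x
    proof -
      obtain k where "x = k *\<^sub>R z" using \<open>x \<in> span {z}\<close> by (auto simp: span_singleton)
      then show ?thesis
        using f z N_nonneg[OF z] by (simp add: linear_cmul N_scaleR mult_right_mono)
    qed
    then show ?case using f by blast
  next
    case (insert b C)
    then obtain f where f: "linear f" "f z = N z" "\<forall>x\<in>span (insert z C). f x \<le> N x" by auto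
    let ?W = "span (insert z C)"
    have CB: "insert z C \<subseteq> V" "b \<in> V" using insert.prems z B by (auto intro: span_base)
    have WV: "?W \<subseteq> V" using CB subspace_V by (meson span_minimal)
    have eq: "span (insert z (insert b C)) = span (insert b ?W)"
    proof (rule span_eq[THEN iffD2], intro conjI)
      show "insert z (insert b C) \<subseteq> span (insert b ?W)"
        by (auto intro: span_base)
      have "?W \<subseteq> span (insert z (insert b C))" by (intro span_mono) auto
      then show "insert b ?W \<subseteq> span (insert z (insert b C))"
        by (auto intro: span_base)
    qed
    show ?case
    proof (cases "b \<in> ?W")
      case True
      then have "span (insert b ?W) = ?W" by (simp add: insert_absorb)
      then show ?thesis using f eq by auto
    next
      case False
      from extend_dominated[OF subspace_span WV CB(2) False f(1)] f(3)
      obtain g where "linear g" "\<forall>x\<in>?W. g x = f x" "\<forall>x\<in>span (insert b ?W). g x \<le> N x" by blast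
      moreover have "z \<in> ?W" by (simp add: span_base)
      ultimately show ?thesis using f eq by (intro exI[of _ g]) auto
    qed
  qed
  from this[of B] obtain f where f: "linear f" "f z = N z" "\<forall>x\<in>span (insert z B). f x \<le> N x"
    using B by auto
  have V: "span (insert z B) = V" using z B by (simp add: span_redundant)
  have "\<bar>f x\<bar> \<le> N x" if "x \<in> V" for x
    using f(3)[unfolded V] that N_minus[OF that] subspace_neg[OF subspace_V that]
      linear_neg[OF f(1), of x] by (metis abs_le_iff)
  then show ?thesis using f by (auto simp: dual_ball_def)
qed

end

section \<open>Signings and rounding of linear combinations\<close>

text \<open>J stands for the infratype 2 constant on p vectors. \<open>signing\<close> concerns
  lists of exactly p vectors; shorter ones are padded with zeros.\<close>

locale infratype_space = normed_subspace V N
  for V :: "'v::real_vector set" and N :: "'v \<Rightarrow> real" +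
  fixes p :: nat and J :: real
  assumes p_pos: "0 < p" and J_pos: "0 < J"
    and signing: "\<And>z. (\<And>i. i < p \<Longrightarrow> z i \<in> V) \<Longrightarrow>
      \<exists>\<eta>. (\<forall>i. \<eta> i \<in> {-1, 1::real}) \<and>
          N (\<Sum>i<p. \<eta> i *\<^sub>R z i) \<le> J * sqrt (\<Sum>i<p. (N (z i))\<^sup>2)"
begin

lemma signing_small:
  assumes "finite S" "card S \<le> p" and y: "\<And>s. s \<in> S \<Longrightarrow> y s \<in> V" "\<And>s. s \<in> S \<Longrightarrow> N (y s) \<le> \<gamma>"
  shows "\<exists>\<eta>. (\<forall>s. \<eta> s \<in> {-1, 1::int}) \<and>
    N (\<Sum>s\<in>S. of_int (\<eta> s) *\<^sub>R y s) \<le> J * \<gamma> * sqrt (card S)"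
proof (cases "S = {}")
  case True
  then show ?thesis by (intro exI[of _ "\<lambda>_. 1"]) auto
next
  case False
  then have \<gamma>: "\<gamma> \<ge> 0" using y N_nonneg by fastforce
  let ?m = "card S"
  obtain e where e: "bij_betw e {..<?m} S"
    using ex_bij_betw_nat_finite[OF assms(1)] by (auto simp: atLeast0LessThan)
  define z where "z i = (if i < ?m then y (e i) else 0)" for i
  have eS: "e i \<in> S" if "i < ?m" for i using e that by (auto simp: bij_betw_def)
  have zV: "z i \<in> V" for i using y eS subspace_0[OF subspace_V] by (auto simp: z_def)
  obtain \<eta> where \<eta>: "\<forall>i. \<eta> i \<in> {-1, 1::real}"
      "N (\<Sum>i<p. \<eta> i *\<^sub>R z i) \<le> J * sqrt (\<Sum>i<p. (N (z i))\<^sup>2)"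
    using signing[of z] zV by blast
  define \<epsilon> where "\<epsilon> s = (if \<eta> (the_inv_into {..<?m} e s) = 1 then 1 else (-1::int))" for s
  have \<epsilon>: "real_of_int (\<epsilon> (e i)) = \<eta> i" if "i < ?m" for i
    using e that \<eta>(1)[rule_format, of i] by (auto simp: \<epsilon>_def bij_betw_def the_inv_into_f_f)
  have sub: "{..<?m} \<subseteq> {..<p}" using assms(2) by auto
  have "(\<Sum>s\<in>S. of_int (\<epsilon> s) *\<^sub>R y s) = (\<Sum>i<?m. of_int (\<epsilon> (e i)) *\<^sub>R y (e i))"
    using sum.reindex_bij_betw[OF e, of "\<lambda>s. of_int (\<epsilon> s) *\<^sub>R y s"] by simp
  also have "\<dots> = (\<Sum>i<?m. \<eta> i *\<^sub>R z i)"
    using \<epsilon> by (intro sum.cong) (auto simp: z_def)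
  also have "\<dots> = (\<Sum>i<p. \<eta> i *\<^sub>R z i)"
    using sub by (intro sum.mono_neutral_left) (auto simp: z_def)
  finally have eq: "N (\<Sum>s\<in>S. of_int (\<epsilon> s) *\<^sub>R y s) = N (\<Sum>i<p. \<eta> i *\<^sub>R z i)" by simp
  have "(\<Sum>i<p. (N (z i))\<^sup>2) = (\<Sum>i<?m. (N (z i))\<^sup>2)"
    using sub by (intro sum.mono_neutral_right) (auto simp: z_def)
  also have "\<dots> \<le> (\<Sum>i<?m. \<gamma>\<^sup>2)"
    using y eS N_nonneg by (intro sum_mono power_mono) (auto simp: z_def)
  finally have "sqrt (\<Sum>i<p. (N (z i))\<^sup>2) \<le> sqrt (?m * \<gamma>\<^sup>2)" by simp
  also have "\<dots> = \<gamma> * sqrt ?m" using \<gamma> by (simp add: real_sqrt_mult)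
  finally have "J * sqrt (\<Sum>i<p. (N (z i))\<^sup>2) \<le> J * (\<gamma> * sqrt ?m)"
    using J_pos by (intro mult_left_mono) auto
  with \<eta>(2) eq have "N (\<Sum>s\<in>S. of_int (\<epsilon> s) *\<^sub>R y s) \<le> J * \<gamma> * sqrt ?m" by (simp add: mult.assoc)
  then show ?thesis by (intro exI[of _ \<epsilon>]) (auto simp: \<epsilon>_def)
qed

text \<open>Blocks of p vectors are signed separately and the triangle inequality adds them up: at
  most card S / p full blocks cost \<open>sqrt p\<close> each, and the incomplete block costs at
  most \<open>sqrt (card S)\<close>.\<close>

lemma signing_chunks:
  assumes "finite S" and y: "\<And>s. s \<in> S \<Longrightarrow> y s \<in> V" "\<And>s. s \<in> S \<Longrightarrow> N (y s) \<le> \<gamma>"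
  shows "\<exists>\<eta>. (\<forall>s. \<eta> s \<in> {-1, 1::int}) \<and>
    N (\<Sum>s\<in>S. of_int (\<eta> s) *\<^sub>R y s) \<le> J * \<gamma> * (card S / sqrt p + sqrt (card S))"
  using assms
proof (induction "card S" arbitrary: S rule: less_induct)
  case less
  show ?case
  proof (cases "card S \<le> p")
    case True
    from signing_small[OF less.prems(1) True, of y \<gamma>] less.prems
    obtain \<eta> where \<eta>: "\<forall>s. \<eta> s \<in> {-1, 1::int}"
      "N (\<Sum>s\<in>S. of_int (\<eta> s) *\<^sub>R y s) \<le> J * \<gamma> * sqrt (card S)" by auto
    have "J * \<gamma> * sqrt (card S) \<le> J * \<gamma> * (card S / sqrt p + sqrt (card S))"
    proof (cases "S = {}")
      case False
      then have "\<gamma> \<ge> 0" using less.prems N_nonneg by fastforce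
      then show ?thesis using J_pos by (intro mult_left_mono) auto
    qed auto
    with \<eta>(2) have "N (\<Sum>s\<in>S. of_int (\<eta> s) *\<^sub>R y s)
        \<le> J * \<gamma> * (card S / sqrt p + sqrt (card S))" by (rule order_trans)
    with \<eta>(1) show ?thesis by blast
  next
    case False
    then obtain T where T: "T \<subseteq> S" "card T = p"
      using obtain_subset_with_card_n[of p S] by auto
    have fin: "finite T" "finite (S - T)" using T less.prems finite_subset by auto
    have cardD: "card (S - T) = card S - p" using T less.prems by (simp add: card_Diff_subset fin)
    have "S \<noteq> {}" using False by auto
    then have \<gamma>: "\<gamma> \<ge> 0" using less.prems N_nonneg by fastforce
    from signing_small[OF fin(1), of y \<gamma>] T less.prems
    obtain \<eta> where \<eta>: "\<forall>s. \<eta> s \<in> {-1, 1::int}"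
      "N (\<Sum>s\<in>T. of_int (\<eta> s) *\<^sub>R y s) \<le> J * \<gamma> * sqrt p" by (auto simp: subset_iff)
    from less.hyps[OF _ fin(2)] cardD False p_pos less.prems
    obtain \<theta> where \<theta>: "\<forall>s. \<theta> s \<in> {-1, 1::int}"
      "N (\<Sum>s\<in>S-T. of_int (\<theta> s) *\<^sub>R y s)
        \<le> J * \<gamma> * (card (S-T) / sqrt p + sqrt (card (S-T)))" by auto
    define \<epsilon> where "\<epsilon> s = (if s \<in> T then \<eta> s else \<theta> s)" for s
    have "(\<Sum>s\<in>S. of_int (\<epsilon> s) *\<^sub>R y s)
        = (\<Sum>s\<in>S-T. of_int (\<epsilon> s) *\<^sub>R y s) + (\<Sum>s\<in>T. of_int (\<epsilon> s) *\<^sub>R y s)"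
      using T less.prems by (simp add: sum.subset_diff)
    also have "\<dots> = (\<Sum>s\<in>S-T. of_int (\<theta> s) *\<^sub>R y s) + (\<Sum>s\<in>T. of_int (\<eta> s) *\<^sub>R y s)"
      by (intro arg_cong2[where f = "(+)"] sum.cong) (auto simp: \<epsilon>_def)
    finally have "N (\<Sum>s\<in>S. of_int (\<epsilon> s) *\<^sub>R y s)
        \<le> N (\<Sum>s\<in>S-T. of_int (\<theta> s) *\<^sub>R y s) + N (\<Sum>s\<in>T. of_int (\<eta> s) *\<^sub>R y s)"
      using T less.prems by (simp only:) (intro N_triangle lincomb_in_V, auto)
    also have "\<dots> \<le> J * \<gamma> * (card (S-T) / sqrt p + sqrt (card (S-T))) + J * \<gamma> * sqrt p"
      using \<eta> \<theta> by linarith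
    also have "\<dots> = J * \<gamma> * (card (S-T) / sqrt p + sqrt (card (S-T)) + sqrt p)"
      by (simp add: algebra_simps)
    also have "\<dots> \<le> J * \<gamma> * (card S / sqrt p + sqrt (card S))"
    proof -
      have "real (card (S-T)) / sqrt p + sqrt p = card S / sqrt p"
        using p_pos cardD False by (simp add: field_simps of_nat_diff)
      moreover have "sqrt (card (S-T)) \<le> sqrt (card S)" using cardD by simp
      ultimately have "real (card (S-T)) / sqrt p + sqrt (card (S-T)) + sqrt p
          \<le> card S / sqrt p + sqrt (card S)" by linarith
      then show ?thesis using J_pos \<gamma> by (intro mult_left_mono) auto
    qed
    finally have "N (\<Sum>s\<in>S. of_int (\<epsilon> s) *\<^sub>R y s) \<le> J * \<gamma> * (card S / sqrt p + sqrt (card S))" .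
    then show ?thesis using \<eta> \<theta> by (intro exI[of _ \<epsilon>]) (auto simp: \<epsilon>_def)
  qed
qed

text \<open>
  Replacing c by c' makes all coefficients multiples of the doubled step. Since the signing may be
  negated, the l1 norm of the coefficients need not grow.
\<close>

lemma halve_coefficients:
  fixes c :: "'s \<Rightarrow> int"
  assumes S: "finite S" and y: "\<And>s. s \<in> S \<Longrightarrow> y s \<in> V" "\<And>s. s \<in> S \<Longrightarrow> N (y s) \<le> \<gamma>"
    and odd_le: "real (card {s \<in> S. odd (c s)}) \<le> m" and \<gamma>: "0 \<le> \<gamma>"
  shows "\<exists>c'. 2 * (\<Sum>s\<in>S. \<bar>c' s\<bar>) \<le> (\<Sum>s\<in>S. \<bar>c s\<bar>) \<and>
    N (\<Sum>s\<in>S. (of_int (c s) - 2 * of_int (c' s)) *\<^sub>R y s) \<le> J * \<gamma> * (m / sqrt p + sqrt m)"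
proof -
  let ?O = "{s \<in> S. odd (c s)}"
  obtain \<eta> where \<eta>: "\<forall>s. \<eta> s \<in> {-1, 1::int}"
    "N (\<Sum>s\<in>?O. of_int (\<eta> s) *\<^sub>R y s) \<le> J * \<gamma> * (card ?O / sqrt p + sqrt (card ?O))"
    using signing_chunks[of ?O y \<gamma>] S y by auto
  note \<eta>(2)
  also have "J * \<gamma> * (card ?O / sqrt p + sqrt (card ?O)) \<le> J * \<gamma> * (m / sqrt p + sqrt m)"
    using odd_le \<gamma> J_pos by (intro mult_left_mono add_mono divide_right_mono) auto
  finally have bound: "N (\<Sum>s\<in>?O. of_int (\<eta> s) *\<^sub>R y s) \<le> J * \<gamma> * (m / sqrt p + sqrt m)" .
  \<comment> \<open>For an odd, hence nonzero, integer c and a sign e, |c + e| = |c| + e sgn c. The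
    global sign is chosen to make the sum of these increments nonpositive.\<close>
  have "\<exists>\<theta>\<in>{-1, 1}. (\<Sum>s\<in>?O. \<theta> * \<eta> s * sgn (c s)) \<le> 0"
  proof (cases "(\<Sum>s\<in>?O. \<eta> s * sgn (c s)) \<le> 0")
    case False
    then show ?thesis by (intro bexI[of _ "-1"]) (auto simp: sum_negf)
  qed auto
  then obtain \<theta> :: int where \<theta>: "\<theta> \<in> {-1, 1}" "(\<Sum>s\<in>?O. \<theta> * \<eta> s * sgn (c s)) \<le> 0" by blast
  define \<epsilon> where "\<epsilon> s = \<theta> * \<eta> s" for s
  have \<epsilon>: "\<epsilon> s = 1 \<or> \<epsilon> s = -1" for s using \<theta>(1) \<eta>(1)[rule_format, of s] by (auto simp: \<epsilon>_def)
  define c' where "c' s = (if odd (c s) then (c s + \<epsilon> s) div 2 else c s div 2)" for s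
  have c'_odd: "2 * c' s = c s + \<epsilon> s" if "odd (c s)" for s
  proof -
    have "even (c s + \<epsilon> s)" using that \<epsilon>[of s] by auto
    then show ?thesis using that by (simp add: c'_def)
  qed
  have c'_even: "2 * c' s = c s" if "even (c s)" for s
    using that by (auto simp: c'_def)
  have abs: "2 * \<bar>c' s\<bar> = \<bar>c s\<bar> + (if odd (c s) then \<epsilon> s * sgn (c s) else 0)" for s
  proof (cases "odd (c s)")
    case True
    then have "c s \<noteq> 0" by auto
    have "2 * \<bar>c' s\<bar> = \<bar>2 * c' s\<bar>" by simp
    also have "\<dots> = \<bar>c s + \<epsilon> s\<bar>" using c'_odd[OF True] by simp
    also have "\<dots> = \<bar>c s\<bar> + \<epsilon> s * sgn (c s)"
      using \<open>c s \<noteq> 0\<close> \<epsilon>[of s] by (auto simp: sgn_if)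
    finally show ?thesis using True by simp
  next
    case False
    have "2 * \<bar>c' s\<bar> = \<bar>2 * c' s\<bar>" by simp
    then show ?thesis using False c'_even[of s] by simp
  qed
  have "2 * (\<Sum>s\<in>S. \<bar>c' s\<bar>) = (\<Sum>s\<in>S. \<bar>c s\<bar>) + (\<Sum>s\<in>?O. \<epsilon> s * sgn (c s))"
    using S by (simp add: sum_distrib_left abs sum.distrib sum.inter_filter[symmetric])
  also have "\<dots> \<le> (\<Sum>s\<in>S. \<bar>c s\<bar>)" using \<theta>(2) by (simp add: \<epsilon>_def)
  finally have l1: "2 * (\<Sum>s\<in>S. \<bar>c' s\<bar>) \<le> (\<Sum>s\<in>S. \<bar>c s\<bar>)" .
  have coeff: "real_of_int (c s) - 2 * real_of_int (c' s)
      = (if odd (c s) then - of_int (\<epsilon> s) else 0)" for s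
  proof -
    have "real_of_int (c s) - 2 * real_of_int (c' s) = of_int (c s - 2 * c' s)" by simp
    also have "c s - 2 * c' s = (if odd (c s) then - \<epsilon> s else 0)"
      using c'_odd[of s] c'_even[of s] by auto
    finally show ?thesis by simp
  qed
  have "(\<Sum>s\<in>S. (of_int (c s) - 2 * of_int (c' s)) *\<^sub>R y s)
      = (\<Sum>s\<in>?O. - of_int (\<epsilon> s) *\<^sub>R y s)"
    using S by (simp add: coeff sum.inter_filter if_distrib[of "\<lambda>a. a *\<^sub>R _"] cong: if_cong)
  also have "\<dots> = - of_int \<theta> *\<^sub>R (\<Sum>s\<in>?O. of_int (\<eta> s) *\<^sub>R y s)"
    by (simp add: \<epsilon>_def scaleR_sum_right sum_negf)
  finally have "N (\<Sum>s\<in>S. (of_int (c s) - 2 * of_int (c' s)) *\<^sub>R y s)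
      = \<bar>- of_int \<theta>\<bar> * N (\<Sum>s\<in>?O. of_int (\<eta> s) *\<^sub>R y s)"
    using y by (simp only:) (intro N_scaleR lincomb_in_V, auto)
  then have "N (\<Sum>s\<in>S. (of_int (c s) - 2 * of_int (c' s)) *\<^sub>R y s)
      = N (\<Sum>s\<in>?O. of_int (\<eta> s) *\<^sub>R y s)" using \<theta>(1) by auto
  then show ?thesis using l1 bound by (intro exI[of _ c']) auto
qed

text \<open>Rounding errors accumulate this way: a is the error so far, k the current grid step, and
  b the error of the next rounding measured in units of that step.\<close>

lemma N_chain:
  assumes "\<And>s. s \<in> S \<Longrightarrow> y s \<in> V" "\<And>s. s \<in> S \<Longrightarrow> d s = a s + k * b s"
  shows "N (\<Sum>s\<in>S. d s *\<^sub>R y s) \<le> N (\<Sum>s\<in>S. a s *\<^sub>R y s) + \<bar>k\<bar> * N (\<Sum>s\<in>S. b s *\<^sub>R y s)"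
proof -
  have "(\<Sum>s\<in>S. d s *\<^sub>R y s) = (\<Sum>s\<in>S. a s *\<^sub>R y s) + k *\<^sub>R (\<Sum>s\<in>S. b s *\<^sub>R y s)"
    using assms(2) by (simp add: scaleR_sum_right sum.distrib[symmetric] algebra_simps)
  then show ?thesis
    using N_triangle[of "\<Sum>s\<in>S. a s *\<^sub>R y s" "k *\<^sub>R (\<Sum>s\<in>S. b s *\<^sub>R y s)"]
      N_scaleR[of "\<Sum>s\<in>S. b s *\<^sub>R y s" k] lincomb_in_V[of S y] assms(1)
      subspace_scale[OF subspace_V] by auto
qed

text \<open>Coefficients are counted in units of 2^-q and brought to unit grid. All of S may be
  signed each time, but the step doubles, so the errors form a geometric series controlled by its
  last term.\<close>

lemma fine_rounding:
  fixes c :: "'s \<Rightarrow> int"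
  assumes S: "finite S" and y: "\<And>s. s \<in> S \<Longrightarrow> y s \<in> V" "\<And>s. s \<in> S \<Longrightarrow> N (y s) \<le> \<gamma>"
    and \<gamma>: "0 \<le> \<gamma>"
  shows "\<exists>c'. 2 ^ q * (\<Sum>s\<in>S. \<bar>c' s\<bar>) \<le> (\<Sum>s\<in>S. \<bar>c s\<bar>) \<and>
    N (\<Sum>s\<in>S. (of_int (c s) - 2 ^ q * of_int (c' s)) *\<^sub>R y s)
      \<le> 2 ^ q * (J * \<gamma> * (card S / sqrt p + sqrt (card S)))"
proof (induction q)
  case 0
  show ?case using J_pos \<gamma> by (intro exI[of _ c]) auto
next
  case (Suc q)
  let ?K = "J * \<gamma> * (card S / sqrt p + sqrt (card S))"
  from Suc obtain c' where c': "2 ^ q * (\<Sum>s\<in>S. \<bar>c' s\<bar>) \<le> (\<Sum>s\<in>S. \<bar>c s\<bar>)"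
    "N (\<Sum>s\<in>S. (of_int (c s) - 2 ^ q * of_int (c' s)) *\<^sub>R y s) \<le> 2 ^ q * ?K" by blast
  have "real (card {s \<in> S. odd (c' s)}) \<le> card S" using S by (simp add: card_mono)
  from halve_coefficients[where y = y and c = c' and \<gamma> = \<gamma>, OF S y this \<gamma>] obtain c'' where
    c'': "2 * (\<Sum>s\<in>S. \<bar>c'' s\<bar>) \<le> (\<Sum>s\<in>S. \<bar>c' s\<bar>)"
    "N (\<Sum>s\<in>S. (of_int (c' s) - 2 * of_int (c'' s)) *\<^sub>R y s) \<le> ?K" by blast
  have "2 ^ Suc q * (\<Sum>s\<in>S. \<bar>c'' s\<bar>) = 2 ^ q * (2 * (\<Sum>s\<in>S. \<bar>c'' s\<bar>))" by simp
  also have "\<dots> \<le> 2 ^ q * (\<Sum>s\<in>S. \<bar>c' s\<bar>)" using c''(1) by (intro mult_left_mono) auto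
  also note c'(1)
  finally have 1: "2 ^ Suc q * (\<Sum>s\<in>S. \<bar>c'' s\<bar>) \<le> (\<Sum>s\<in>S. \<bar>c s\<bar>)" .
  have "N (\<Sum>s\<in>S. (of_int (c s) - 2 ^ Suc q * of_int (c'' s)) *\<^sub>R y s)
      \<le> N (\<Sum>s\<in>S. (of_int (c s) - 2 ^ q * of_int (c' s)) *\<^sub>R y s)
        + \<bar>2 ^ q\<bar> * N (\<Sum>s\<in>S. (of_int (c' s) - 2 * of_int (c'' s)) *\<^sub>R y s)"
    using y by (intro N_chain) (auto simp: algebra_simps)
  also have "\<dots> \<le> 2 ^ q * ?K + \<bar>2 ^ q\<bar> * ?K"
    using c'(2) c''(2) by (intro add_mono mult_left_mono) auto
  finally show ?case using 1 by (intro exI[of _ c'']) (auto simp: algebra_simps)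
qed

text \<open>Beyond the unit grid the l1 bound takes over: at step 2^l at most m / 2^l coefficients
  are odd. The block part of the error is then the same, m / sqrt p, at every level and adds up
  linearly, while the square root part grows geometrically with ratio \<open>sqrt 2\<close>.\<close>

lemma coarse_rounding:
  fixes c :: "'s \<Rightarrow> int"
  assumes S: "finite S" and y: "\<And>s. s \<in> S \<Longrightarrow> y s \<in> V" "\<And>s. s \<in> S \<Longrightarrow> N (y s) \<le> \<gamma>"
    and \<gamma>: "0 \<le> \<gamma>" and c: "real_of_int (\<Sum>s\<in>S. \<bar>c s\<bar>) \<le> m"
  shows "\<exists>c'. real_of_int (\<Sum>s\<in>S. \<bar>c' s\<bar>) \<le> m / 2 ^ l \<and>
    N (\<Sum>s\<in>S. (of_int (c s) - 2 ^ l * of_int (c' s)) *\<^sub>R y s)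
      \<le> J * \<gamma> * (l * m / sqrt p + 3 * sqrt m * sqrt 2 ^ l)"
proof (induction l)
  case 0
  have "m \<ge> 0" using c by (smt (verit) of_int_0_le_iff sum_nonneg abs_ge_zero)
  then show ?case using J_pos \<gamma> c by (intro exI[of _ c]) auto
next
  case (Suc l)
  then obtain c' where c': "real_of_int (\<Sum>s\<in>S. \<bar>c' s\<bar>) \<le> m / 2 ^ l"
    "N (\<Sum>s\<in>S. (of_int (c s) - 2 ^ l * of_int (c' s)) *\<^sub>R y s)
      \<le> J * \<gamma> * (l * m / sqrt p + 3 * sqrt m * sqrt 2 ^ l)" by blast
  have m0: "m \<ge> 0" using c by (smt (verit) of_int_0_le_iff sum_nonneg abs_ge_zero)
  let ?O = "{s \<in> S. odd (c' s)}"
  have "int (card ?O) = (\<Sum>s\<in>?O. 1)" by simp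
  also have "\<dots> \<le> (\<Sum>s\<in>?O. \<bar>c' s\<bar>)"
  proof (rule sum_mono)
    fix s assume "s \<in> ?O"
    then have "c' s \<noteq> 0" by auto
    then show "1 \<le> \<bar>c' s\<bar>" by linarith
  qed
  also have "\<dots> \<le> (\<Sum>s\<in>S. \<bar>c' s\<bar>)" using S by (intro sum_mono2) auto
  finally have "real (card ?O) \<le> m / 2 ^ l" using c'(1) by linarith
  from halve_coefficients[where y = y and c = c' and \<gamma> = \<gamma>, OF S y this \<gamma>] obtain c'' where
    c'': "2 * (\<Sum>s\<in>S. \<bar>c'' s\<bar>) \<le> (\<Sum>s\<in>S. \<bar>c' s\<bar>)"
    "N (\<Sum>s\<in>S. (of_int (c' s) - 2 * of_int (c'' s)) *\<^sub>R y s)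
      \<le> J * \<gamma> * (m / 2 ^ l / sqrt p + sqrt (m / 2 ^ l))" by blast
  have "2 * real_of_int (\<Sum>s\<in>S. \<bar>c'' s\<bar>) \<le> real_of_int (\<Sum>s\<in>S. \<bar>c' s\<bar>)"
    using c''(1) by (metis of_int_le_iff of_int_mult of_int_numeral)
  then have "2 * real_of_int (\<Sum>s\<in>S. \<bar>c'' s\<bar>) \<le> m / 2 ^ l" using c'(1) by linarith
  then have 1: "real_of_int (\<Sum>s\<in>S. \<bar>c'' s\<bar>) \<le> m / 2 ^ Suc l"
    by (simp add: field_simps del: of_int_sum)
  have s2: "2 ^ l / sqrt (2 ^ l) = sqrt (2::real) ^ l"
    by (simp add: real_sqrt_power real_div_sqrt flip: real_sqrt_power)
  have "N (\<Sum>s\<in>S. (of_int (c s) - 2 ^ Suc l * of_int (c'' s)) *\<^sub>R y s)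
      \<le> N (\<Sum>s\<in>S. (of_int (c s) - 2 ^ l * of_int (c' s)) *\<^sub>R y s)
        + \<bar>2 ^ l\<bar> * N (\<Sum>s\<in>S. (of_int (c' s) - 2 * of_int (c'' s)) *\<^sub>R y s)"
    using y by (intro N_chain) (auto simp: algebra_simps)
  also have "\<dots> \<le> J * \<gamma> * (l * m / sqrt p + 3 * sqrt m * sqrt 2 ^ l)
      + \<bar>2 ^ l\<bar> * (J * \<gamma> * (m / 2 ^ l / sqrt p + sqrt (m / 2 ^ l)))"
    using c'(2) c''(2) by (intro add_mono mult_left_mono) auto
  also have "\<dots> = J * \<gamma> * (Suc l * m / sqrt p + (3 * sqrt m * sqrt 2 ^ l + sqrt m * (2 ^ l / sqrt (2 ^ l))))"
    by (simp add: real_sqrt_divide algebra_simps add_divide_distrib)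
  also have "\<dots> = J * \<gamma> * (Suc l * m / sqrt p + 4 * (sqrt m * sqrt 2 ^ l))"
    unfolding s2 by (simp add: algebra_simps)
  also have "\<dots> \<le> J * \<gamma> * (Suc l * m / sqrt p + 3 * sqrt m * sqrt 2 ^ Suc l)"
  proof -
    \<comment> \<open>The constant 3 closes the induction because 3 + 1 is at most 3 sqrt 2.\<close>
    have "4 / 3 \<le> sqrt (2::real)" by (rule real_le_rsqrt) (simp add: power2_eq_square)
    then have "4 * (sqrt m * sqrt 2 ^ l) \<le> (3 * sqrt 2) * (sqrt m * sqrt 2 ^ l)"
      using m0 by (intro mult_right_mono) auto
    then show ?thesis using J_pos \<gamma> by (intro mult_left_mono add_left_mono) (auto simp: algebra_simps)
  qed
  finally show ?case using 1 by (intro exI[of _ c'']) auto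
qed

text \<open>Multiplying by \<open>sqrt M\<close> turns the Euclidean unit ball into vectors of l1
  norm at most M, by Cauchy-Schwarz. They are truncated to a very fine grid, brought to the unit
  grid, and then to the grid of step 2^l.\<close>

lemma rounding:
  assumes S: "finite S" "S \<noteq> {}" and y: "\<And>s. s \<in> S \<Longrightarrow> y s \<in> V" "\<And>s. s \<in> S \<Longrightarrow> N (y s) \<le> \<gamma>"
    and b: "(\<Sum>s\<in>S. (b s)\<^sup>2) \<le> 1"
  defines "M \<equiv> real (card S)"
  shows "\<exists>c. real_of_int (\<Sum>s\<in>S. \<bar>c s\<bar>) \<le> M / 2 ^ l \<and>
    N (\<Sum>s\<in>S. (sqrt M * b s - 2 ^ l * of_int (c s)) *\<^sub>R y s)
      \<le> J * \<gamma> * ((real l + 2) * M / sqrt p + 4 * sqrt M * sqrt 2 ^ l)"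
proof -
  have M: "M > 0" using S by (simp add: M_def card_gt_0_iff)
  have \<gamma>: "\<gamma> \<ge> 0" using S y N_nonneg by fastforce
  have "0 < J / sqrt p" using J_pos p_pos by simp
  \<comment> \<open>With grid 2^-q below J / sqrt p, even the plain triangle inequality over all M
    vectors makes the truncation cost no more than the block term M / sqrt p.\<close>
  then obtain q where q: "(1/2::real) ^ q < J / sqrt p"
    using real_arch_pow_inv[of "J / sqrt p" "1/2"] by auto
  \<comment> \<open>Truncation is towards zero, so that the l1 norm cannot grow.\<close>
  define c0 where "c0 s = (if b s \<ge> 0 then \<lfloor>\<bar>sqrt M * b s\<bar> * 2 ^ q\<rfloor> else - \<lfloor>\<bar>sqrt M * b s\<bar> * 2 ^ q\<rfloor>)" for s
  have c0_abs: "\<bar>c0 s\<bar> = \<lfloor>\<bar>sqrt M * b s\<bar> * 2 ^ q\<rfloor>" for s by (auto simp: c0_def)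
  have c0_near: "\<bar>sqrt M * b s - of_int (c0 s) / 2 ^ q\<bar> \<le> (1/2) ^ q" for s
  proof -
    define t where "t = \<bar>sqrt M * b s\<bar> * 2 ^ q"
    have "\<bar>sqrt M * b s - of_int (c0 s) / 2 ^ q\<bar> = \<bar>t - of_int \<lfloor>t\<rfloor>\<bar> / 2 ^ q"
    proof (cases "b s \<ge> 0")
      case True
      then have "sqrt M * b s = t / 2 ^ q" using M by (simp add: t_def)
      moreover have "c0 s = \<lfloor>t\<rfloor>" using True by (simp add: c0_def t_def)
      ultimately show ?thesis by (simp flip: diff_divide_distrib)
    next
      case False
      then have "sqrt M * b s < 0" using M by (simp add: mult_pos_neg)
      then have "sqrt M * b s = - t / 2 ^ q" by (simp add: t_def)
      then have "sqrt M * b s - of_int (c0 s) / 2 ^ q = - ((t - of_int \<lfloor>t\<rfloor>) / 2 ^ q)"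
        using False by (simp add: c0_def diff_divide_distrib t_def)
      then show ?thesis by simp
    qed
    also have "\<dots> \<le> 1 / 2 ^ q" by (intro divide_right_mono) (linarith, simp)
    finally show ?thesis by (simp add: power_one_over)
  qed
  have "(\<Sum>s\<in>S. \<bar>b s\<bar>) \<le> sqrt M"
  proof -
    have "(\<Sum>s\<in>S. \<bar>b s\<bar>)\<^sup>2 \<le> (\<Sum>s\<in>S. \<bar>b s\<bar>\<^sup>2) * (\<Sum>s\<in>S. 1\<^sup>2)"
      using Cauchy_Schwarz_ineq_sum[of "\<lambda>s. \<bar>b s\<bar>" "\<lambda>_. 1" S] by simp
    also have "\<dots> \<le> 1 * M" using b by (intro mult_mono) (auto simp: M_def sum_nonneg)
    finally show ?thesis by (intro real_le_rsqrt) auto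
  qed
  then have "2 ^ q * (sqrt M * (\<Sum>s\<in>S. \<bar>b s\<bar>)) \<le> 2 ^ q * (sqrt M * sqrt M)"
    using M by (intro mult_left_mono) auto
  moreover have "real_of_int (\<Sum>s\<in>S. \<bar>c0 s\<bar>) \<le> 2 ^ q * (sqrt M * (\<Sum>s\<in>S. \<bar>b s\<bar>))"
    unfolding of_int_sum sum_distrib_left c0_abs
    using M by (intro sum_mono) (auto intro: order_trans[OF of_int_floor_le] simp: abs_mult algebra_simps)
  moreover have "sqrt M * sqrt M = M" using M by simp
  ultimately have c0: "real_of_int (\<Sum>s\<in>S. \<bar>c0 s\<bar>) \<le> 2 ^ q * M" by (metis order_trans)
  from fine_rounding[where y = y and c = c0 and q = q and \<gamma> = \<gamma>, OF S(1) y \<gamma>] obtain c1 where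
    c1: "2 ^ q * (\<Sum>s\<in>S. \<bar>c1 s\<bar>) \<le> (\<Sum>s\<in>S. \<bar>c0 s\<bar>)"
    "N (\<Sum>s\<in>S. (of_int (c0 s) - 2 ^ q * of_int (c1 s)) *\<^sub>R y s)
      \<le> 2 ^ q * (J * \<gamma> * (M / sqrt p + sqrt M))" unfolding M_def by blast
  have "real_of_int (2 ^ q * (\<Sum>s\<in>S. \<bar>c1 s\<bar>)) \<le> 2 ^ q * M"
    using c1(1) c0 by linarith
  then have c1_le: "real_of_int (\<Sum>s\<in>S. \<bar>c1 s\<bar>) \<le> M" by simp
  from coarse_rounding[where y = y and \<gamma> = \<gamma> and l = l, OF S(1) y \<gamma> c1_le] obtain c2 where
    c2: "real_of_int (\<Sum>s\<in>S. \<bar>c2 s\<bar>) \<le> M / 2 ^ l"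
    "N (\<Sum>s\<in>S. (of_int (c1 s) - 2 ^ l * of_int (c2 s)) *\<^sub>R y s)
      \<le> J * \<gamma> * (l * M / sqrt p + 3 * sqrt M * sqrt 2 ^ l)" by blast
  have "N (\<Sum>s\<in>S. (sqrt M * b s - of_int (c0 s) / 2 ^ q) *\<^sub>R y s)
      \<le> (\<Sum>s\<in>S. \<bar>sqrt M * b s - of_int (c0 s) / 2 ^ q\<bar> * N (y s))"
    using y by (intro N_sum)
  also have "\<dots> \<le> (\<Sum>s\<in>S. (J / sqrt p) * \<gamma>)"
    using order_trans[OF c0_near less_imp_le[OF q]] y N_nonneg \<gamma> J_pos
    by (intro sum_mono mult_mono) auto
  also have "\<dots> = J * \<gamma> * (M / sqrt p)" by (simp add: M_def)
  finally have e0: "N (\<Sum>s\<in>S. (sqrt M * b s - of_int (c0 s) / 2 ^ q) *\<^sub>R y s) \<le> J * \<gamma> * (M / sqrt p)" .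
  have "N (\<Sum>s\<in>S. (sqrt M * b s - of_int (c1 s)) *\<^sub>R y s)
      \<le> N (\<Sum>s\<in>S. (sqrt M * b s - of_int (c0 s) / 2 ^ q) *\<^sub>R y s)
        + \<bar>1 / 2 ^ q\<bar> * N (\<Sum>s\<in>S. (of_int (c0 s) - 2 ^ q * of_int (c1 s)) *\<^sub>R y s)"
    using y by (intro N_chain) (auto simp: field_simps)
  also have "\<dots> \<le> J * \<gamma> * (M / sqrt p) + \<bar>1 / 2 ^ q\<bar> * (2 ^ q * (J * \<gamma> * (M / sqrt p + sqrt M)))"
    using e0 c1(2) by (intro add_mono mult_left_mono) auto
  also have "\<dots> = J * \<gamma> * (2 * M / sqrt p + sqrt M)" by (simp add: algebra_simps)
  finally have e1: "N (\<Sum>s\<in>S. (sqrt M * b s - of_int (c1 s)) *\<^sub>R y s)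
    \<le> J * \<gamma> * (2 * M / sqrt p + sqrt M)" .
  have "N (\<Sum>s\<in>S. (sqrt M * b s - 2 ^ l * of_int (c2 s)) *\<^sub>R y s)
      \<le> N (\<Sum>s\<in>S. (sqrt M * b s - of_int (c1 s)) *\<^sub>R y s)
        + \<bar>1\<bar> * N (\<Sum>s\<in>S. (of_int (c1 s) - 2 ^ l * of_int (c2 s)) *\<^sub>R y s)"
    using y by (intro N_chain) auto
  also have "\<dots> \<le> J * \<gamma> * (2 * M / sqrt p + sqrt M) + J * \<gamma> * (l * M / sqrt p + 3 * sqrt M * sqrt 2 ^ l)"
    using e1 c2(2) by simp
  also have "\<dots> = J * \<gamma> * ((real l + 2) * M / sqrt p + (sqrt M + 3 * sqrt M * sqrt 2 ^ l))"
    by (simp add: algebra_simps add_divide_distrib)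
  also have "\<dots> \<le> J * \<gamma> * ((real l + 2) * M / sqrt p + 4 * sqrt M * sqrt 2 ^ l)"
  proof -
    have "1 \<le> sqrt (2::real) ^ l" by (intro one_le_power) simp
    then have "sqrt M * 1 \<le> sqrt M * sqrt 2 ^ l" using M by (intro mult_left_mono) auto
    then show ?thesis using J_pos \<gamma> by (intro mult_left_mono add_left_mono) auto
  qed
  finally have "N (\<Sum>s\<in>S. (sqrt M * b s - 2 ^ l * of_int (c2 s)) *\<^sub>R y s)
      \<le> J * \<gamma> * ((real l + 2) * M / sqrt p + 4 * sqrt M * sqrt 2 ^ l)" .
  with c2(1) show ?thesis by (intro exI[of _ c2] conjI)
qed

end

section \<open>Counting integer vectors of small l1 norm\<close>

lemma sum_geometric_two_sided:
  fixes x :: real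
  assumes "0 \<le> x" "x \<le> 1/2"
  shows "(\<Sum>j\<in>{- int k..int k}. x ^ nat \<bar>j\<bar>) \<le> 1 + 4 * x - 4 * x ^ Suc k"
proof (induction k)
  case (Suc k)
  have "{- int (Suc k)..int (Suc k)} = insert (int (Suc k)) (insert (- int (Suc k)) {- int k..int k})"
    by auto
  then have "(\<Sum>j\<in>{- int (Suc k)..int (Suc k)}. x ^ nat \<bar>j\<bar>)
      = 2 * x ^ Suc k + (\<Sum>j\<in>{- int k..int k}. x ^ nat \<bar>j\<bar>)"
    by (simp add: nat_add_distrib)
  also have "\<dots> \<le> 2 * x ^ Suc k + (1 + 4 * x - 4 * x ^ Suc k)" using Suc by simp
  \<comment> \<open>The subtracted power is the slack that pays for the two new terms: 4 x^(k+2) is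
    at most 2 x^(k+1) since x is at most 1/2.\<close>
  also have "\<dots> \<le> 1 + 4 * x - 4 * x ^ Suc (Suc k)"
    using assms mult_right_mono[of x "1/2" "x ^ Suc k"] by simp
  finally show ?case .
qed auto

lemma finite_sparse_integer_vectors:
  fixes \<kappa> :: real
  assumes "finite S"
  defines "C \<equiv> {c \<in> S \<rightarrow>\<^sub>E (UNIV :: int set). real_of_int (\<Sum>s\<in>S. \<bar>c s\<bar>) \<le> \<kappa>}"
  shows "finite C"
    and "C \<subseteq> S \<rightarrow>\<^sub>E {- int (nat \<lfloor>\<kappa>\<rfloor>)..int (nat \<lfloor>\<kappa>\<rfloor>)}"
proof -
  have "\<bar>c s\<bar> \<le> int (nat \<lfloor>\<kappa>\<rfloor>)" if "c \<in> C" "s \<in> S" for c s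
  proof -
    have "\<bar>c s\<bar> \<le> (\<Sum>s\<in>S. \<bar>c s\<bar>)" using assms that by (intro member_le_sum) auto
    moreover have "(\<Sum>s\<in>S. \<bar>c s\<bar>) \<le> \<lfloor>\<kappa>\<rfloor>" using that by (simp add: C_def le_floor_iff)
    ultimately show ?thesis by linarith
  qed
  note abs_le = this
  show sub: "C \<subseteq> S \<rightarrow>\<^sub>E {- int (nat \<lfloor>\<kappa>\<rfloor>)..int (nat \<lfloor>\<kappa>\<rfloor>)}"
  proof
    fix c assume c: "c \<in> C"
    then have "c s = undefined" if "s \<notin> S" for s using that by (auto simp: C_def PiE_iff extensional_def)
    moreover have "c s \<in> {- int (nat \<lfloor>\<kappa>\<rfloor>)..int (nat \<lfloor>\<kappa>\<rfloor>)}" if "s \<in> S" for s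
      using abs_le[OF c that] unfolding atLeastAtMost_iff by linarith
    ultimately show "c \<in> S \<rightarrow>\<^sub>E {- int (nat \<lfloor>\<kappa>\<rfloor>)..int (nat \<lfloor>\<kappa>\<rfloor>)}" by (intro PiE_I)
  qed
  show "finite C" by (rule finite_subset[OF sub]) (intro finite_PiE assms, auto)
qed

text \<open>A generating function bound: weight each c by x to the power of its l1 norm. Every
  counted vector has weight at least x^\<kappa>, and the total weight factorizes over S into
  two-sided geometric sums.\<close>

lemma card_sparse_integer_vectors:
  fixes l :: nat and \<kappa> :: real
  assumes S: "finite S"
  defines "\<kappa> \<equiv> real (card S) / 2 ^ l"
  shows "card {c \<in> S \<rightarrow>\<^sub>E (UNIV :: int set). real_of_int (\<Sum>s\<in>S. \<bar>c s\<bar>) \<le> \<kappa>} \<le> exp (\<kappa> * (real l + 3))"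
proof -
  let ?C = "{c \<in> S \<rightarrow>\<^sub>E (UNIV :: int set). real_of_int (\<Sum>s\<in>S. \<bar>c s\<bar>) \<le> \<kappa>}"
  define k where "k = nat \<lfloor>\<kappa>\<rfloor>"
  define a where "a = (l + 1) * ln (2::real)"
  \<comment> \<open>With x = 2^-(l+1) the total weight is at most exp (4 x card S) = exp (2
    \<kappa>), while 1 / x costs only a factor of order l in the exponent.\<close>
  define x where "x = exp (- a)"
  have "exp (real (l + 1) * ln 2) = (2::real) ^ (l + 1)" by (subst exp_of_nat_mult) simp
  then have "x = (1/2) ^ (l + 1)"
    by (simp add: x_def a_def exp_minus power_one_over inverse_eq_divide)
  then have x: "0 \<le> x" "x \<le> 1/2" "x = 1 / (2 * 2 ^ l)"
    using power_decreasing[of 1 "l + 1" "1/2::real"] by (auto simp: power_one_over)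
  have w: "exp (- (a * \<kappa>)) \<le> (\<Prod>s\<in>S. x ^ nat \<bar>c s\<bar>)" if "c \<in> ?C" for c
  proof -
    have "(\<Prod>s\<in>S. x ^ nat \<bar>c s\<bar>) = exp (- (a * real_of_int (\<Sum>s\<in>S. \<bar>c s\<bar>)))"
      unfolding x_def using S
      by (simp add: exp_of_nat_mult[symmetric] exp_sum[symmetric] sum_negf sum_distrib_left mult.commute)
    moreover have "a * real_of_int (\<Sum>s\<in>S. \<bar>c s\<bar>) \<le> a * \<kappa>"
      using that by (intro mult_left_mono) (auto simp: a_def)
    ultimately show ?thesis by simp
  qed
  have "card ?C * exp (- (a * \<kappa>)) = (\<Sum>c\<in>?C. exp (- (a * \<kappa>)))" by simp
  also have "\<dots> \<le> (\<Sum>c\<in>?C. \<Prod>s\<in>S. x ^ nat \<bar>c s\<bar>)" using w by (intro sum_mono)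
  also have "\<dots> \<le> (\<Sum>c\<in>S \<rightarrow>\<^sub>E {- int k..int k}. \<Prod>s\<in>S. x ^ nat \<bar>c s\<bar>)"
    using finite_sparse_integer_vectors(2)[OF S, of \<kappa>] S x
    by (intro sum_mono2) (auto intro!: finite_PiE prod_nonneg simp: k_def)
  also have "\<dots> = (\<Prod>s\<in>S. \<Sum>j\<in>{- int k..int k}. x ^ nat \<bar>j\<bar>)"
    using S by (subst prod_sum_PiE) auto
  also have "\<dots> \<le> (\<Prod>s\<in>S. exp (4 * x))"
  proof (intro prod_mono conjI)
    have "(\<Sum>j\<in>{- int k..int k}. x ^ nat \<bar>j\<bar>) \<le> 1 + 4 * x"
      using sum_geometric_two_sided[OF x(1,2), of k] x by (smt (verit) zero_le_power)
    then show "(\<Sum>j\<in>{- int k..int k}. x ^ nat \<bar>j\<bar>) \<le> exp (4 * x)"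
      using exp_ge_add_one_self[of "4 * x"] by linarith
  qed (auto intro!: sum_nonneg simp: x)
  also have "\<dots> = exp (2 * \<kappa>)"
    by (simp add: exp_of_nat_mult[symmetric] \<kappa>_def x(3))
  finally have "card ?C * exp (- (a * \<kappa>)) \<le> exp (2 * \<kappa>)" .
  then have "card ?C * exp (- (a * \<kappa>)) * exp (a * \<kappa>) \<le> exp (2 * \<kappa>) * exp (a * \<kappa>)"
    by (intro mult_right_mono) auto
  then have "card ?C \<le> exp (2 * \<kappa> + a * \<kappa>)"
    by (simp add: mult.assoc exp_add[symmetric])
  also have "\<dots> \<le> exp (\<kappa> * (real l + 3))"
  proof -
    have "ln (2::real) \<le> 1" using ln_2_less_1 by simp
    then have "a \<le> real (l + 1)"
      unfolding a_def using mult_left_mono[of "ln 2" 1 "real (l + 1)"] by simp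
    then have "a * \<kappa> \<le> real (l + 1) * \<kappa>" by (intro mult_right_mono) (auto simp: \<kappa>_def)
    then show ?thesis by (simp add: algebra_simps)
  qed
  finally show ?thesis .
qed

section \<open>Convexly separated subfamilies\<close>

lemma L2_set_sq: "(L2_set f A)\<^sup>2 = (\<Sum>s\<in>A. (f s)\<^sup>2)"
  by (simp add: L2_set_def sum_nonneg)

lemma sum_mult_le_L2_set: "(\<Sum>s\<in>A. f s * g s) \<le> L2_set f A * L2_set g A"
  by (rule order_trans[OF _ L2_set_mult_ineq]) (auto intro!: sum_mono simp flip: abs_mult)

lemma L2_set_scale: "L2_set (\<lambda>s. c * f s) A = \<bar>c\<bar> * L2_set f A"
  by (simp add: L2_set_def power_mult_distrib real_sqrt_mult flip: sum_distrib_left)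

lemma L2_set_minus_commute: "L2_set (\<lambda>s. f s - g s) A = L2_set (\<lambda>s. g s - f s) A"
  by (simp add: L2_set_def power2_commute)

lemma L2_set_diff_le: "L2_set (\<lambda>s. f s - g s) A \<le> L2_set f A + L2_set g A"
  using L2_set_triangle_ineq[of f "\<lambda>s. - g s" A] by (simp add: L2_set_def)

text \<open>
  Frank-Wolfe iteration: no point of S lies strictly behind t in the direction of the accumulated
  error, which therefore grows like the square root of the number of steps, up to \<delta> per step.
\<close>

lemma frank_wolfe:
  fixes z :: "'a \<Rightarrow> 's \<Rightarrow> real" and k :: nat
  assumes near: "\<And>b. L2_set b I \<le> 1 \<Longrightarrow> \<exists>i\<in>S. (\<Sum>s\<in>I. b s * (t s - z i s)) < \<delta>"
    and D: "\<And>i. i \<in> S \<Longrightarrow> L2_set (\<lambda>s. z i s - t s) I \<le> D"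
    and nonneg: "0 \<le> \<delta>" "0 \<le> D"
  shows "\<exists>\<kappa>. (\<forall>j<k. \<kappa> j \<in> S) \<and>
    L2_set (\<lambda>s. \<Sum>j<k. z (\<kappa> j) s - t s) I \<le> \<delta> * k + D * sqrt k"
proof (induction k)
  case 0
  show ?case by (simp add: L2_set_def)
next
  case (Suc k)
  then obtain \<kappa> where \<kappa>: "\<forall>j<k. \<kappa> j \<in> S"
    "L2_set (\<lambda>s. \<Sum>j<k. z (\<kappa> j) s - t s) I \<le> \<delta> * k + D * sqrt k" by blast
  define \<rho> where "\<rho> s = (\<Sum>j<k. z (\<kappa> j) s - t s)" for s
  define a where "a = L2_set \<rho> I"
  have a: "0 \<le> a" "a \<le> \<delta> * k + D * sqrt k" using \<kappa>(2) by (auto simp: a_def \<rho>_def[abs_def])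
  \<comment> \<open>The test direction is the normalized negative error. If a = 0 it is the zero
    vector by the convention for division, and the cross term vanishes by Cauchy-Schwarz.\<close>
  have "L2_set (\<lambda>s. - (1 / a) * \<rho> s) I \<le> 1"
    unfolding L2_set_scale using a(1) by (simp add: a_def)
  from near[OF this] obtain i where i: "i \<in> S" "(\<Sum>s\<in>I. - (1 / a) * \<rho> s * (t s - z i s)) < \<delta>" by blast
  define d where "d s = z i s - t s" for s
  have cross: "(\<Sum>s\<in>I. \<rho> s * d s) \<le> \<delta> * a"
  proof (cases "a = 0")
    case True
    have "(\<Sum>s\<in>I. \<rho> s * d s) \<le> a * L2_set d I" unfolding a_def by (rule sum_mult_le_L2_set)
    then show ?thesis using True by simp
  next
    case False
    then have "a > 0" using a by simp
    have "(\<Sum>s\<in>I. - (1 / a) * \<rho> s * (t s - z i s)) = (\<Sum>s\<in>I. \<rho> s * d s) / a"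
      unfolding sum_divide_distrib by (intro sum.cong) (auto simp: d_def algebra_simps diff_divide_distrib)
    with i(2) have "(\<Sum>s\<in>I. \<rho> s * d s) / a < \<delta>" by simp
    then show ?thesis using \<open>a > 0\<close> by (simp add: pos_divide_less_eq)
  qed
  have dD: "L2_set d I \<le> D" unfolding d_def using D i(1) by blast
  have "(L2_set (\<lambda>s. \<rho> s + d s) I)\<^sup>2 = a\<^sup>2 + 2 * (\<Sum>s\<in>I. \<rho> s * d s) + (L2_set d I)\<^sup>2"
    by (simp add: L2_set_sq a_def power2_sum sum.distrib sum_distrib_left algebra_simps)
  also have "\<dots> \<le> a\<^sup>2 + 2 * (\<delta> * a) + D\<^sup>2"
    using cross dD a(1) by (intro add_mono power_mono) auto
  also have "\<dots> \<le> (\<delta> * k + D * sqrt k)\<^sup>2 + 2 * (\<delta> * (\<delta> * k + D * sqrt k)) + D\<^sup>2"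
    using a nonneg by (intro add_mono power_mono mult_left_mono) auto
  also have "\<dots> = \<delta>\<^sup>2 * (k\<^sup>2 + 2 * k) + 2 * \<delta> * D * (k + 1) * sqrt k + D\<^sup>2 * (k + 1)"
    by (simp add: power2_sum power_mult_distrib algebra_simps power2_eq_square)
  also have "\<dots> \<le> \<delta>\<^sup>2 * (k + 1)\<^sup>2 + 2 * \<delta> * D * (k + 1) * sqrt (k + 1) + D\<^sup>2 * (k + 1)"
    using nonneg by (intro add_mono mult_left_mono) (auto simp: power2_eq_square algebra_simps)
  also have "\<dots> = (\<delta> * Suc k + D * sqrt (Suc k))\<^sup>2"
    by (simp add: power2_sum power_mult_distrib algebra_simps power2_eq_square)
  finally have "L2_set (\<lambda>s. \<rho> s + d s) I \<le> \<delta> * Suc k + D * sqrt (Suc k)"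
    using nonneg by (rule_tac power2_le_imp_le) auto
  moreover have "(\<lambda>s. \<Sum>j<Suc k. z ((\<kappa>(k := i)) j) s - t s) = (\<lambda>s. \<rho> s + d s)"
    by (simp add: \<rho>_def d_def)
  ultimately show ?case using \<kappa>(1) i(1) by (intro exI[of _ "\<kappa>(k := i)"]) auto
qed

text \<open>
  A maximal convexly separated subfamily S: by maximality every point of the family lies near the
  convex hull of S, hence near an average of k points of S.
\<close>

lemma convex_packing:
  fixes z :: "'a \<Rightarrow> 's \<Rightarrow> real"
  assumes A: "finite A" and \<delta>: "0 < \<delta>" and k: "0 < k" and D0: "0 \<le> D"
    and D: "\<And>a b. a \<in> A \<Longrightarrow> b \<in> A \<Longrightarrow> L2_set (\<lambda>s. z a s - z b s) I \<le> D"
    and sep: "\<And>a b. a \<in> A \<Longrightarrow> b \<in> A \<Longrightarrow> a \<noteq> b \<Longrightarrow>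
      2 * (\<delta> + D / sqrt k) < L2_set (\<lambda>s. z a s - z b s) I"
  obtains S \<beta> where "S \<subseteq> A" "\<And>a. L2_set (\<beta> a) I \<le> 1"
    "\<And>i j. i \<in> S \<Longrightarrow> j \<in> S \<Longrightarrow> i \<noteq> j \<Longrightarrow>
      \<delta> \<le> (\<Sum>s\<in>I. \<beta> j s * (z j s - z i s)) \<or> \<delta> \<le> (\<Sum>s\<in>I. \<beta> i s * (z i s - z j s))"
    "card A \<le> card S ^ k"
proof -
  \<comment> \<open>The disjunction encodes one-sided separation without ordering S: of two points,
    the one adjoined later has a witness against the other.\<close>
  define cs where "cs S \<beta> \<longleftrightarrow> S \<subseteq> A \<and> (\<forall>a. L2_set (\<beta> a) I \<le> 1) \<and>
    (\<forall>i\<in>S. \<forall>j\<in>S. i \<noteq> j \<longrightarrow> \<delta> \<le> (\<Sum>s\<in>I. \<beta> j s * (z j s - z i s))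
      \<or> \<delta> \<le> (\<Sum>s\<in>I. \<beta> i s * (z i s - z j s)))" for S and \<beta> :: "'a \<Rightarrow> 's \<Rightarrow> real"
  have ex0: "\<exists>\<beta>. cs {} \<beta>" by (intro exI[of _ "\<lambda>_ _. 0"]) (auto simp: cs_def L2_set_def)
  have "\<forall>S. (\<exists>\<beta>. cs S \<beta>) \<longrightarrow> card S < Suc (card A)"
    using A by (auto simp: cs_def less_Suc_eq_le intro: card_mono)
  then have "\<exists>S. (\<exists>\<beta>. cs S \<beta>) \<and> (\<forall>T. (\<exists>\<beta>. cs T \<beta>) \<longrightarrow> card T \<le> card S)"
    using ex_has_greatest_nat[where P = "\<lambda>S. \<exists>\<beta>. cs S \<beta>" and f = card and b = "Suc (card A)"] ex0 by blast
  then obtain S \<beta> where S: "cs S \<beta>" "\<And>T \<beta>'. cs T \<beta>' \<Longrightarrow> card T \<le> card S" by blast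
  have SA: "S \<subseteq> A" "finite S" using S(1) A finite_subset by (auto simp: cs_def)
  have near: "\<exists>i\<in>S. (\<Sum>s\<in>I. b s * (z a s - z i s)) < \<delta>" if a: "a \<in> A" and b: "L2_set b I \<le> 1" for a b
  proof (cases "a \<in> S")
    case True
    then show ?thesis using \<delta> by (intro bexI[of _ a]) auto
  next
    case False
    show ?thesis
    proof (rule ccontr)
      assume "\<not> ?thesis"
      then have *: "\<forall>i\<in>S. \<delta> \<le> (\<Sum>s\<in>I. b s * (z a s - z i s))" by force
      \<comment> \<open>The new point gets b as its witness against all of S; the witnesses of the
        old points stay as they are.\<close>
      have "cs (insert a S) (\<beta>(a := b))"
        using S(1) a b * False unfolding cs_def by (auto simp: fun_upd_def)
      from S(2)[OF this] show False using False SA by simp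
    qed
  qed
  have "\<forall>a\<in>A. \<exists>\<kappa>. (\<forall>j<k. \<kappa> j \<in> S) \<and>
      L2_set (\<lambda>s. \<Sum>j<k. z (\<kappa> j) s - z a s) I \<le> \<delta> * k + D * sqrt k"
    using SA(1) \<delta> D0 by (intro ballI frank_wolfe near D) auto
  from bchoice[OF this] obtain \<kappa> where \<kappa>: "\<And>a j. a \<in> A \<Longrightarrow> j < k \<Longrightarrow> \<kappa> a j \<in> S"
    "\<And>a. a \<in> A \<Longrightarrow> L2_set (\<lambda>s. \<Sum>j<k. z (\<kappa> a j) s - z a s) I \<le> \<delta> * k + D * sqrt k"
    by blast
  \<comment> \<open>Each point lies within \<delta> + D / sqrt k of the average of its k-tuple. Two
    points with the same tuple would be closer than \<open>sep\<close> allows, so points are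
    determined by tuples from S.\<close>
  define \<phi> where "\<phi> a = restrict (\<kappa> a) {..<k}" for a
  have "inj_on \<phi> A"
  proof (rule inj_onI, rule ccontr)
    fix a b assume ab: "a \<in> A" "b \<in> A" "\<phi> a = \<phi> b" "a \<noteq> b"
    have \<kappa>_eq: "\<kappa> a j = \<kappa> b j" if "j < k" for j
      using fun_cong[OF ab(3), of j] that by (simp add: \<phi>_def)
    have "(\<lambda>s. real k * (z a s - z b s))
        = (\<lambda>s. (\<Sum>j<k. z (\<kappa> b j) s - z b s) - (\<Sum>j<k. z (\<kappa> a j) s - z a s))"
      by (simp add: \<kappa>_eq sum_subtractf algebra_simps)
    then have "L2_set (\<lambda>s. real k * (z a s - z b s)) I
        \<le> L2_set (\<lambda>s. \<Sum>j<k. z (\<kappa> b j) s - z b s) I + L2_set (\<lambda>s. \<Sum>j<k. z (\<kappa> a j) s - z a s) I"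
      by (simp only: L2_set_diff_le)
    then have "k * L2_set (\<lambda>s. z a s - z b s) I \<le> 2 * (\<delta> * k + D * sqrt k)"
      using \<kappa>(2)[OF ab(1)] \<kappa>(2)[OF ab(2)] by (simp add: L2_set_scale)
    moreover have "k * (2 * (\<delta> + D / sqrt k)) < k * L2_set (\<lambda>s. z a s - z b s) I"
      using sep[OF ab(1,2,4)] k by simp
    moreover have "k * (2 * (\<delta> + D / sqrt k)) = 2 * (\<delta> * k + D * (k / sqrt k))"
      by (simp add: algebra_simps)
    moreover have "k / sqrt k = sqrt k" using k by (simp add: real_div_sqrt)
    ultimately show False by simp
  qed
  moreover have "\<phi> ` A \<subseteq> {..<k} \<rightarrow>\<^sub>E S"
    unfolding \<phi>_def using \<kappa>(1) by (intro image_subsetI restrict_PiE_iff[THEN iffD2]) auto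
  ultimately have "card A \<le> card ({..<k} \<rightarrow>\<^sub>E S)"
    using SA by (intro card_inj_on_le[of \<phi>] finite_PiE) auto
  also have "\<dots> = card S ^ k" by (simp add: card_PiE)
  finally show thesis using S(1) SA(1) by (intro that[of S \<beta>]) (auto simp: cs_def)
qed

section \<open>Packing numbers of the dual ball\<close>

context infratype_space begin

text \<open>
  Duality: if the points (f(y_s))_s are convexly separated, witnessed by unit vectors \<beta>(f), and
  the values of f at its own witness agree up to half the gap, then the combinations of the y_s
  with coefficients \<beta>(f) are separated in N. Rounding bounds how many such combinations there are.
\<close>

lemma dual_packing_bound:
  fixes y :: "'s \<Rightarrow> 'v"
  assumes I: "finite I" "I \<noteq> {}" and M: "M = real (card I)"
    and y: "\<And>s. s \<in> I \<Longrightarrow> y s \<in> V" "\<And>s. s \<in> I \<Longrightarrow> N (y s) \<le> sqrt (2 / M)"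
    and A: "finite A" "A \<subseteq> dual_ball"
    and small: "\<And>f. f \<in> A \<Longrightarrow> L2_set (\<lambda>s. f (y s)) I \<le> 2 * r"
    and sep: "\<And>f g. f \<in> A \<Longrightarrow> g \<in> A \<Longrightarrow> f \<noteq> g \<Longrightarrow> r / 4 \<le> L2_set (\<lambda>s. f (y s) - g (y s)) I"
    and r: "256 * (J * ((real l + 2) / sqrt p + 4 * sqrt 2 ^ l / sqrt M)) \<le> r"
  shows "card A \<le> (257 * exp (M / 2 ^ l * (real l + 3))) ^ 4096"
proof -
  have M0: "M > 0" using I by (simp add: M card_gt_0_iff)
  define G where "G = J * ((real l + 2) / sqrt p + 4 * sqrt 2 ^ l / sqrt M)"
  have "(real l + 2) / sqrt p > 0" "4 * sqrt 2 ^ l / sqrt M > 0" using p_pos M0 by auto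
  then have G0: "G > 0" unfolding G_def using J_pos by (intro mult_pos_pos add_pos_pos)
  then have r0: "r > 0" using r unfolding G_def by linarith
  \<comment> \<open>D = 4r bounds the diameter, and averages of 4096 points give D / 64 = r / 16.
    Then 2 (r / 32 + r / 16) = 3r / 16 stays below the separation r / 4.\<close>
  define \<delta> where "\<delta> = r / 32"
  define D where "D = 4 * r"
  have s64: "sqrt (real 4096) = 64" by (rule real_sqrt_unique) auto
  obtain S \<beta> where S: "S \<subseteq> A" "\<And>f. L2_set (\<beta> f) I \<le> 1"
    "\<And>f g. f \<in> S \<Longrightarrow> g \<in> S \<Longrightarrow> f \<noteq> g \<Longrightarrow>
      \<delta> \<le> (\<Sum>s\<in>I. \<beta> g s * (g (y s) - f (y s))) \<or> \<delta> \<le> (\<Sum>s\<in>I. \<beta> f s * (f (y s) - g (y s)))"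
    "card A \<le> card S ^ 4096"
  proof (rule convex_packing[of A \<delta> 4096 D "\<lambda>f s. f (y s)" I])
    show "L2_set (\<lambda>s. f (y s) - g (y s)) I \<le> D" if "f \<in> A" "g \<in> A" for f g
      using L2_set_diff_le[of "\<lambda>s. f (y s)" "\<lambda>s. g (y s)" I] small[OF that(1)] small[OF that(2)]
      by (simp add: D_def)
    show "2 * (\<delta> + D / sqrt (real 4096)) < L2_set (\<lambda>s. f (y s) - g (y s)) I"
      if "f \<in> A" "g \<in> A" "f \<noteq> g" for f g
      using sep[OF that] r0 unfolding s64 by (simp add: \<delta>_def D_def)
  qed (use A r0 in \<open>auto simp: \<delta>_def D_def\<close>)
  have finS: "finite S" using S(1) A finite_subset by blast
  define B where "B f = (\<Sum>s\<in>I. \<beta> f s *\<^sub>R y s)" for f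
  have B: "B f \<in> V" for f unfolding B_def using y by (intro lincomb_in_V) auto
  have "\<forall>f. \<exists>c. real_of_int (\<Sum>s\<in>I. \<bar>c s\<bar>) \<le> M / 2 ^ l \<and>
      N (\<Sum>s\<in>I. (sqrt M * \<beta> f s - 2 ^ l * of_int (c s)) *\<^sub>R y s)
        \<le> J * sqrt (2 / M) * ((real l + 2) * M / sqrt p + 4 * sqrt M * sqrt 2 ^ l)"
  proof
    fix f
    have "(\<Sum>s\<in>I. (\<beta> f s)\<^sup>2) \<le> 1"
      using S(2)[of f] power_mono[of "L2_set (\<beta> f) I" 1 2] by (simp add: L2_set_sq)
    from rounding[where b = "\<beta> f" and y = y and l = l and \<gamma> = "sqrt (2 / M)", OF I y this]
    show "\<exists>c. real_of_int (\<Sum>s\<in>I. \<bar>c s\<bar>) \<le> M / 2 ^ l \<and>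
      N (\<Sum>s\<in>I. (sqrt M * \<beta> f s - 2 ^ l * of_int (c s)) *\<^sub>R y s)
        \<le> J * sqrt (2 / M) * ((real l + 2) * M / sqrt p + 4 * sqrt M * sqrt 2 ^ l)"
      unfolding M[symmetric] .
  qed
  from choice[OF this] obtain c where c: "\<And>f. real_of_int (\<Sum>s\<in>I. \<bar>c f s\<bar>) \<le> M / 2 ^ l"
    "\<And>f. N (\<Sum>s\<in>I. (sqrt M * \<beta> f s - 2 ^ l * of_int (c f s)) *\<^sub>R y s)
        \<le> J * sqrt (2 / M) * ((real l + 2) * M / sqrt p + 4 * sqrt M * sqrt 2 ^ l)" by blast
  \<comment> \<open>The norm bound \<open>sqrt (2 / M)\<close> makes the block part of the error
    free of M once the factor \<open>sqrt M\<close> is divided out.\<close>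
  have err: "J * sqrt (2 / M) * ((real l + 2) * M / sqrt p + 4 * sqrt M * sqrt 2 ^ l) = sqrt M * (sqrt 2 * G)"
  proof -
    define q where "q = sqrt M"
    have q: "q > 0" "M = q * q" "sqrt (2 / M) = sqrt 2 / q"
      using M0 by (auto simp: q_def real_sqrt_divide)
    have "sqrt p > 0" using p_pos by simp
    then show ?thesis
      unfolding G_def q(3) q_def[symmetric] using q(1) by (simp add: q(2) field_simps)
  qed
  have close: "N (B f - B g) \<le> 2 * (sqrt 2 * G)" if "\<And>s. s \<in> I \<Longrightarrow> c f s = c g s" for f g
  proof -
    define E where "E h = (\<Sum>s\<in>I. (sqrt M * \<beta> h s - 2 ^ l * of_int (c h s)) *\<^sub>R y s)" for h
    have E: "E h \<in> V" "N (E h) \<le> sqrt M * (sqrt 2 * G)" for h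
      unfolding E_def using y c(2) err by (auto intro!: lincomb_in_V)
    have "sqrt M *\<^sub>R (B f - B g) = E f - E g"
      unfolding E_def B_def using that
      by (simp add: scaleR_sum_right scaleR_diff_right sum_subtractf[symmetric] scaleR_diff_left)
    then have "sqrt M * N (B f - B g) = N (E f - E g)"
      using M0 N_scaleR[of "B f - B g" "sqrt M"] B subspace_diff[OF subspace_V] by simp
    also have "\<dots> \<le> N (E f) + N (E g)" using E by (intro N_diff)
    also have "\<dots> \<le> sqrt M * (2 * (sqrt 2 * G))" using E(2)[of f] E(2)[of g] by simp
    finally show ?thesis using M0 by simp
  qed
  have fB: "f (B g) = (\<Sum>s\<in>I. \<beta> g s * f (y s))" if "f \<in> A" for f g
  proof -
    have "linear f" using that A dual_ball_linear by blast
    then show ?thesis by (simp add: B_def linear_sum linear_cmul)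
  qed
  define h where "h f = f (B f)" for f
  have hb: "\<bar>h f\<bar> \<le> 2 * r" if "f \<in> A" for f
  proof -
    have "\<bar>h f\<bar> \<le> (\<Sum>s\<in>I. \<bar>\<beta> f s\<bar> * \<bar>f (y s)\<bar>)"
      unfolding h_def fB[OF that] by (rule order_trans[OF sum_abs]) (simp add: abs_mult)
    also have "\<dots> \<le> L2_set (\<beta> f) I * L2_set (\<lambda>s. f (y s)) I" by (rule L2_set_mult_ineq)
    also have "\<dots> \<le> 1 * (2 * r)" using S(2) small[OF that] by (intro mult_mono) auto
    finally show ?thesis by simp
  qed
  \<comment> \<open>The values \<open>h f\<close> lie in an interval of length 4r. Cells of width
    \<delta> / 2 = r / 64 have indices from -128 to 128, hence the factor 257.\<close>
  define \<psi> where "\<psi> f = (\<lfloor>h f / (\<delta> / 2)\<rfloor>, restrict (c f) I)" for f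
  have sq2: "sqrt 2 < (2::real)" by (rule real_less_lsqrt) auto
  \<comment> \<open>Equal rounded coefficients place B f and B g within 4G, at most \<delta> / 2, in
    N, so f nearly agrees on them. The gap \<delta> between g and f at B g then forces
    \<open>h g\<close> and \<open>h f\<close> more than \<delta> / 2 apart, although they share a
    cell of that width.\<close>
  have separated: False
    if fg: "f \<in> S" "g \<in> S" "\<psi> f = \<psi> g" and ge: "\<delta> \<le> (\<Sum>s\<in>I. \<beta> g s * (g (y s) - f (y s)))" for f g
  proof -
    have fgA: "f \<in> A" "g \<in> A" using fg S(1) by auto
    have "c f s = c g s" if "s \<in> I" for s
      using fun_cong[OF conjunct2[OF fg(3)[unfolded \<psi>_def prod.inject]], of s] that by simp
    then have "N (B f - B g) \<le> 2 * (sqrt 2 * G)" by (rule close)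
    also have "\<dots> < 2 * (2 * G)" using sq2 G0 by simp
    also have "\<dots> \<le> \<delta> / 2" using r unfolding \<delta>_def G_def by simp
    finally have 1: "N (B f - B g) < \<delta> / 2" .
    have "f (B f - B g) \<le> N (B f - B g)"
      using dual_ball_bound[of f "B f - B g"] fgA A B subspace_diff[OF subspace_V]
      by (meson abs_le_D1 subsetD)
    moreover have "linear f" using fgA A dual_ball_linear by blast
    ultimately have 2: "h f - f (B g) < \<delta> / 2" using 1 by (simp add: h_def linear_diff)
    have "\<delta> \<le> h g - f (B g)"
      using ge fgA by (simp add: h_def fB right_diff_distrib sum_subtractf)
    then have 3: "h g - h f > \<delta> / 2" using 2 by linarith
    have "\<lfloor>h f / (\<delta> / 2)\<rfloor> = \<lfloor>h g / (\<delta> / 2)\<rfloor>" using fg(3) by (simp add: \<psi>_def)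
    then have "h g / (\<delta> / 2) - h f / (\<delta> / 2) < 1" by linarith
    then have "(h g - h f) / (\<delta> / 2) < 1" by (simp add: diff_divide_distrib)
    then show False using 3 r0 by (simp add: \<delta>_def field_simps)
  qed
  have "inj_on \<psi> S"
  proof (rule inj_onI, rule ccontr)
    fix f g assume fg: "f \<in> S" "g \<in> S" "\<psi> f = \<psi> g" "f \<noteq> g"
    then show False using S(3)[OF fg(1,2,4)] separated[of f g] separated[of g f] by auto
  qed
  moreover have "\<psi> ` S \<subseteq> {-128..128} \<times> {c \<in> I \<rightarrow>\<^sub>E (UNIV :: int set). real_of_int (\<Sum>s\<in>I. \<bar>c s\<bar>) \<le> M / 2 ^ l}"
  proof (rule image_subsetI)
    fix f assume f: "f \<in> S"
    have "\<bar>h f\<bar> \<le> 2 * r" using hb S(1) f by blast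
    then have "- 128 \<le> h f / (\<delta> / 2)" "h f / (\<delta> / 2) \<le> 128"
      using r0 by (auto simp: \<delta>_def field_simps abs_le_iff)
    then have "\<lfloor>h f / (\<delta> / 2)\<rfloor> \<in> {-128..128}"
      unfolding atLeastAtMost_iff by linarith
    moreover have "(\<Sum>s\<in>I. \<bar>restrict (c f) I s\<bar>) = (\<Sum>s\<in>I. \<bar>c f s\<bar>)" by simp
    ultimately show "\<psi> f \<in> {-128..128} \<times> {c \<in> I \<rightarrow>\<^sub>E (UNIV :: int set). real_of_int (\<Sum>s\<in>I. \<bar>c s\<bar>) \<le> M / 2 ^ l}"
      using c(1)[of f] by (simp add: \<psi>_def del: of_int_sum)
  qed
  ultimately have "card S \<le> card ({-128..128::int} \<times> {c \<in> I \<rightarrow>\<^sub>E (UNIV :: int set). real_of_int (\<Sum>s\<in>I. \<bar>c s\<bar>) \<le> M / 2 ^ l})"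
    using finite_sparse_integer_vectors(1)[OF I(1)] by (intro card_inj_on_le[of \<psi>]) auto
  also have "\<dots> = 257 * card {c \<in> I \<rightarrow>\<^sub>E (UNIV :: int set). real_of_int (\<Sum>s\<in>I. \<bar>c s\<bar>) \<le> M / 2 ^ l}"
    by (simp add: card_cartesian_product)
  finally have "real (card S) \<le> 257 * real (card {c \<in> I \<rightarrow>\<^sub>E (UNIV :: int set). real_of_int (\<Sum>s\<in>I. \<bar>c s\<bar>) \<le> M / 2 ^ l})"
    by linarith
  also have "\<dots> \<le> 257 * exp (M / 2 ^ l * (real l + 3))"
    unfolding M using card_sparse_integer_vectors[OF I(1), of l] by (intro mult_left_mono) auto
  finally have "real (card S) ^ 4096 \<le> (257 * exp (M / 2 ^ l * (real l + 3))) ^ 4096"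
    by (intro power_mono) auto
  moreover have "real (card A) \<le> real (card S) ^ 4096" using S(4) by (metis of_nat_le_iff of_nat_power)
  ultimately show ?thesis by linarith
qed

end

section \<open>Reduction to boundedly many vectors\<close>

text \<open>Gram-Schmidt in matrix form: q is the orthogonal projection onto the span of the vectors
  \<xi> k. A new vector contributes the rank one projection onto its residual v, which raises the
  trace by 1, unless v vanishes.\<close>

lemma orthogonal_projection_matrix:
  fixes \<xi> :: "'k \<Rightarrow> 's \<Rightarrow> real"
  assumes "finite K" and I: "finite I"
  shows "\<exists>q. (\<forall>i j. q i j = q j i) \<and> (\<forall>i\<in>I. \<forall>k\<in>I. (\<Sum>j\<in>I. q i j * q j k) = q i k) \<and>
    (\<forall>k\<in>K. \<forall>j\<in>I. (\<Sum>i\<in>I. \<xi> k i * q i j) = \<xi> k j) \<and> (\<Sum>i\<in>I. q i i) \<le> real (card K)"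
  using assms(1)
proof (induction K rule: finite_induct)
  case empty
  show ?case by (intro exI[of _ "\<lambda>_ _. 0"]) auto
next
  case (insert k0 K)
  then obtain q where sym: "\<And>i j. q i j = q j i"
    and idem: "\<And>i k. i \<in> I \<Longrightarrow> k \<in> I \<Longrightarrow> (\<Sum>j\<in>I. q i j * q j k) = q i k"
    and fixed: "\<And>k j. k \<in> K \<Longrightarrow> j \<in> I \<Longrightarrow> (\<Sum>i\<in>I. \<xi> k i * q i j) = \<xi> k j"
    and tr: "(\<Sum>i\<in>I. q i i) \<le> real (card K)" by blast
  define u where "u = \<xi> k0"
  define v where "v j = u j - (\<Sum>i\<in>I. u i * q i j)" for j
  define c where "c = (\<Sum>i\<in>I. (v i)\<^sup>2)"
  have qv: "(\<Sum>j\<in>I. q i j * v j) = 0" if "i \<in> I" for i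
  proof -
    have "(\<Sum>j\<in>I. q i j * v j) = (\<Sum>j\<in>I. q i j * u j) - (\<Sum>j\<in>I. \<Sum>l\<in>I. q i j * (u l * q l j))"
      by (simp add: v_def right_diff_distrib sum_subtractf sum_distrib_left)
    also have "(\<Sum>j\<in>I. \<Sum>l\<in>I. q i j * (u l * q l j)) = (\<Sum>l\<in>I. \<Sum>j\<in>I. q i j * (u l * q l j))"
      by (rule sum.swap)
    also have "\<dots> = (\<Sum>l\<in>I. u l * (\<Sum>j\<in>I. q i j * q j l))"
      by (simp add: sum_distrib_left sym mult.left_commute)
    also have "\<dots> = (\<Sum>l\<in>I. u l * q i l)" using idem that by simp
    finally show ?thesis by (simp add: mult.commute)
  qed
  show ?case
  proof (cases "c = 0")
    case True
    then have "v j = 0" if "j \<in> I" for j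
      using that I by (simp add: c_def sum_nonneg_eq_0_iff)
    then have "(\<Sum>i\<in>I. u i * q i j) = u j" if "j \<in> I" for j
      using that by (simp add: v_def)
    then show ?thesis using sym idem fixed tr insert.hyps
      by (intro exI[of _ q]) (auto simp: u_def)
  next
    case False
    define q' where "q' i j = q i j + v i * v j / c" for i j
    have vq: "(\<Sum>j\<in>I. v j * q j k) = 0" if "k \<in> I" for k
      using qv[OF that] sym by (simp add: mult.commute)
    have idem': "(\<Sum>j\<in>I. q' i j * q' j k) = q' i k" if "i \<in> I" "k \<in> I" for i k
    proof -
      have "(\<Sum>j\<in>I. q' i j * q' j k) = (\<Sum>j\<in>I. q i j * q j k) + (\<Sum>j\<in>I. q i j * v j) * (v k / c)
          + (v i / c) * (\<Sum>j\<in>I. v j * q j k) + (v i / c) * (\<Sum>j\<in>I. (v j)\<^sup>2) * (v k / c)"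
        by (simp add: q'_def algebra_simps sum.distrib sum_distrib_left sum_distrib_right power2_eq_square)
      also have "\<dots> = q i k + v i * v k / c"
        using idem qv vq that False by (simp add: c_def[symmetric])
      finally show ?thesis by (simp add: q'_def)
    qed
    have orth: "(\<Sum>i\<in>I. \<xi> k i * v i) = 0" if "k \<in> K" for k
    proof -
      have "(\<Sum>i\<in>I. \<xi> k i * v i) = (\<Sum>i\<in>I. (\<Sum>l\<in>I. \<xi> k l * q l i) * v i)"
        using fixed[OF that] by simp
      also have "\<dots> = (\<Sum>i\<in>I. \<Sum>l\<in>I. \<xi> k l * (q l i * v i))"
        by (simp add: sum_distrib_right mult.assoc)
      also have "\<dots> = (\<Sum>l\<in>I. \<xi> k l * (\<Sum>i\<in>I. q l i * v i))"
        by (subst sum.swap) (simp add: sum_distrib_left)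
      finally show ?thesis using qv by simp
    qed
    have "(\<Sum>i\<in>I. u i * v i) = c"
    proof -
      have "(\<Sum>i\<in>I. (\<Sum>l\<in>I. u l * q l i) * v i) = (\<Sum>i\<in>I. \<Sum>l\<in>I. u l * (q l i * v i))"
        by (simp add: sum_distrib_right mult.assoc)
      also have "\<dots> = (\<Sum>l\<in>I. u l * (\<Sum>i\<in>I. q l i * v i))"
        by (subst sum.swap) (simp add: sum_distrib_left)
      finally have z: "(\<Sum>i\<in>I. (\<Sum>l\<in>I. u l * q l i) * v i) = 0" using qv by simp
      have "u i * v i = (v i)\<^sup>2 + (\<Sum>l\<in>I. u l * q l i) * v i" for i
        by (simp add: v_def power2_eq_square algebra_simps)
      then show ?thesis using z by (simp add: sum.distrib c_def)
    qed
    then have "(\<Sum>i\<in>I. u i * q' i j) = u j" for j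
    proof -
      have "(\<Sum>i\<in>I. u i * q' i j) = (\<Sum>i\<in>I. u i * q i j) + (\<Sum>i\<in>I. u i * v i) * (v j / c)"
        by (simp add: q'_def distrib_left sum.distrib sum_distrib_right sum_divide_distrib mult.assoc)
      then show ?thesis using \<open>(\<Sum>i\<in>I. u i * v i) = c\<close> False by (simp add: v_def)
    qed
    moreover have "(\<Sum>i\<in>I. \<xi> k i * q' i j) = \<xi> k j" if "k \<in> K" "j \<in> I" for k j
    proof -
      have "(\<Sum>i\<in>I. \<xi> k i * q' i j) = (\<Sum>i\<in>I. \<xi> k i * q i j) + (\<Sum>i\<in>I. \<xi> k i * v i) * (v j / c)"
        by (simp add: q'_def distrib_left sum.distrib sum_distrib_right sum_divide_distrib mult.assoc)
      then show ?thesis using fixed orth that by simp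
    qed
    moreover have "(\<Sum>i\<in>I. q' i i) \<le> real (card (insert k0 K))"
    proof -
      have "(\<Sum>i\<in>I. q' i i) = (\<Sum>i\<in>I. q i i) + (\<Sum>i\<in>I. (v i)\<^sup>2) / c"
        by (simp add: q'_def sum.distrib power2_eq_square sum_divide_distrib)
      then show ?thesis using tr insert.hyps False by (simp add: c_def[symmetric])
    qed
    ultimately show ?thesis using idem' sym
      by (intro exI[of _ q']) (auto simp: u_def q'_def mult.commute)
  qed
qed

section \<open>Sampling by successive choices\<close>

lemma exists_le_weighted_average:
  fixes w \<Phi> :: "'s \<Rightarrow> real"
  assumes I: "finite I" and w: "\<And>i. i \<in> I \<Longrightarrow> 0 \<le> w i" "(\<Sum>i\<in>I. w i) = 1"
    and le: "(\<Sum>i\<in>I. w i * \<Phi> i) \<le> C"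
  shows "\<exists>i\<in>I. \<Phi> i \<le> C"
proof (rule ccontr)
  assume "\<not> ?thesis"
  then have gt: "\<Phi> i - C > 0" if "i \<in> I" for i using that by force
  have "(\<Sum>i\<in>I. w i * (\<Phi> i - C)) \<le> 0"
    using le w(2) by (simp add: right_diff_distrib sum_subtractf flip: sum_distrib_right)
  moreover have nn: "0 \<le> w i * (\<Phi> i - C)" if "i \<in> I" for i
    using that w(1) gt[OF that] by (intro mult_nonneg_nonneg) auto
  ultimately have "(\<Sum>i\<in>I. w i * (\<Phi> i - C)) = 0" by (meson order_antisym sum_nonneg)
  then have "\<forall>i\<in>I. w i * (\<Phi> i - C) = 0" using sum_nonneg_eq_0_iff[OF I, of "\<lambda>i. w i * (\<Phi> i - C)"] nn by simp
  then have "w i = 0" if "i \<in> I" for i using gt[OF that] that by auto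
  then show False using w(2) by simp
qed

text \<open>
  Derandomized sampling from w: Z(a,i) is the centred rank one contribution of the index i to the
  empirical covariance applied to t_a. It has mean zero, so some choice of the next index keeps the
  potential below its average growth.
\<close>

lemma sampling:
  fixes t :: "'a \<Rightarrow> 's \<Rightarrow> real" and q :: "'s \<Rightarrow> 's \<Rightarrow> real" and n :: real
  assumes I: "finite I" and n: "0 < n"
    and w: "\<And>i. i \<in> I \<Longrightarrow> 0 \<le> w i" "(\<Sum>i\<in>I. w i) = 1"
    and w0: "\<And>a i. a \<in> A \<Longrightarrow> i \<in> I \<Longrightarrow> w i = 0 \<Longrightarrow> t a i = 0"
    and lev: "\<And>i. i \<in> I \<Longrightarrow> (\<Sum>l\<in>I. (q i l)\<^sup>2) \<le> 2 * n * w i"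
    and fixed: "\<And>a l. a \<in> A \<Longrightarrow> l \<in> I \<Longrightarrow> (\<Sum>i\<in>I. t a i * q i l) = t a l"
    and r: "\<And>a. a \<in> A \<Longrightarrow> (\<Sum>i\<in>I. (t a i)\<^sup>2) \<le> r\<^sup>2"
  defines "Z \<equiv> \<lambda>a i l. t a i * q i l / w i - t a l"
  shows "\<exists>s. (\<forall>j<k. s j \<in> I) \<and>
    (\<Sum>a\<in>A. (\<Sum>l\<in>I. (\<Sum>j<k. Z a (s j) l)\<^sup>2) / (2 * n) + (\<Sum>j<k. (t a (s j))\<^sup>2 / w (s j)))
      \<le> 2 * real k * r\<^sup>2 * card A"
proof (induction k)
  case 0
  show ?case by simp
next
  case (Suc k)
  then obtain s where s: "\<forall>j<k. s j \<in> I"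
    "(\<Sum>a\<in>A. (\<Sum>l\<in>I. (\<Sum>j<k. Z a (s j) l)\<^sup>2) / (2 * n) + (\<Sum>j<k. (t a (s j))\<^sup>2 / w (s j)))
      \<le> 2 * real k * r\<^sup>2 * card A" by blast
  define R where "R a l = (\<Sum>j<k. Z a (s j) l)" for a l
  define \<Phi> where "\<Phi> i = (\<Sum>a\<in>A. (\<Sum>l\<in>I. (R a l + Z a i l)\<^sup>2) / (2 * n) + (t a i)\<^sup>2 / w i)" for i
  have mean: "(\<Sum>i\<in>I. w i * Z a i l) = 0" if "a \<in> A" "l \<in> I" for a l
  proof -
    have "w i * Z a i l = t a i * q i l - w i * t a l" if "i \<in> I" for i
      using w0[OF \<open>a \<in> A\<close> that] by (cases "w i = 0") (auto simp: Z_def algebra_simps)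
    then have "(\<Sum>i\<in>I. w i * Z a i l) = (\<Sum>i\<in>I. t a i * q i l) - (\<Sum>i\<in>I. w i) * t a l"
      by (simp add: sum_subtractf sum_distrib_right)
    then show ?thesis using fixed that w(2) by simp
  qed
  \<comment> \<open>The second moment about the mean is at most the raw second moment. There the row
    bound \<open>lev\<close> cancels the denominator w i, which is why small weights do no
    harm.\<close>
  have var: "(\<Sum>i\<in>I. w i * (\<Sum>l\<in>I. (Z a i l)\<^sup>2)) \<le> 2 * n * (\<Sum>i\<in>I. (t a i)\<^sup>2)" if "a \<in> A" for a
  proof -
    have "(\<Sum>i\<in>I. w i * (\<Sum>l\<in>I. (Z a i l)\<^sup>2)) = (\<Sum>l\<in>I. \<Sum>i\<in>I. w i * (Z a i l)\<^sup>2)"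
      unfolding sum_distrib_left by (rule sum.swap)
    also have "\<dots> \<le> (\<Sum>l\<in>I. \<Sum>i\<in>I. w i * (t a i * q i l / w i)\<^sup>2)"
    proof (rule sum_mono)
      fix l assume l: "l \<in> I"
      have e: "w i * (Z a i l)\<^sup>2 = w i * (t a i * q i l / w i)\<^sup>2 - 2 * t a l * (w i * Z a i l) - w i * (t a l)\<^sup>2" for i
        by (simp add: Z_def power2_eq_square algebra_simps)
      have "(\<Sum>i\<in>I. w i * (Z a i l)\<^sup>2) = (\<Sum>i\<in>I. w i * (t a i * q i l / w i)\<^sup>2)
          - 2 * t a l * (\<Sum>i\<in>I. w i * Z a i l) - (\<Sum>i\<in>I. w i) * (t a l)\<^sup>2"
        unfolding e by (simp only: sum_subtractf sum_distrib_left sum_distrib_right)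
      then show "(\<Sum>i\<in>I. w i * (Z a i l)\<^sup>2) \<le> (\<Sum>i\<in>I. w i * (t a i * q i l / w i)\<^sup>2)"
        using mean[OF that l] w(2) by simp
    qed
    also have "\<dots> = (\<Sum>i\<in>I. w i * (t a i / w i)\<^sup>2 * (\<Sum>l\<in>I. (q i l)\<^sup>2))"
      by (subst sum.swap)
        (simp add: sum_distrib_left power_mult_distrib power_divide algebra_simps sum_divide_distrib)
    also have "\<dots> \<le> (\<Sum>i\<in>I. 2 * n * (t a i)\<^sup>2)"
    proof (rule sum_mono)
      fix i assume i: "i \<in> I"
      have "w i * (t a i / w i)\<^sup>2 * (\<Sum>l\<in>I. (q i l)\<^sup>2) \<le> w i * (t a i / w i)\<^sup>2 * (2 * n * w i)"
        using lev[OF i] w(1)[OF i] by (intro mult_left_mono) auto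
      also have "\<dots> = 2 * n * (t a i)\<^sup>2"
        using w0[OF that i] by (cases "w i = 0") (auto simp: power2_eq_square)
      finally show "w i * (t a i / w i)\<^sup>2 * (\<Sum>l\<in>I. (q i l)\<^sup>2) \<le> 2 * n * (t a i)\<^sup>2" .
    qed
    finally show ?thesis by (simp add: sum_distrib_left)
  qed
  \<comment> \<open>The divisor 2n balances the potential: the mean increase of the covariance error
    and that of the empirical square sum are each at most r^2.\<close>
  have expand: "(\<Sum>i\<in>I. w i * ((\<Sum>l\<in>I. (R a l + Z a i l)\<^sup>2) / (2 * n) + (t a i)\<^sup>2 / w i))
      \<le> (\<Sum>l\<in>I. (R a l)\<^sup>2) / (2 * n) + 2 * r\<^sup>2" if a: "a \<in> A" for a
  proof -
    have "(\<Sum>i\<in>I. w i * (\<Sum>l\<in>I. (R a l + Z a i l)\<^sup>2))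
        = (\<Sum>i\<in>I. w i) * (\<Sum>l\<in>I. (R a l)\<^sup>2) + 2 * (\<Sum>l\<in>I. R a l * (\<Sum>i\<in>I. w i * Z a i l))
          + (\<Sum>i\<in>I. w i * (\<Sum>l\<in>I. (Z a i l)\<^sup>2))"
    proof -
      have "(\<Sum>l\<in>I. R a l * (\<Sum>i\<in>I. w i * Z a i l)) = (\<Sum>i\<in>I. w i * (\<Sum>l\<in>I. R a l * Z a i l))"
        by (simp add: sum_distrib_left mult.left_commute) (rule sum.swap)
      moreover have "w i * (\<Sum>l\<in>I. (R a l + Z a i l)\<^sup>2) = w i * (\<Sum>l\<in>I. (R a l)\<^sup>2)
          + 2 * (w i * (\<Sum>l\<in>I. R a l * Z a i l)) + w i * (\<Sum>l\<in>I. (Z a i l)\<^sup>2)" for i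
        by (simp add: power2_sum sum.distrib sum_distrib_left algebra_simps)
      ultimately show ?thesis
        by (simp only: sum.distrib sum_distrib_right flip: sum_distrib_left)
    qed
    also have "\<dots> \<le> (\<Sum>l\<in>I. (R a l)\<^sup>2) + 2 * n * (\<Sum>i\<in>I. (t a i)\<^sup>2)"
      using mean[OF a] var[OF a] w(2) by simp
    finally have 1: "(\<Sum>i\<in>I. w i * (\<Sum>l\<in>I. (R a l + Z a i l)\<^sup>2))
        \<le> (\<Sum>l\<in>I. (R a l)\<^sup>2) + 2 * n * (\<Sum>i\<in>I. (t a i)\<^sup>2)" .
    have 2: "w i * ((t a i)\<^sup>2 / w i) = (t a i)\<^sup>2" if "i \<in> I" for i
      using w0[OF a that] by (cases "w i = 0") auto
    have "(\<Sum>i\<in>I. w i * ((\<Sum>l\<in>I. (R a l + Z a i l)\<^sup>2) / (2 * n) + (t a i)\<^sup>2 / w i))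
        = (\<Sum>i\<in>I. w i * (\<Sum>l\<in>I. (R a l + Z a i l)\<^sup>2)) / (2 * n) + (\<Sum>i\<in>I. (t a i)\<^sup>2)"
    proof -
      have "(\<Sum>i\<in>I. w i * (S i / (2 * n) + b i)) = (\<Sum>i\<in>I. w i * S i) / (2 * n) + (\<Sum>i\<in>I. w i * b i)"
        for S b :: "'s \<Rightarrow> real"
        by (simp add: distrib_left sum.distrib sum_divide_distrib)
      moreover have "(\<Sum>i\<in>I. w i * ((t a i)\<^sup>2 / w i)) = (\<Sum>i\<in>I. (t a i)\<^sup>2)"
        by (intro sum.cong refl 2)
      ultimately show ?thesis by simp
    qed
    also have "\<dots> \<le> ((\<Sum>l\<in>I. (R a l)\<^sup>2) + 2 * n * (\<Sum>i\<in>I. (t a i)\<^sup>2)) / (2 * n) + (\<Sum>i\<in>I. (t a i)\<^sup>2)"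
      using 1 n by (intro add_right_mono divide_right_mono) auto
    also have "\<dots> = (\<Sum>l\<in>I. (R a l)\<^sup>2) / (2 * n) + 2 * (\<Sum>i\<in>I. (t a i)\<^sup>2)"
      using n by (simp add: add_divide_distrib)
    also have "\<dots> \<le> (\<Sum>l\<in>I. (R a l)\<^sup>2) / (2 * n) + 2 * r\<^sup>2" using r[OF a] by simp
    finally show ?thesis .
  qed
  have "(\<Sum>i\<in>I. w i * \<Phi> i)
      = (\<Sum>a\<in>A. \<Sum>i\<in>I. w i * ((\<Sum>l\<in>I. (R a l + Z a i l)\<^sup>2) / (2 * n) + (t a i)\<^sup>2 / w i))"
    unfolding \<Phi>_def sum_distrib_left by (rule sum.swap)
  also have "\<dots> \<le> (\<Sum>a\<in>A. (\<Sum>l\<in>I. (R a l)\<^sup>2) / (2 * n) + 2 * r\<^sup>2)"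
    by (intro sum_mono expand)
  finally obtain i where i: "i \<in> I" "\<Phi> i \<le> (\<Sum>a\<in>A. (\<Sum>l\<in>I. (R a l)\<^sup>2) / (2 * n) + 2 * r\<^sup>2)"
    using exists_le_weighted_average[OF I w] by blast
  define s' where "s' = s(k := i)"
  have old: "(\<Sum>j<k. g (s' j)) = (\<Sum>j<k. g (s j))" for g :: "'s \<Rightarrow> real"
    by (intro sum.cong) (auto simp: s'_def)
  have "(\<Sum>a\<in>A. (\<Sum>l\<in>I. (\<Sum>j<Suc k. Z a (s' j) l)\<^sup>2) / (2 * n) + (\<Sum>j<Suc k. (t a (s' j))\<^sup>2 / w (s' j)))
      = \<Phi> i + (\<Sum>a\<in>A. (\<Sum>j<k. (t a (s j))\<^sup>2 / w (s j)))"
    by (simp add: old[of "\<lambda>i. Z _ i _"] old[of "\<lambda>i. (t _ i)\<^sup>2 / w i"] \<Phi>_def R_def sum.distrib)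
      (simp add: s'_def)
  also have "\<dots> \<le> (\<Sum>a\<in>A. (\<Sum>l\<in>I. (R a l)\<^sup>2) / (2 * n) + 2 * r\<^sup>2) + (\<Sum>a\<in>A. (\<Sum>j<k. (t a (s j))\<^sup>2 / w (s j)))"
    using i(2) by simp
  also have "\<dots> = (\<Sum>a\<in>A. (\<Sum>l\<in>I. (R a l)\<^sup>2) / (2 * n) + (\<Sum>j<k. (t a (s j))\<^sup>2 / w (s j))) + 2 * r\<^sup>2 * card A"
    by (simp add: sum.distrib)
  also have "\<dots> \<le> 2 * real k * r\<^sup>2 * card A + 2 * r\<^sup>2 * card A"
    using s(2) unfolding R_def by simp
  also have "\<dots> = 2 * real (Suc k) * r\<^sup>2 * card A" by (simp add: algebra_simps)
  finally show ?case using s(1) i(1) by (intro exI[of _ s']) (auto simp: s'_def less_Suc_eq)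
qed

context normed_subspace begin

text \<open>The vectors (f (x i))_i fill a space of dimension at most card B, spanned by the
  coordinates of the x i with respect to B. q projects onto it, and its squared Hilbert-Schmidt norm
  is its trace.\<close>

lemma evaluation_projection:
  assumes B: "finite B" "V = span B" and I: "finite I" and x: "\<And>i. i \<in> I \<Longrightarrow> x i \<in> V"
  obtains q where "\<And>i j. q i j = q j i"
    "\<And>f j. linear f \<Longrightarrow> j \<in> I \<Longrightarrow> (\<Sum>i\<in>I. f (x i) * q i j) = (f (x j) :: real)"
    "(\<Sum>i\<in>I. \<Sum>j\<in>I. (q i j)\<^sup>2) \<le> real (card B)"
proof -
  have "\<forall>i\<in>I. \<exists>c. x i = (\<Sum>b\<in>B. c b *\<^sub>R b)"
    using x B by (auto simp: span_finite)
  from bchoice[OF this] obtain c where c: "\<And>i. i \<in> I \<Longrightarrow> x i = (\<Sum>b\<in>B. c i b *\<^sub>R b)" by blast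
  obtain q where q: "\<And>i j. q i j = q j i" "\<And>i k. i \<in> I \<Longrightarrow> k \<in> I \<Longrightarrow> (\<Sum>j\<in>I. q i j * q j k) = q i k"
    "\<And>b j. b \<in> B \<Longrightarrow> j \<in> I \<Longrightarrow> (\<Sum>i\<in>I. c i b * q i j) = c j b" "(\<Sum>i\<in>I. q i i) \<le> real (card B)"
    using orthogonal_projection_matrix[OF B(1) I, of "\<lambda>b i. c i b"] by blast
  show thesis
  proof (rule that[of q])
    fix f :: "'v \<Rightarrow> real" and j assume f: "linear f" and j: "j \<in> I"
    have fx: "f (x i) = (\<Sum>b\<in>B. f b * c i b)" if "i \<in> I" for i
      using c[OF that] f by (simp add: linear_sum linear_cmul mult.commute)
    have "(\<Sum>i\<in>I. f (x i) * q i j) = (\<Sum>i\<in>I. \<Sum>b\<in>B. f b * (c i b * q i j))"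
      by (simp add: fx sum_distrib_right mult.assoc)
    also have "\<dots> = (\<Sum>b\<in>B. f b * (\<Sum>i\<in>I. c i b * q i j))"
      by (subst sum.swap) (simp add: sum_distrib_left)
    also have "\<dots> = f (x j)" using q(3) j by (simp add: fx)
    finally show "(\<Sum>i\<in>I. f (x i) * q i j) = f (x j)" .
  next
    have "(\<Sum>j\<in>I. (q i j)\<^sup>2) = q i i" if "i \<in> I" for i
      using q(2)[OF that that] q(1) by (simp add: power2_eq_square)
    then show "(\<Sum>i\<in>I. \<Sum>j\<in>I. (q i j)\<^sup>2) \<le> real (card B)" using q(4) by simp
  qed (rule q(1))
qed

text \<open>One deterministic sample must serve many functionals. The potential of
  \<open>sampling\<close> is small on average over A, so by Markov at least half of A keeps its size
  and separation on the sampled vectors. Only errors of single functionals are summed, not those of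
  pairs: the error of f - g is the difference of two of them.\<close>

lemma sampled_packing:
  fixes x :: "'s \<Rightarrow> 'v"
  assumes B: "finite B" "V = span B" "card B \<le> n" "1 \<le> n"
    and I: "finite I" and x: "\<And>i. i \<in> I \<Longrightarrow> x i \<in> V" and norm1: "(\<Sum>i\<in>I. (N (x i))\<^sup>2) = 1"
    and A: "finite A" "A \<subseteq> dual_ball" and r: "0 < r"
    and small: "\<And>f. f \<in> A \<Longrightarrow> L2_set (\<lambda>i. f (x i)) I \<le> r"
    and sep: "\<And>f g. f \<in> A \<Longrightarrow> g \<in> A \<Longrightarrow> f \<noteq> g \<Longrightarrow> r / 2 \<le> L2_set (\<lambda>i. f (x i) - g (x i)) I"
    and M: "M = 512 * n"
  obtains A' y where "A' \<subseteq> A" "card A \<le> 2 * card A'" "\<And>j. j < M \<Longrightarrow> y j \<in> V"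
    "\<And>j. j < M \<Longrightarrow> N (y j) \<le> sqrt (2 / real M)"
    "\<And>f. f \<in> A' \<Longrightarrow> L2_set (\<lambda>j. f (y j)) {..<M} \<le> 2 * r"
    "\<And>f g. f \<in> A' \<Longrightarrow> g \<in> A' \<Longrightarrow> f \<noteq> g \<Longrightarrow> r / 4 \<le> L2_set (\<lambda>j. f (y j) - g (y j)) {..<M}"
proof -
  obtain q where q: "\<And>i j. q i j = q j i"
    "\<And>f j. linear f \<Longrightarrow> j \<in> I \<Longrightarrow> (\<Sum>i\<in>I. f (x i) * q i j) = (f (x j) :: real)"
    "(\<Sum>i\<in>I. \<Sum>j\<in>I. (q i j)\<^sup>2) \<le> real (card B)"
    by (rule evaluation_projection[of B I x]) (use B I x in auto)
  define \<pi> where "\<pi> i = (\<Sum>j\<in>I. (q i j)\<^sup>2)" for i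
  define P where "P = (\<Sum>i\<in>I. \<pi> i)"
  have n0: "real n > 0" using B by simp
  have P: "0 \<le> P" "P \<le> n" using q(3) B by (auto simp: P_def \<pi>_def intro!: sum_nonneg)
  have \<pi>0: "0 \<le> \<pi> i" for i by (auto simp: \<pi>_def intro!: sum_nonneg)
  \<comment> \<open>Half or more of the weight follows the squared norms, which bounds the norms of
    the rescaled samples; the rest follows the leverage scores \<pi>, which bounds the variance. The
    factor 1 - P / (2n) makes the total exactly 1.\<close>
  define w where "w i = (N (x i))\<^sup>2 * (1 - P / (2 * n)) + \<pi> i / (2 * n)" for i
  have Pn: "1 / 2 \<le> 1 - P / (2 * n)" using P n0 by (simp add: field_simps)
  have w_N: "(N (x i))\<^sup>2 / 2 \<le> w i" for i
    using mult_left_mono[OF Pn, of "(N (x i))\<^sup>2"] \<pi>0[of i] n0 by (simp add: w_def add_increasing2)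
  have w_\<pi>: "\<pi> i \<le> 2 * real n * w i" for i
  proof -
    have "0 \<le> (N (x i))\<^sup>2 * (1 - P / (2 * n))" using Pn by (intro mult_nonneg_nonneg) auto
    then have "\<pi> i / (2 * n) \<le> w i" by (simp add: w_def)
    then show ?thesis using n0 by (simp add: field_simps)
  qed
  have w0: "0 \<le> w i" for i using w_N[of i] zero_le_power2[of "N (x i)"] by linarith
  have w1: "(\<Sum>i\<in>I. w i) = 1"
  proof -
    have "(\<Sum>i\<in>I. w i) = (\<Sum>i\<in>I. (N (x i))\<^sup>2) * (1 - P / (2 * n)) + P / (2 * n)"
      by (simp add: w_def sum.distrib P_def sum_distrib_right sum_divide_distrib)
    then show ?thesis using norm1 by simp
  qed
  have lin: "linear f" if "f \<in> A" for f using that A dual_ball_linear by blast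
  have fw0: "f (x i) = 0" if "f \<in> A" "i \<in> I" "w i = 0" for f i
  proof -
    have "N (x i) = 0" using w_N[of i] that by simp
    then have "x i = 0" using N_eq_0_iff[OF x[OF that(2)]] by simp
    then show ?thesis using lin[OF that(1)] by (simp add: linear_0)
  qed
  have sq: "(\<Sum>i\<in>I. (f (x i))\<^sup>2) \<le> r\<^sup>2" if "f \<in> A" for f
    using power_mono[OF small[OF that], of 2] by (simp add: L2_set_sq)
  define Z where "Z f i l = f (x i) * q i l / w i - f (x l)" for f i l
  have "\<exists>s. (\<forall>j<M. s j \<in> I) \<and>
    (\<Sum>f\<in>A. (\<Sum>l\<in>I. (\<Sum>j<M. Z f (s j) l)\<^sup>2) / (2 * real n) + (\<Sum>j<M. (f (x (s j)))\<^sup>2 / w (s j)))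
      \<le> 2 * real M * r\<^sup>2 * card A"
    unfolding Z_def
    by (rule sampling[of I "real n" w A "\<lambda>f i. f (x i)" q r])
      (use I n0 w0 w1 fw0 w_\<pi> q(2) lin sq in \<open>auto simp: \<pi>_def\<close>)
  then obtain s where s: "\<And>j. j < M \<Longrightarrow> s j \<in> I"
    "(\<Sum>f\<in>A. (\<Sum>l\<in>I. (\<Sum>j<M. Z f (s j) l)\<^sup>2) / (2 * real n) + (\<Sum>j<M. (f (x (s j)))\<^sup>2 / w (s j)))
      \<le> 2 * real M * r\<^sup>2 * card A" by blast
  define R where "R f l = (\<Sum>j<M. Z f (s j) l)" for f l
  define val where "val f = (\<Sum>l\<in>I. (R f l)\<^sup>2) / (2 * real n) + (\<Sum>j<M. (f (x (s j)))\<^sup>2 / w (s j))" for f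
  have M0: "real M > 0" using M n0 by simp
  \<comment> \<open>Markov at twice the average 2 M r^2 of the potential.\<close>
  define A' where "A' = {f \<in> A. val f \<le> 4 * real M * r\<^sup>2}"
  \<comment> \<open>This scaling makes the sum of (f (y j))^2 an unbiased estimate of the sum of (f
    (x i))^2 under sampling from w. A sample of weight 0 gives y j = 0.\<close>
  define y where "y j = (1 / sqrt (M * w (s j))) *\<^sub>R x (s j)" for j
  have val0: "0 \<le> val f" for f unfolding val_def using w0 n0
    by (intro add_nonneg_nonneg sum_nonneg divide_nonneg_nonneg) auto
  have cardA: "card A \<le> 2 * card A'"
  proof -
    have sub: "A' \<subseteq> A" by (auto simp: A'_def)
    have "real (card (A - A')) * (4 * real M * r\<^sup>2) = (\<Sum>f\<in>A - A'. 4 * real M * r\<^sup>2)" by simp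
    also have "\<dots> \<le> (\<Sum>f\<in>A - A'. val f)" by (intro sum_mono) (auto simp: A'_def)
    also have "\<dots> \<le> (\<Sum>f\<in>A. val f)" using A val0 by (intro sum_mono2) auto
    also have "\<dots> \<le> 2 * real M * r\<^sup>2 * card A" using s(2) by (simp add: val_def R_def)
    finally have "(2 * real M * r\<^sup>2) * (2 * real (card (A - A'))) \<le> (2 * real M * r\<^sup>2) * card A"
      by (simp add: algebra_simps)
    then have "2 * real (card (A - A')) \<le> card A" using M0 r by simp
    moreover have "card A = card (A - A') + card A'"
      using A sub by (metis card_Diff_subset card_mono finite_subset le_add_diff_inverse2)
    ultimately show ?thesis by linarith
  qed
  have fy: "(f (y j))\<^sup>2 = (f (x (s j)))\<^sup>2 / w (s j) / M" if "linear f" for f j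
    using that w0[of "s j"] by (simp add: y_def linear_cmul power_mult_distrib power_divide)
  have yV: "y j \<in> V" if "j < M" for j
    unfolding y_def using x s(1) that subspace_V by (auto intro: subspace_scale)
  have yN: "N (y j) \<le> sqrt (2 / real M)" if "j < M" for j
  proof (rule real_le_rsqrt)
    have "(N (y j))\<^sup>2 = (N (x (s j)))\<^sup>2 / (M * w (s j))"
      using x s(1) that w0[of "s j"]
      by (simp add: y_def N_scaleR power_mult_distrib power_divide)
    also have "\<dots> \<le> 2 / M"
    proof (cases "w (s j) = 0")
      case False
      then have "w (s j) > 0" using w0[of "s j"] by simp
      then show ?thesis using w_N[of "s j"] M0 by (simp add: field_simps)
    qed simp
    finally show "(N (y j))\<^sup>2 \<le> 2 / M" .
  qed
  have ysmall: "L2_set (\<lambda>j. f (y j)) {..<M} \<le> 2 * r" if "f \<in> A'" for f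
  proof -
    have f: "f \<in> A" "val f \<le> 4 * real M * r\<^sup>2" using that by (auto simp: A'_def)
    have "(\<Sum>j<M. (f (x (s j)))\<^sup>2 / w (s j)) \<le> val f"
      using n0 by (simp add: val_def sum_nonneg)
    then have "(\<Sum>j<M. (f (x (s j)))\<^sup>2 / w (s j)) / M \<le> 4 * r\<^sup>2"
      using f(2) M0 by (simp add: field_simps)
    then have "(L2_set (\<lambda>j. f (y j)) {..<M})\<^sup>2 \<le> (2 * r)\<^sup>2"
      by (simp add: L2_set_sq fy[OF lin[OF f(1)]] sum_divide_distrib)
    then show ?thesis using r by (rule_tac power2_le_imp_le) auto
  qed
  have Rsmall: "L2_set (R f) I \<le> M * r / 8" if "f \<in> A'" for f
  proof -
    have "(\<Sum>l\<in>I. (R f l)\<^sup>2) / (2 * real n) \<le> val f"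
      unfolding val_def using w0 by (simp add: sum_nonneg)
    also have "\<dots> \<le> 4 * real M * r\<^sup>2" using that by (simp add: A'_def)
    finally have "(\<Sum>l\<in>I. (R f l)\<^sup>2) \<le> 8 * real n * M * r\<^sup>2" using n0 by (simp add: field_simps)
    \<comment> \<open>The origin of 512: 8 n M equals (M / 8)^2 for M = 512 n.\<close>
    also have "\<dots> = (M * r / 8)\<^sup>2" by (simp add: M power2_eq_square)
    finally have "(L2_set (R f) I)\<^sup>2 \<le> (M * r / 8)\<^sup>2" by (simp add: L2_set_sq)
    then show ?thesis using r by (rule_tac power2_le_imp_le) auto
  qed
  have ysep: "r / 4 \<le> L2_set (\<lambda>j. f (y j) - g (y j)) {..<M}" if fg: "f \<in> A'" "g \<in> A'" "f \<noteq> g" for f g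
  proof -
    have fgA: "f \<in> A" "g \<in> A" using fg by (auto simp: A'_def)
    define h where "h v = f v - g v" for v
    have linh: "linear h" using lin[OF fgA(1)] lin[OF fgA(2)] unfolding h_def by (rule linear_compose_sub)
    define T where "T = L2_set (\<lambda>i. h (x i)) I"
    define L where "L = L2_set (\<lambda>j. h (y j)) {..<M}"
    have T: "r / 2 \<le> T" using sep[OF fgA fg(3)] by (simp add: T_def h_def)
    have qh: "(\<Sum>l\<in>I. h (x l) * q i l) = h (x i)" if "i \<in> I" for i
      using q(2)[OF linh that] q(1)[of i] by simp
    have L2: "L\<^sup>2 = (\<Sum>j<M. (h (x (s j)))\<^sup>2 / w (s j)) / M"
      by (simp add: L_def L2_set_sq fy[OF linh] sum_divide_distrib)
    \<comment> \<open>R f - R g is the covariance error applied to h = f - g. Pairing it with h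
      itself yields the discrepancy between the sampled and the original square norm of h.\<close>
    have "(\<Sum>l\<in>I. h (x l) * (R f l - R g l))
        = (\<Sum>j<M. \<Sum>l\<in>I. h (x l) * (Z f (s j) l - Z g (s j) l))"
      by (subst sum.swap) (simp add: R_def sum_distrib_left sum_subtractf right_diff_distrib)
    also have "\<dots> = (\<Sum>j<M. (h (x (s j)))\<^sup>2 / w (s j) - T\<^sup>2)"
    proof (rule sum.cong)
      fix j assume "j \<in> {..<M}"
      then have sj: "s j \<in> I" using s(1) by simp
      have "(\<Sum>l\<in>I. h (x l) * (Z f (s j) l - Z g (s j) l))
          = (\<Sum>l\<in>I. h (x (s j)) / w (s j) * (h (x l) * q (s j) l) - (h (x l))\<^sup>2)"
        by (intro sum.cong)
          (auto simp: Z_def h_def power2_eq_square algebra_simps diff_divide_distrib add_divide_distrib)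
      also have "\<dots> = h (x (s j)) / w (s j) * (\<Sum>l\<in>I. h (x l) * q (s j) l) - T\<^sup>2"
        by (simp add: sum_subtractf sum_distrib_left T_def L2_set_sq)
      finally show "(\<Sum>l\<in>I. h (x l) * (Z f (s j) l - Z g (s j) l)) = (h (x (s j)))\<^sup>2 / w (s j) - T\<^sup>2"
        using qh[OF sj] by (simp add: power2_eq_square)
    qed simp
    also have "\<dots> = M * L\<^sup>2 - M * T\<^sup>2" using M0 by (simp add: sum_subtractf L2)
    finally have id: "(\<Sum>l\<in>I. h (x l) * (R f l - R g l)) = M * L\<^sup>2 - M * T\<^sup>2" .
    have "(\<Sum>l\<in>I. h (x l) * (R g l - R f l)) \<le> T * L2_set (\<lambda>l. R g l - R f l) I"
      unfolding T_def by (rule sum_mult_le_L2_set)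
    also have "\<dots> \<le> T * (M * r / 4)"
      using L2_set_diff_le[of "R g" "R f" I] Rsmall[OF fg(1)] Rsmall[OF fg(2)]
      by (intro mult_left_mono) (auto simp: T_def)
    finally have "M * T\<^sup>2 - M * L\<^sup>2 \<le> T * (M * r / 4)"
      using id by (simp add: right_diff_distrib sum_subtractf)
    then have "M * (T * (T - r / 4)) \<le> M * L\<^sup>2" by (simp add: algebra_simps power2_eq_square)
    then have "T * (T - r / 4) \<le> L\<^sup>2" using M0 by simp
    \<comment> \<open>T has no upper bound here, so its relative loss is estimated: T (T - r / 4)
      increases for T at least r / 2.\<close>
    moreover have "(r / 2) * (r / 2 - r / 4) \<le> T * (T - r / 4)"
      using T r by (intro mult_mono) auto
    moreover have "(r / 4)\<^sup>2 \<le> (r / 2) * (r / 2 - r / 4)"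
      using zero_le_square[of r] by (simp add: power2_eq_square field_simps)
    ultimately have "(r / 4)\<^sup>2 \<le> L\<^sup>2" by linarith
    then have "r / 4 \<le> L" by (rule power2_le_imp_le) (simp add: L_def)
    then show ?thesis by (simp add: L_def h_def)
  qed
  show thesis
    by (rule that[of A' y]) (use cardA yV yN ysmall ysep in \<open>auto simp: A'_def\<close>)
qed

end

lemma L2_set_half: "L2_set (\<lambda>s. f s / 2) A = L2_set f A / 2"
  using L2_set_scale[of "1/2" f A] by simp

section \<open>Entropy of the dual ball\<close>

locale finite_infratype_space = infratype_space V N p J
  for V :: "'v::real_vector set" and N :: "'v \<Rightarrow> real" and p :: nat and J :: real +
  fixes n :: nat and B :: "'v set" and lam :: real
  assumes basis: "finite B" "V = span B" "card B \<le> n" "1 \<le> n"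
    and lam: "0 < lam" "lam \<le> 1" "lam * n \<le> p"
begin

lemma n_pos: "0 < real n" using basis by simp

text \<open>The scale at which the trivial estimate in dimension n,
  \<open>base_scale * sqrt n\<close>, equals 2048 J / sqrt lam; finer nets would gain
  nothing.\<close>

definition "base_scale = 2048 * (J / sqrt (lam * n))"

definition "radius j = 2 ^ j * base_scale"

text \<open>
  2097152 is 4096 * 512: the number of points averaged in the convex packing argument times the
  number of sampled vectors per dimension.
\<close>

definition "entropy_bound j =
  2097152 * (1 + n * ((1/4) ^ j * ((1/4) ^ j + 2 * lam)) * (4 * real j + 3))"

lemma base_scale_pos: "0 < base_scale"
  unfolding base_scale_def using J_pos lam n_pos by simp

lemma radius_pos: "0 < radius j"
  unfolding radius_def using base_scale_pos by simp

lemma entropy_bound_ge_1: "1 \<le> entropy_bound j"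
proof -
  have "0 \<le> n * ((1/4) ^ j * ((1/4) ^ j + 2 * lam)) * (4 * real j + 3)"
    using lam by (intro mult_nonneg_nonneg add_nonneg_nonneg) auto
  then show ?thesis by (simp add: entropy_bound_def)
qed

text \<open>
  The number of rounding steps grows like 4j while 16^j \<le> 1/\<lambda>, and like 2j afterwards; the
  rounding error then stays below the radius.
\<close>

lemma rounding_level:
  obtains l :: nat where
    "256 * (J * ((real l + 2) / sqrt p + 4 * sqrt 2 ^ l / sqrt (512 * real n))) \<le> radius j"
    "1 / 2 ^ l \<le> (1/4) ^ j * ((1/4) ^ j + 2 * lam)" "l \<le> 4 * j"
proof -
  define q where "q = nat \<lfloor>log 2 (1 / lam)\<rfloor>"
  have "0 \<le> log 2 (1 / lam)" using lam by (simp add: zero_le_log_cancel_iff)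
  then have q: "real q \<le> log 2 (1 / lam)" "log 2 (1 / lam) < real q + 1"
    unfolding q_def by linarith+
  have "2 powr real q \<le> 1 / lam" using q(1) lam by (simp add: le_log_iff)
  then have q1: "2 ^ q \<le> 1 / lam" by (simp add: powr_realpow)
  have "1 / lam < 2 powr (real q + 1)" using q(2) lam by (simp add: log_less_iff)
  then have "1 / lam < 2 * 2 ^ q" by (simp add: powr_add powr_realpow mult.commute)
  then have q2: "1 / 2 ^ q \<le> 2 * lam" using lam by (simp add: field_simps)
  \<comment> \<open>The switch is at 4^j = 1 / lam. Capping the second summand at q keeps 2^l at
    most 4^j / lam, all that the square root error tolerates at radius 2^j
    \<open>base_scale\<close>; the uncapped value gives the faster decay 16^-j.\<close>
  define l where "l = 2 * j + min (2 * j) q"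
  have l4: "l \<le> 4 * j" by (simp add: l_def)
  have pow: "(2::real) ^ l = 4 ^ j * 2 ^ min (2 * j) q"
    by (simp add: l_def power_add power_mult)
  have small: "1 / 2 ^ l \<le> (1/4) ^ j * ((1/4) ^ j + 2 * lam)"
  proof -
    have "1 / 2 ^ min (2 * j) q \<le> (1/4) ^ j + 2 * lam"
    proof (cases "2 * j \<le> q")
      case True
      then show ?thesis using lam by (simp add: min_def power_mult power_one_over)
    next
      case False
      have "0 \<le> (1/4::real) ^ j" by simp
      then have "1 / 2 ^ q \<le> (1/4) ^ j + 2 * lam" using q2 by linarith
      then show ?thesis using False by (simp add: min_def)
    qed
    then have "(1/4) ^ j * (1 / 2 ^ min (2 * j) q) \<le> (1/4) ^ j * ((1/4) ^ j + 2 * lam)"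
      by (intro mult_left_mono) auto
    then show ?thesis by (simp add: pow power_one_over)
  qed
  define \<rho> where "\<rho> = J / sqrt (lam * n)"
  have \<rho>: "0 \<le> \<rho>" using J_pos lam by (simp add: \<rho>_def)
  have "sqrt (lam * n) \<le> sqrt p" using lam(3) by simp
  moreover have "0 < sqrt (lam * n)" using lam n_pos by simp
  ultimately have Jp: "J / sqrt p \<le> \<rho>"
    unfolding \<rho>_def using J_pos by (intro divide_left_mono) auto
  have lin: "4 * real j + 2 \<le> 4 * 2 ^ j"
  proof (induction j)
    case (Suc j)
    define P :: real where "P = 2 ^ j"
    have "1 \<le> P" "4 * real j + 2 \<le> 4 * P" using Suc by (auto simp: P_def)
    then have "4 * (1 + real j) + 2 \<le> 4 * (2 * P)" by argo
    then show ?case by (simp add: P_def)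
  qed auto
  have "J * ((real l + 2) / sqrt p) = (real l + 2) * (J / sqrt p)" by simp
  also have "\<dots> \<le> (4 * 2 ^ j) * \<rho>"
  proof (intro mult_mono Jp)
    have "real l + 2 \<le> 4 * real j + 2" using l4 by linarith
    also note lin
    finally show "real l + 2 \<le> 4 * 2 ^ j" .
  qed (use J_pos in auto)
  finally have 1: "J * ((real l + 2) / sqrt p) \<le> 4 * 2 ^ j * \<rho>" .
  have "sqrt 2 ^ l = sqrt (2 ^ l)" by (simp add: real_sqrt_power)
  also have "\<dots> \<le> sqrt (4 ^ j * (1 / lam))"
  proof -
    have "(2::real) ^ min (2 * j) q \<le> 2 ^ q" by (intro power_increasing) auto
    then have "(2::real) ^ min (2 * j) q \<le> 1 / lam" using q1 by linarith
    then have "(2::real) ^ l \<le> 4 ^ j * (1 / lam)" unfolding pow by (intro mult_left_mono) auto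
    then show ?thesis by simp
  qed
  also have "\<dots> = 2 ^ j / sqrt lam"
  proof -
    have "(4::real) ^ j = (2 ^ j)\<^sup>2" by (simp add: power2_eq_square flip: power_mult_distrib)
    then show ?thesis by (simp add: real_sqrt_divide)
  qed
  finally have s: "sqrt 2 ^ l \<le> 2 ^ j / sqrt lam" .
  have "J * (4 * sqrt 2 ^ l / sqrt (512 * real n)) \<le> J * (4 * (2 ^ j / sqrt lam) / sqrt n)"
    using J_pos s n_pos lam(1) by (intro mult_left_mono frac_le) auto
  also have "\<dots> = 4 * 2 ^ j * \<rho>" by (simp add: \<rho>_def real_sqrt_mult)
  finally have 2: "J * (4 * sqrt 2 ^ l / sqrt (512 * real n)) \<le> 4 * 2 ^ j * \<rho>" .
  have "256 * (J * ((real l + 2) / sqrt p + 4 * sqrt 2 ^ l / sqrt (512 * real n)))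
      = 256 * (J * ((real l + 2) / sqrt p) + J * (4 * sqrt 2 ^ l / sqrt (512 * real n)))"
    by (simp add: distrib_left)
  also have "\<dots> \<le> 256 * (4 * 2 ^ j * \<rho> + 4 * 2 ^ j * \<rho>)"
    using 1 2 by (intro mult_left_mono add_mono) auto
  \<comment> \<open>The constant in \<open>base_scale\<close> is 2048 = 256 (4 + 4), from the two
    error terms.\<close>
  also have "\<dots> = radius j" by (simp add: radius_def base_scale_def \<rho>_def)
  finally show thesis using small l4 by (rule that)
qed

end

locale normalized_vectors = finite_infratype_space V N p J n B lam
  for V :: "'v::real_vector set" and N :: "'v \<Rightarrow> real" and p J n B lam +
  fixes I :: "'s set" and x :: "'s \<Rightarrow> 'v"
  assumes finite_I: "finite I" and x_in_V: "\<And>i. i \<in> I \<Longrightarrow> x i \<in> V"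
    and normalized: "(\<Sum>i\<in>I. (N (x i))\<^sup>2) = 1"
begin

lemma localized_packing:
  assumes A: "finite A" "A \<subseteq> dual_ball"
    and small: "\<And>f. f \<in> A \<Longrightarrow> L2_set (\<lambda>i. f (x i)) I \<le> radius j"
    and sep: "\<And>f g. f \<in> A \<Longrightarrow> g \<in> A \<Longrightarrow> f \<noteq> g \<Longrightarrow>
      radius j / 2 \<le> L2_set (\<lambda>i. f (x i) - g (x i)) I"
  shows "real (card A) \<le> exp (entropy_bound j)"
proof -
  define M where "M = 512 * n"
  obtain l where l: "256 * (J * ((real l + 2) / sqrt p + 4 * sqrt 2 ^ l / sqrt (512 * real n))) \<le> radius j"
    "1 / 2 ^ l \<le> (1/4) ^ j * ((1/4) ^ j + 2 * lam)" "l \<le> 4 * j"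
    by (rule rounding_level)
  obtain A' y where A': "A' \<subseteq> A" "card A \<le> 2 * card A'" "\<And>j. j < M \<Longrightarrow> y j \<in> V"
    "\<And>j. j < M \<Longrightarrow> N (y j) \<le> sqrt (2 / real M)"
    "\<And>f. f \<in> A' \<Longrightarrow> L2_set (\<lambda>i. f (y i)) {..<M} \<le> 2 * radius j"
    "\<And>f g. f \<in> A' \<Longrightarrow> g \<in> A' \<Longrightarrow> f \<noteq> g \<Longrightarrow> radius j / 4 \<le> L2_set (\<lambda>i. f (y i) - g (y i)) {..<M}"
  proof (rule sampled_packing[where x = x and A = A and r = "radius j", OF basis finite_I x_in_V
          normalized A radius_pos small sep M_def])
  qed (assumption | (rule that; simp))+
  have M: "real M = 512 * real n" by (simp add: M_def)
  have "card A' \<le> (257 * exp (real M / 2 ^ l * (real l + 3))) ^ 4096"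
  proof (rule dual_packing_bound[where I = "{..<M}" and y = y and r = "radius j"])
    show "256 * (J * ((real l + 2) / sqrt p + 4 * sqrt 2 ^ l / sqrt (real M))) \<le> radius j"
      using l(1) by (simp add: M)
    show "{..<M} \<noteq> {}" unfolding M_def lessThan_empty_iff using n_pos by simp
    show "finite A'" "A' \<subseteq> dual_ball" using A A'(1) finite_subset by auto
  qed (use A' in auto)
  also have "\<dots> \<le> (exp 7 * exp (real M / 2 ^ l * (real l + 3))) ^ 4096"
  proof (intro power_mono mult_right_mono)
    \<comment> \<open>The constants go into the exponent: 257 is at most e^7 and the factor 2 lost
      in sampling at most e, so 4096 * 7 + 1 = 28673, well below the constant of
      \<open>entropy_bound\<close>.\<close>
    have "(257::real) \<le> (3/2) ^ 14" by (simp add: power_numeral_reduce)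
    also have "\<dots> \<le> exp (1/2) ^ 14"
      using exp_ge_add_one_self[of "1/2::real"] by (intro power_mono) auto
    also have "\<dots> = exp 7" by (simp add: exp_of_nat_mult[symmetric])
    finally show "(257::real) \<le> exp 7" .
  qed auto
  also have "\<dots> = exp (4096 * (7 + real M / 2 ^ l * (real l + 3)))"
    by (simp add: exp_add[symmetric] exp_of_nat_mult[symmetric])
  finally have "2 * real (card A') \<le> exp 1 * exp (4096 * (7 + real M / 2 ^ l * (real l + 3)))"
    using exp_ge_add_one_self[of "1::real"] by (intro mult_mono) auto
  then have "real (card A) \<le> exp (28673 + 4096 * (real M / 2 ^ l * (real l + 3)))"
    using A'(2) by (simp add: exp_add[symmetric] algebra_simps)
  also have "\<dots> \<le> exp (entropy_bound j)"
  proof -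
    have "1 / 2 ^ l * (real l + 3) \<le> (1/4) ^ j * ((1/4) ^ j + 2 * lam) * (4 * real j + 3)"
      using l lam by (intro mult_mono) auto
    then have "real n * (1 / 2 ^ l * (real l + 3)) \<le> n * ((1/4) ^ j * ((1/4) ^ j + 2 * lam) * (4 * real j + 3))"
      by (intro mult_left_mono) auto
    moreover have "real M / 2 ^ l * (real l + 3) = 512 * (real n * (1 / 2 ^ l * (real l + 3)))"
      by (simp add: M)
    moreover have "entropy_bound j
        = 2097152 * (1 + n * ((1/4) ^ j * ((1/4) ^ j + 2 * lam) * (4 * real j + 3)))"
      by (simp add: entropy_bound_def)
    ultimately have "28673 + 4096 * (real M / 2 ^ l * (real l + 3)) \<le> entropy_bound j" by argo
    then show ?thesis by simp
  qed
  finally show ?thesis .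
qed

abbreviation ev_dist :: "('v \<Rightarrow> real) \<Rightarrow> ('v \<Rightarrow> real) \<Rightarrow> real" where
  "ev_dist f g \<equiv> L2_set (\<lambda>i. f (x i) - g (x i)) I"

text \<open>A maximal separated set in the ball of radius 2R about e is a net. The map f -> (f - e)
  / 2 carries it into the dual ball with size at most R and separation R / 2, where
  \<open>localized_packing\<close> bounds its cardinality and so ensures that a maximal set
  exists.\<close>

lemma local_net:
  assumes e: "e \<in> dual_ball"
  obtains S where "finite S" "S \<subseteq> dual_ball" "real (card S) \<le> exp (entropy_bound j)"
    "\<And>f. f \<in> dual_ball \<Longrightarrow> ev_dist f e \<le> 2 * radius j \<Longrightarrow> \<exists>g\<in>S. ev_dist f g \<le> radius j"
proof -
  define R where "R = radius j"
  define Q where "Q S \<longleftrightarrow> finite S \<and> S \<subseteq> {f \<in> dual_ball. ev_dist f e \<le> 2 * R} \<and>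
    (\<forall>f\<in>S. \<forall>g\<in>S. f \<noteq> g \<longrightarrow> R < ev_dist f g)" for S
  have bound: "real (card S) \<le> exp (entropy_bound j)" if "Q S" for S
  proof -
    define \<phi> where "\<phi> f = (\<lambda>v. (f v - e v) / 2)" for f :: "'v \<Rightarrow> real"
    have "inj \<phi>"
    proof (rule injI)
      fix f g assume "\<phi> f = \<phi> g"
      then have "\<phi> f v = \<phi> g v" for v by simp
      then have "f v = g v" for v by (simp add: \<phi>_def)
      then show "f = g" by blast
    qed
    then have "card S = card (\<phi> ` S)" by (simp add: card_image inj_on_subset)
    also have "real (card (\<phi> ` S)) \<le> exp (entropy_bound j)"
    proof (rule localized_packing)
      show "finite (\<phi> ` S)" using that by (simp add: Q_def)
      show "\<phi> ` S \<subseteq> dual_ball"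
        using that e half_diff_in_dual_ball by (auto simp: Q_def \<phi>_def)
    next
      fix h assume "h \<in> \<phi> ` S"
      then obtain f where f: "f \<in> S" "h = \<phi> f" by blast
      have "L2_set (\<lambda>i. h (x i)) I = ev_dist f e / 2"
        by (simp add: f \<phi>_def L2_set_half)
      also have "\<dots> \<le> radius j" using that f by (auto simp: Q_def R_def)
      finally show "L2_set (\<lambda>i. h (x i)) I \<le> radius j" .
    next
      fix h k assume "h \<in> \<phi> ` S" "k \<in> \<phi> ` S" "h \<noteq> k"
      then obtain f g where f: "f \<in> S" "h = \<phi> f" and g: "g \<in> S" "k = \<phi> g" and "f \<noteq> g" by blast
      have "h (x i) - k (x i) = (f (x i) - g (x i)) / 2" for i
        by (simp add: f g \<phi>_def diff_divide_distrib)
      then have "L2_set (\<lambda>i. h (x i) - k (x i)) I = ev_dist f g / 2" by (simp only: L2_set_half)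
      moreover have "R < ev_dist f g" using that f g \<open>f \<noteq> g\<close> by (auto simp: Q_def)
      ultimately show "radius j / 2 \<le> L2_set (\<lambda>i. h (x i) - k (x i)) I" by (simp add: R_def)
    qed
    finally show ?thesis .
  qed
  have "Q {}" by (simp add: Q_def)
  moreover have "card S < Suc (nat \<lfloor>exp (entropy_bound j)\<rfloor>)" if "Q S" for S
    using bound[OF that] by (simp add: less_Suc_eq_le le_nat_floor)
  ultimately have "\<exists>S. Q S \<and> (\<forall>T. Q T \<longrightarrow> card T \<le> card S)"
    using ex_has_greatest_nat[of Q "{}" card "Suc (nat \<lfloor>exp (entropy_bound j)\<rfloor>)"] by blast
  then obtain S where S: "Q S" "\<And>T. Q T \<Longrightarrow> card T \<le> card S" by blast
  have finS: "finite S" "S \<subseteq> dual_ball" using S(1) by (auto simp: Q_def)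
  have "\<exists>g\<in>S. ev_dist f g \<le> radius j" if f: "f \<in> dual_ball" "ev_dist f e \<le> 2 * radius j" for f
  proof (rule ccontr)
    assume "\<not> ?thesis"
    then have far: "R < ev_dist f g" if "g \<in> S" for g using that by (force simp: R_def)
    have "f \<notin> S"
    proof
      assume "f \<in> S"
      from far[OF this] show False using radius_pos[of j] by (simp add: R_def L2_set_def)
    qed
    have "Q (insert f S)"
      using S(1) f far far[unfolded L2_set_minus_commute[of "\<lambda>i. f (x i)"]]
      unfolding Q_def R_def by auto
    from S(2)[OF this] show False using \<open>f \<notin> S\<close> finS by simp
  qed
  then show thesis using finS bound[OF S(1)] by (intro that[of S]) auto
qed

lemma refine_net:
  assumes E: "finite E" "E \<subseteq> dual_ball" "\<And>f. f \<in> dual_ball \<Longrightarrow> \<exists>e\<in>E. ev_dist f e \<le> radius (Suc j)"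
  obtains E' where "finite E'" "E' \<subseteq> dual_ball" "real (card E') \<le> card E * exp (entropy_bound j)"
    "\<And>f. f \<in> dual_ball \<Longrightarrow> \<exists>e\<in>E'. ev_dist f e \<le> radius j"
proof -
  have "\<forall>e\<in>E. \<exists>S. finite S \<and> S \<subseteq> dual_ball \<and> real (card S) \<le> exp (entropy_bound j) \<and>
    (\<forall>f\<in>dual_ball. ev_dist f e \<le> 2 * radius j \<longrightarrow> (\<exists>g\<in>S. ev_dist f g \<le> radius j))"
  proof
    fix e assume "e \<in> E"
    then have "e \<in> dual_ball" using E(2) by blast
    then show "\<exists>S. finite S \<and> S \<subseteq> dual_ball \<and>
      real (card S) \<le> exp (entropy_bound j) \<and>
      (\<forall>f\<in>dual_ball. ev_dist f e \<le> 2 * radius j \<longrightarrow> (\<exists>g\<in>S. ev_dist f g \<le> radius j))"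
      by (rule local_net[where j = j]) blast
  qed
  from bchoice[OF this] obtain S where S: "\<And>e. e \<in> E \<Longrightarrow> finite (S e)" "\<And>e. e \<in> E \<Longrightarrow> S e \<subseteq> dual_ball"
    "\<And>e. e \<in> E \<Longrightarrow> real (card (S e)) \<le> exp (entropy_bound j)"
    "\<And>e f. e \<in> E \<Longrightarrow> f \<in> dual_ball \<Longrightarrow> ev_dist f e \<le> 2 * radius j \<Longrightarrow> \<exists>g\<in>S e. ev_dist f g \<le> radius j"
    by blast
  show thesis
  proof (rule that[of "\<Union>e\<in>E. S e"])
    have "real (card (\<Union>e\<in>E. S e)) \<le> (\<Sum>e\<in>E. real (card (S e)))"
      using card_UN_le[OF E(1), of S] by (metis of_nat_le_iff of_nat_sum)
    also have "\<dots> \<le> (\<Sum>e\<in>E. exp (entropy_bound j))" by (intro sum_mono S(3))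
    finally show "real (card (\<Union>e\<in>E. S e)) \<le> card E * exp (entropy_bound j)" by simp
  next
    fix f assume f: "f \<in> dual_ball"
    obtain e where e: "e \<in> E" "ev_dist f e \<le> radius (Suc j)" using E(3)[OF f] by blast
    then have "ev_dist f e \<le> 2 * radius j" by (simp add: radius_def)
    from S(4)[OF e(1) f this] show "\<exists>e\<in>\<Union>e\<in>E. S e. ev_dist f e \<le> radius j" using e(1) by blast
  next
    show "finite (\<Union>e\<in>E. S e)" using E(1) S(1) by blast
    show "(\<Union>e\<in>E. S e) \<subseteq> dual_ball" using S(2) by blast
  qed
qed

text \<open>Nets are built downwards from the single functional 0, which suffices at radius 1
  because the normalization bounds every evaluation vector by 1. Each halving of the radius
  multiplies the cardinality by a local net bound.\<close>

lemma net_sequence: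
  assumes top: "1 \<le> radius m"
  obtains E where "E m = {\<lambda>_. 0}" "\<And>j. j \<le> m \<Longrightarrow> finite (E j)"
    "\<And>j. j \<le> m \<Longrightarrow> real (card (E j)) \<le> exp (\<Sum>i\<in>{j..<m}. entropy_bound i)"
    "\<And>j. j \<le> m \<Longrightarrow> E j \<subseteq> dual_ball"
    "\<And>j f. j \<le> m \<Longrightarrow> f \<in> dual_ball \<Longrightarrow> \<exists>e\<in>E j. ev_dist f e \<le> radius j"
proof -
  define Q where "Q j E \<longleftrightarrow> finite E \<and> real (card E) \<le> exp (\<Sum>i\<in>{j..<m}. entropy_bound i) \<and>
    E \<subseteq> dual_ball \<and> (\<forall>f\<in>dual_ball. \<exists>e\<in>E. ev_dist f e \<le> radius j)" for j and E :: "('v \<Rightarrow> real) set"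
  have Qm: "Q m {\<lambda>_. 0}"
  proof -
    have "L2_set (\<lambda>i. f (x i)) I \<le> 1" if "f \<in> dual_ball" for f
    proof -
      have "(\<Sum>i\<in>I. (f (x i))\<^sup>2) \<le> (\<Sum>i\<in>I. (N (x i))\<^sup>2)"
      proof (rule sum_mono)
        fix i assume "i \<in> I"
        then have "\<bar>f (x i)\<bar> \<le> N (x i)" using dual_ball_bound[OF that] x_in_V by blast
        from power_mono[OF this, of 2] show "(f (x i))\<^sup>2 \<le> (N (x i))\<^sup>2" by simp
      qed
      then show ?thesis using normalized by (simp add: L2_set_def)
    qed
    then have "ev_dist f (\<lambda>_. 0) \<le> radius m" if "f \<in> dual_ball" for f
      using order_trans[OF _ top] that by simp
    then show ?thesis using zero_in_dual_ball by (simp add: Q_def)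
  qed
  have "\<exists>E. Q j E" if "j \<le> m" for j
    using that
  proof (induction rule: inc_induct)
    case base
    show ?case using Qm by blast
  next
    case (step j)
    then obtain E where E: "Q (Suc j) E" by blast
    obtain E' where E': "finite E'" "E' \<subseteq> dual_ball" "real (card E') \<le> card E * exp (entropy_bound j)"
      "\<And>f. f \<in> dual_ball \<Longrightarrow> \<exists>e\<in>E'. ev_dist f e \<le> radius j"
    proof (rule refine_net[of E j])
      show "finite E" "E \<subseteq> dual_ball" using E by (auto simp: Q_def)
      show "\<exists>e\<in>E. ev_dist f e \<le> radius (Suc j)" if "f \<in> dual_ball" for f
        using E that by (auto simp: Q_def)
    qed (rule that; blast)
    note E'(3)
    also have "card E * exp (entropy_bound j) \<le> exp (\<Sum>i\<in>{Suc j..<m}. entropy_bound i) * exp (entropy_bound j)"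
      using E by (intro mult_right_mono) (auto simp: Q_def)
    also have "\<dots> = exp (\<Sum>i\<in>{j..<m}. entropy_bound i)"
      using step.hyps by (simp add: exp_add[symmetric] sum.atLeast_Suc_lessThan add.commute)
    finally show ?case using E' by (intro exI[of _ E']) (auto simp: Q_def)
  qed
  then have "\<forall>j. \<exists>E. j \<le> m \<longrightarrow> Q j E \<and> (j = m \<longrightarrow> E = {\<lambda>_. 0})" using Qm by metis
  from choice[OF this] obtain E where E: "\<And>j. j \<le> m \<Longrightarrow> Q j (E j) \<and> (j = m \<longrightarrow> E j = {\<lambda>_. 0})" by blast
  show thesis by (rule that[of E]) (use E in \<open>auto simp: Q_def\<close>)
qed

end

section \<open>Chaining\<close>

text \<open>The common ground of Gaussian vectors and random signs: only the moment generating
  function of linear combinations is controlled.\<close>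

locale subgaussian_process = prob_space \<Omega> for \<Omega> :: "'w measure" +
  fixes I :: "'s set" and g :: "'w \<Rightarrow> 's \<Rightarrow> real"
  assumes finite_index: "finite I"
    and exp_integrable: "\<And>t. integrable \<Omega> (\<lambda>\<omega>. exp (\<Sum>i\<in>I. t i * g \<omega> i))"
    and exp_le: "\<And>t. (\<integral>\<omega>. exp (\<Sum>i\<in>I. t i * g \<omega> i) \<partial>\<Omega>) \<le> exp ((\<Sum>i\<in>I. (t i)\<^sup>2) / 2)"
begin

text \<open>The maximum is linearized by 1 + (s u - k) \<le> exp (s u - k). Summing the exponentials
  over Q gives an integrable function above all the variables, with no logarithm of an expectation
  to take.\<close>

lemma max_majorant:
  assumes Q: "finite Q" "\<And>t. t \<in> Q \<Longrightarrow> L2_set t I \<le> R" and R: "0 < R"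
    and h: "0 < h" "real (card Q) \<le> exp h"
  shows "\<exists>\<Psi>. integrable \<Omega> \<Psi> \<and> (\<forall>\<omega>. \<forall>t\<in>Q. (\<Sum>i\<in>I. t i * g \<omega> i) \<le> \<Psi> \<omega>) \<and>
    (\<integral>\<omega>. \<Psi> \<omega> \<partial>\<Omega>) \<le> 2 * R * sqrt h"
proof -
  define s where "s = sqrt h / R"
  have s: "0 < s" using h R by (simp add: s_def)
  \<comment> \<open>h accounts for the cardinality and h / 2 for the exponential moment at s R =
    sqrt h; with this k the weighted sum has mean at most 1.\<close>
  define k where "k = 3 / 2 * h"
  define e where "e t \<omega> = exp (\<Sum>i\<in>I. (s * t i) * g \<omega> i)" for t \<omega>
  define \<Psi> where "\<Psi> \<omega> = (1 / s) * (k - 1 + exp (- k) * (\<Sum>t\<in>Q. e t \<omega>))" for \<omega>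
  have int: "integrable \<Omega> (e t)" for t unfolding e_def by (rule exp_integrable)
  have 1: "integrable \<Omega> \<Psi>"
    unfolding \<Psi>_def using int by simp
  have 2: "(\<Sum>i\<in>I. t i * g \<omega> i) \<le> \<Psi> \<omega>" if t: "t \<in> Q" for t \<omega>
  proof -
    define u where "u = (\<Sum>i\<in>I. t i * g \<omega> i)"
    have "e t \<omega> = exp (s * u)" by (simp add: e_def u_def sum_distrib_left mult.assoc)
    moreover have "e t \<omega> \<le> (\<Sum>t\<in>Q. e t \<omega>)" using Q(1) t by (intro member_le_sum) (auto simp: e_def)
    ultimately have "exp (- k) * exp (s * u) \<le> exp (- k) * (\<Sum>t\<in>Q. e t \<omega>)" by simp
    moreover have "1 + (s * u - k) \<le> exp (- k) * exp (s * u)"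
      using exp_ge_add_one_self[of "s * u - k"] by (simp add: exp_diff exp_minus field_simps)
    ultimately have "s * u \<le> k - 1 + exp (- k) * (\<Sum>t\<in>Q. e t \<omega>)" by linarith
    then have "u \<le> \<Psi> \<omega>" using s by (simp add: \<Psi>_def field_simps)
    then show ?thesis by (simp add: u_def)
  qed
  have e_le: "(\<integral>\<omega>. e t \<omega> \<partial>\<Omega>) \<le> exp (h / 2)" if t: "t \<in> Q" for t
  proof -
    have "(\<integral>\<omega>. e t \<omega> \<partial>\<Omega>) \<le> exp ((\<Sum>i\<in>I. (s * t i)\<^sup>2) / 2)" unfolding e_def by (rule exp_le)
    also have "(\<Sum>i\<in>I. (s * t i)\<^sup>2) = (s * L2_set t I)\<^sup>2"
      by (simp add: power_mult_distrib L2_set_sq sum_distrib_left)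
    also have "\<dots> \<le> (s * R)\<^sup>2" using Q(2)[OF t] s by (intro power_mono mult_left_mono) auto
    also have "\<dots> = h" using R h by (simp add: s_def)
    finally show ?thesis by simp
  qed
  have "(\<integral>\<omega>. \<Psi> \<omega> \<partial>\<Omega>) = (1 / s) * (k - 1 + exp (- k) * (\<Sum>t\<in>Q. \<integral>\<omega>. e t \<omega> \<partial>\<Omega>))"
    unfolding \<Psi>_def using int by (simp add: prob_space)
  also have "\<dots> \<le> (1 / s) * (k - 1 + exp (- k) * (\<Sum>t\<in>Q. exp (h / 2)))"
    using s by (intro mult_left_mono add_left_mono sum_mono e_le) auto
  also have "\<dots> = (1 / s) * (k - 1 + exp (- k) * (card Q * exp (h / 2)))" by simp
  also have "\<dots> \<le> (1 / s) * (k - 1 + exp (- k) * (exp h * exp (h / 2)))"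
    using s h by (intro mult_left_mono add_left_mono mult_right_mono) auto
  also have "exp (- k) * (exp h * exp (h / 2)) = 1"
    by (simp add: exp_add[symmetric] k_def)
  also have "(1 / s) * (k - 1 + 1) = 3 / 2 * R * (h / sqrt h)" by (simp add: s_def k_def)
  also have "h / sqrt h = sqrt h" using h by (simp add: real_div_sqrt)
  also have "3 / 2 * R * sqrt h \<le> 2 * R * sqrt h" using R h by simp
  finally show ?thesis using 1 2 by blast
qed

text \<open>A square is dominated by exponentials, u^2 \<le> 2 (e^u + e^-u), after normalizing u.
  This keeps to the exponential moments that the locale supplies.\<close>

lemma second_moment_majorant:
  shows "\<exists>\<Psi>. integrable \<Omega> \<Psi> \<and> (\<forall>\<omega>. (\<Sum>i\<in>I. t i * g \<omega> i)\<^sup>2 \<le> \<Psi> \<omega>) \<and>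
    (\<integral>\<omega>. \<Psi> \<omega> \<partial>\<Omega>) \<le> 8 * (\<Sum>i\<in>I. (t i)\<^sup>2)"
proof -
  define T where "T = L2_set t I"
  define e where "e c \<omega> = exp (\<Sum>i\<in>I. (c * t i / T) * g \<omega> i)" for c \<omega>
  define \<Psi> where "\<Psi> \<omega> = 2 * T\<^sup>2 * (e 1 \<omega> + e (-1) \<omega>)" for \<omega>
  have int: "integrable \<Omega> (e c)" for c unfolding e_def by (rule exp_integrable)
  have pointwise: "(\<Sum>i\<in>I. t i * g \<omega> i)\<^sup>2 \<le> \<Psi> \<omega>" for \<omega>
  proof (cases "T = 0")
    case True
    then have "t i = 0" if "i \<in> I" for i
      using that finite_index by (simp add: T_def L2_set_eq_0_iff)
    then show ?thesis by (simp add: \<Psi>_def True)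
  next
    case False
    define u where "u = (\<Sum>i\<in>I. t i * g \<omega> i) / T"
    have e: "e c \<omega> = exp (c * u)" for c
      by (simp add: e_def u_def sum_distrib_left sum_divide_distrib mult.assoc)
    have "1 + \<bar>u\<bar> + \<bar>u\<bar>\<^sup>2 / 2 \<le> exp \<bar>u\<bar>" by (rule exp_lower_Taylor_quadratic) simp
    moreover have "1 + (- \<bar>u\<bar>) \<le> exp (- \<bar>u\<bar>)" by (rule exp_ge_add_one_self)
    moreover have "exp \<bar>u\<bar> + exp (- \<bar>u\<bar>) = exp u + exp (- u)" by (cases "u \<ge> 0") auto
    ultimately have "u\<^sup>2 \<le> 2 * (exp u + exp (- u))" by simp
    then have "T\<^sup>2 * u\<^sup>2 \<le> T\<^sup>2 * (2 * (exp u + exp (- u)))" by (intro mult_left_mono) auto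
    moreover have "T\<^sup>2 * u\<^sup>2 = (\<Sum>i\<in>I. t i * g \<omega> i)\<^sup>2"
      using False by (simp add: u_def power_divide)
    ultimately show ?thesis by (simp add: \<Psi>_def e algebra_simps)
  qed
  have e_le: "(\<integral>\<omega>. e c \<omega> \<partial>\<Omega>) \<le> 2" if "c \<in> {1, -1}" for c
  proof -
    have "(\<integral>\<omega>. e c \<omega> \<partial>\<Omega>) \<le> exp ((\<Sum>i\<in>I. (c * t i / T)\<^sup>2) / 2)" unfolding e_def by (rule exp_le)
    also have "(\<Sum>i\<in>I. (c * t i / T)\<^sup>2) = T\<^sup>2 / T\<^sup>2"
    proof -
      have "(c * t i / T)\<^sup>2 = (t i)\<^sup>2 / T\<^sup>2" for i
        using that by (auto simp: power_divide)
      then show ?thesis by (simp add: T_def L2_set_sq flip: sum_divide_distrib)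
    qed
    also have "exp (T\<^sup>2 / T\<^sup>2 / 2) \<le> exp (1 / 2)" by simp
    also have "exp (1 / 2 :: real) \<le> 2"
      using exp_bound_lemma[of "1/2 :: real"] by simp
    finally show ?thesis .
  qed
  have "(\<integral>\<omega>. \<Psi> \<omega> \<partial>\<Omega>) = 2 * T\<^sup>2 * ((\<integral>\<omega>. e 1 \<omega> \<partial>\<Omega>) + (\<integral>\<omega>. e (-1) \<omega> \<partial>\<Omega>))"
    unfolding \<Psi>_def using int by simp
  also have "\<dots> \<le> 2 * T\<^sup>2 * (2 + 2)" using e_le by (intro mult_left_mono add_mono) auto
  finally have "(\<integral>\<omega>. \<Psi> \<omega> \<partial>\<Omega>) \<le> 8 * (\<Sum>i\<in>I. (t i)\<^sup>2)" by (simp add: T_def L2_set_sq)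
  moreover have "integrable \<Omega> \<Psi>" unfolding \<Psi>_def using int by simp
  ultimately show ?thesis using pointwise by blast
qed

end

section \<open>Summing the entropy over the scales\<close>

lemma chaining_sum_le:
  fixes b :: "nat \<Rightarrow> real"
  assumes "\<And>i. 0 \<le> b i"
  shows "(\<Sum>j<m. 2 ^ j * (\<Sum>i\<in>{j..<m}. b i)) \<le> 2 * (\<Sum>i<m. 2 ^ i * b i)"
proof (induction m)
  case (Suc m)
  \<comment> \<open>After exchanging the sums, b i carries weight 2^0 + ... + 2^i, less than 2 *
    2^i: accumulating the entropies of all coarser levels costs only a constant.\<close>
  have geo: "(\<Sum>j<m. 2 ^ j) = (2::real) ^ m - 1" by (induction m) auto
  have "(\<Sum>j<Suc m. 2 ^ j * (\<Sum>i\<in>{j..<Suc m}. b i))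
      = (\<Sum>j<m. 2 ^ j * (\<Sum>i\<in>{j..<m}. b i) + 2 ^ j * b m) + 2 ^ m * b m"
    by (simp add: distrib_left)
  also have "\<dots> = (\<Sum>j<m. 2 ^ j * (\<Sum>i\<in>{j..<m}. b i)) + (\<Sum>j<m. 2 ^ j) * b m + 2 ^ m * b m"
    by (simp add: sum.distrib sum_distrib_right)
  also have "\<dots> \<le> 2 * (\<Sum>i<m. 2 ^ i * b i) + (2 ^ m - 1) * b m + 2 ^ m * b m"
    using Suc unfolding geo by simp
  also have "\<dots> \<le> 2 * (\<Sum>i<Suc m. 2 ^ i * b i)" using assms[of m] by (simp add: algebra_simps)
  finally show ?case .
qed auto

context finite_infratype_space begin

text \<open>The number k of scales: evaluation vectors of normalized data have length at most 1, so
  no net is required above radius 1.\<close>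

definition "levels = (LEAST m. 1 \<le> radius m)"

lemma radius_levels: "1 \<le> radius levels"
proof -
  obtain m where "1 / base_scale < 2 ^ m" using real_arch_pow[of 2 "1 / base_scale"] by auto
  then have "1 \<le> radius m" using base_scale_pos by (simp add: radius_def field_simps)
  then show ?thesis unfolding levels_def by (rule LeastI)
qed

lemma radius_pred_levels:
  assumes "0 < levels"
  shows "radius (levels - 1) < 1"
  using assms not_less_Least[of "levels - 1" "\<lambda>m. 1 \<le> radius m"] by (simp add: levels_def)

lemma radius_levels_le: "radius levels \<le> 2 + base_scale"
proof (cases "levels = 0")
  case True
  then show ?thesis by (simp add: radius_def)
next
  case False
  then have "radius levels = 2 * radius (levels - 1)"
    by (cases levels) (auto simp: radius_def)
  then show ?thesis using radius_pred_levels False base_scale_pos by simp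
qed

text \<open>The last radius below 1 is 2^(k-1) \<open>base_scale\<close>; squaring gives the bound,
  after weakening by 2048 and by lam \<le> 1.\<close>

lemma levels_bound:
  assumes "0 < levels"
  shows "4 ^ (levels - 1) * J\<^sup>2 < n"
proof -
  let ?k = "levels - 1"
  have s: "0 < sqrt (lam * n)" using lam n_pos by simp
  have "2 ^ ?k * J \<le> 2 ^ ?k * (2048 * J)" using J_pos by simp
  also have "\<dots> = radius ?k * sqrt (lam * n)"
    using less_imp_neq[OF s] by (simp add: radius_def base_scale_def)
  also have "\<dots> < 1 * sqrt (lam * n)"
    using radius_pred_levels[OF assms] s by (intro mult_strict_right_mono) auto
  finally have "(2 ^ ?k * J)\<^sup>2 < (sqrt (lam * n))\<^sup>2"
    using J_pos by (intro power_strict_mono) auto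
  also have "\<dots> = lam * n" using lam by simp
  also have "\<dots> \<le> 1 * real n" using lam by (intro mult_right_mono) auto
  also have "(2 ^ ?k * J)\<^sup>2 = 4 ^ ?k * J\<^sup>2"
    by (simp add: power_mult_distrib power2_eq_square flip: power_mult_distrib)
  finally show ?thesis by simp
qed

text \<open>The root is split factor by factor, with 4i + 3 \<le> (2i + 2)^2 and 2097152 \<le>
  1500^2. Multiplication by 2^i cancels one factor (1/2)^i.\<close>

lemma sqrt_entropy_bound_le:
  "2 ^ i * sqrt (entropy_bound i)
    \<le> 1500 * (2 ^ i + sqrt n * (((1/2) ^ i + 2 * sqrt lam) * (2 * real i + 2)))"
proof -
  define u where "u = (1/4) ^ i * ((1/4) ^ i + 2 * lam) * (4 * real i + 3)"
  define v where "v = (1/2) ^ i * (((1/2) ^ i + 2 * sqrt lam) * (2 * real i + 2))"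
  have v0: "0 \<le> v" unfolding v_def using lam by simp
  have q: "(1/4::real) ^ i = (1/2) ^ i * (1/2) ^ i" by (simp flip: power_mult_distrib)
  have "u \<le> v\<^sup>2"
  proof -
    have "((1/2) ^ i + 2 * sqrt lam)\<^sup>2 = (1/4) ^ i + 4 * lam + 4 * (1/2) ^ i * sqrt lam"
    proof -
      have "(a + 2 * s)\<^sup>2 = a * a + 4 * (s * s) + 4 * a * s" for a s :: real by algebra
      from this[of "(1/2) ^ i" "sqrt lam"] show ?thesis using lam by (simp add: q)
    qed
    then have "(1/4) ^ i + 2 * lam \<le> ((1/2) ^ i + 2 * sqrt lam)\<^sup>2"
      using lam by simp
    moreover have "(2 * real i + 2)\<^sup>2 = 4 * (real i)\<^sup>2 + 8 * real i + 4" by algebra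
    then have "4 * real i + 3 \<le> (2 * real i + 2)\<^sup>2" by simp
    ultimately have "((1/4) ^ i + 2 * lam) * (4 * real i + 3)
        \<le> ((1/2) ^ i + 2 * sqrt lam)\<^sup>2 * (2 * real i + 2)\<^sup>2"
      using lam by (intro mult_mono) auto
    then have "(1/4) ^ i * (((1/4) ^ i + 2 * lam) * (4 * real i + 3))
        \<le> (1/4) ^ i * (((1/2) ^ i + 2 * sqrt lam)\<^sup>2 * (2 * real i + 2)\<^sup>2)"
      by (intro mult_left_mono) auto
    then show ?thesis by (simp add: u_def v_def q power_mult_distrib power2_eq_square mult_ac)
  qed
  then have "n * u \<le> (sqrt n * v)\<^sup>2" using n_pos by (simp add: power_mult_distrib)
  moreover have "0 \<le> sqrt n * v" using v0 by simp
  ultimately have "1 + n * u \<le> (1 + sqrt n * v)\<^sup>2" by (simp add: power2_sum)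
  then have "entropy_bound i \<le> 1500\<^sup>2 * (1 + sqrt n * v)\<^sup>2"
  proof -
    have "0 \<le> u" using lam by (simp add: u_def)
    moreover have "entropy_bound i = 2097152 * (1 + n * u)"
      by (simp add: entropy_bound_def u_def mult.assoc)
    ultimately show ?thesis
      using \<open>1 + n * u \<le> (1 + sqrt n * v)\<^sup>2\<close> by (simp only:) (intro mult_mono, auto)
  qed
  then have "entropy_bound i \<le> (1500 * (1 + sqrt n * v))\<^sup>2" by (simp only: power_mult_distrib)
  then have "sqrt (entropy_bound i) \<le> 1500 * (1 + sqrt n * v)"
    using \<open>0 \<le> sqrt n * v\<close> by (intro real_le_lsqrt) auto
  then have "2 ^ i * sqrt (entropy_bound i) \<le> 2 ^ i * (1500 * (1 + sqrt n * v))"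
    by (intro mult_left_mono) auto
  also have "\<dots> = 1500 * (2 ^ i + sqrt n * (2 ^ i * v))" by (simp add: algebra_simps)
  also have "2 ^ i * v = ((1/2) ^ i + 2 * sqrt lam) * (2 * real i + 2)"
    by (simp add: v_def power_one_over)
  finally show ?thesis .
qed

text \<open>The terms with (1/2)^i sum to at most 8, whereas those with \<open>sqrt lam\<close> do
  not decay in i; their linear growth, summed over m levels, is the source of k^2.\<close>

lemma entropy_sum_le:
  "(\<Sum>j<m. 2 ^ j * sqrt (2 * (\<Sum>i\<in>{j..<m}. entropy_bound i)))
    \<le> 6000 * (2 ^ m + 8 * sqrt n + 4 * sqrt n * sqrt lam * (real m)\<^sup>2)"
proof -
  define b where "b i = sqrt (entropy_bound i)" for i
  have e0: "0 \<le> entropy_bound i" for i using entropy_bound_ge_1[of i] by simp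
  have b0: "0 \<le> b i" for i using e0 by (simp add: b_def)
  have sqrt_sum: "sqrt (2 * (\<Sum>i\<in>{j..<m}. entropy_bound i)) \<le> 2 * (\<Sum>i\<in>{j..<m}. b i)" for j
  proof -
    have "sqrt (\<Sum>i\<in>{j..<m}. entropy_bound i) = L2_set b {j..<m}"
      using e0 by (simp add: L2_set_def b_def)
    also have "\<dots> \<le> (\<Sum>i\<in>{j..<m}. b i)" using b0 by (intro L2_set_le_sum) auto
    finally have "sqrt 2 * sqrt (\<Sum>i\<in>{j..<m}. entropy_bound i) \<le> 2 * (\<Sum>i\<in>{j..<m}. b i)"
      using e0 by (intro mult_mono) (auto intro!: real_le_lsqrt sum_nonneg)
    then show ?thesis by (simp add: real_sqrt_mult)
  qed
  have "(\<Sum>j<m. 2 ^ j * sqrt (2 * (\<Sum>i\<in>{j..<m}. entropy_bound i)))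
      \<le> (\<Sum>j<m. 2 ^ j * (2 * (\<Sum>i\<in>{j..<m}. b i)))"
    by (intro sum_mono mult_left_mono sqrt_sum) auto
  also have "\<dots> = 2 * (\<Sum>j<m. 2 ^ j * (\<Sum>i\<in>{j..<m}. b i))"
    by (simp add: sum_distrib_left mult.left_commute)
  also have "\<dots> \<le> 4 * (\<Sum>i<m. 2 ^ i * b i)" using chaining_sum_le[of b m] b0 by simp
  also have "\<dots> \<le> 4 * (\<Sum>i<m. 1500 * (2 ^ i + sqrt n * (((1/2) ^ i + 2 * sqrt lam) * (2 * real i + 2))))"
    unfolding b_def by (intro mult_left_mono sum_mono sqrt_entropy_bound_le) auto
  also have "\<dots> = 6000 * ((\<Sum>i<m. 2 ^ i) + sqrt n * (\<Sum>i<m. (1/2) ^ i * (2 * real i + 2))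
      + sqrt n * (2 * sqrt lam) * (\<Sum>i<m. 2 * real i + 2))"
  proof -
    have "1500 * (2 ^ i + sqrt n * (((1/2) ^ i + 2 * sqrt lam) * (2 * real i + 2)))
        = 1500 * 2 ^ i + 1500 * sqrt n * ((1/2) ^ i * (2 * real i + 2))
          + 1500 * (sqrt n * (2 * sqrt lam)) * (2 * real i + 2)" for i
      by (simp add: algebra_simps)
    then show ?thesis
      by (simp only: sum.distrib flip: sum_distrib_left) (simp add: algebra_simps)
  qed
  also have "\<dots> \<le> 6000 * (2 ^ m + sqrt n * 8 + sqrt n * (2 * sqrt lam) * (2 * (real m)\<^sup>2))"
  proof (intro mult_left_mono add_mono)
    have "(\<Sum>i<m. 2 ^ i) = (2::real) ^ m - 1" by (induction m) auto
    then show "(\<Sum>i<m. 2 ^ i) \<le> (2::real) ^ m" by simp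
    have "(\<Sum>i<m. (1/2) ^ i * (2 * real i + 2)) = 8 - (1/2) ^ m * (4 * real m + 8)"
      by (induction m) (auto simp: algebra_simps)
    then show "(\<Sum>i<m. (1/2) ^ i * (2 * real i + 2)) \<le> 8" by simp
    have "(\<Sum>i<m. 2 * real i + 2) = (real m)\<^sup>2 + real m"
      by (induction m) (auto simp: power2_eq_square algebra_simps)
    also have "\<dots> \<le> 2 * (real m)\<^sup>2" by (cases m) (auto simp: power2_eq_square algebra_simps)
    finally show "(\<Sum>i<m. 2 * real i + 2) \<le> 2 * (real m)\<^sup>2" .
  qed (use lam in auto)
  finally show ?thesis by (simp add: algebra_simps)
qed

end

section \<open>The chaining bound\<close>

context normalized_vectors begin

lemma chaining_majorant:
  fixes \<Omega> :: "'w measure"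
  assumes sg: "subgaussian_process \<Omega> I g" and J1: "1 \<le> J"
  obtains W where "integrable \<Omega> W" "\<And>\<omega>. N (\<Sum>i\<in>I. g \<omega> i *\<^sub>R x i) \<le> W \<omega>"
    "(\<integral>\<omega>. W \<omega> \<partial>\<Omega>) \<le> 10 ^ 9 * (J * (1 / sqrt lam + (real levels)\<^sup>2))"
proof -
  interpret subgaussian_process \<Omega> I g by (rule sg)
  define m where "m = levels"
  obtain E where E: "E m = {\<lambda>_. 0}" "\<And>j. j \<le> m \<Longrightarrow> finite (E j)"
    "\<And>j. j \<le> m \<Longrightarrow> real (card (E j)) \<le> exp (\<Sum>i\<in>{j..<m}. entropy_bound i)"
    "\<And>j. j \<le> m \<Longrightarrow> E j \<subseteq> dual_ball"
    "\<And>j f. j \<le> m \<Longrightarrow> f \<in> dual_ball \<Longrightarrow> \<exists>e\<in>E j. ev_dist f e \<le> radius j"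
    by (rule net_sequence[of m]) (use radius_levels in \<open>auto simp: m_def\<close>)
  obtain q where q: "\<And>i j. q i j = q j i"
    "\<And>f j. linear f \<Longrightarrow> j \<in> I \<Longrightarrow> (\<Sum>i\<in>I. f (x i) * q i j) = (f (x j) :: real)"
    "(\<Sum>i\<in>I. \<Sum>j\<in>I. (q i j)\<^sup>2) \<le> real (card B)"
    by (rule evaluation_projection[of B I x]) (use basis finite_I x_in_V in auto)
  have "\<forall>i. \<exists>\<Psi>. integrable \<Omega> \<Psi> \<and> (\<forall>\<omega>. (\<Sum>j\<in>I. q i j * g \<omega> j)\<^sup>2 \<le> \<Psi> \<omega>) \<and>
    (\<integral>\<omega>. \<Psi> \<omega> \<partial>\<Omega>) \<le> 8 * (\<Sum>j\<in>I. (q i j)\<^sup>2)"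
    using second_moment_majorant by blast
  from choice[OF this] obtain \<Theta> where \<Theta>: "\<And>i. integrable \<Omega> (\<Theta> i)"
    "\<And>i \<omega>. (\<Sum>j\<in>I. q i j * g \<omega> j)\<^sup>2 \<le> \<Theta> i \<omega>"
    "\<And>i. (\<integral>\<omega>. \<Theta> i \<omega> \<partial>\<Omega>) \<le> 8 * (\<Sum>j\<in>I. (q i j)\<^sup>2)" by blast
  define T where "T j = {(\<lambda>i. d (x i) - e (x i)) |d e. d \<in> E j \<and> e \<in> E (Suc j) \<and> ev_dist d e \<le> 3 * radius j}" for j
  \<comment> \<open>The factor 2 comes from a link being a pair of points in consecutive
    nets.\<close>
  define h where "h j = 2 * (\<Sum>i\<in>{j..<m}. entropy_bound i)" for j
  have "\<exists>\<Psi>. integrable \<Omega> \<Psi> \<and> (\<forall>\<omega>. \<forall>t\<in>T j. (\<Sum>i\<in>I. t i * g \<omega> i) \<le> \<Psi> \<omega>) \<and>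
    (\<integral>\<omega>. \<Psi> \<omega> \<partial>\<Omega>) \<le> 2 * (3 * radius j) * sqrt (h j)" if "j < m" for j
  proof (rule max_majorant)
    have sub: "T j \<subseteq> (\<lambda>(d, e) i. d (x i) - e (x i)) ` (E j \<times> E (Suc j))"
      by (auto simp: T_def)
    have fin: "finite (E j \<times> E (Suc j))" using E(2) that by simp
    show "finite (T j)" using finite_subset[OF sub] fin by blast
    have "card (T j) \<le> card (E j \<times> E (Suc j))"
      by (rule surj_card_le[OF fin sub])
    then have "real (card (T j)) \<le> real (card (E j)) * real (card (E (Suc j)))"
      by (simp add: card_cartesian_product flip: of_nat_mult)
    also have "\<dots> \<le> exp (\<Sum>i\<in>{j..<m}. entropy_bound i) * exp (\<Sum>i\<in>{Suc j..<m}. entropy_bound i)"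
      using E(3) that by (intro mult_mono) auto
    also have "\<dots> \<le> exp (\<Sum>i\<in>{j..<m}. entropy_bound i) * exp (\<Sum>i\<in>{j..<m}. entropy_bound i)"
    proof -
      have "0 \<le> entropy_bound i" for i using entropy_bound_ge_1[of i] by simp
      then have "(\<Sum>i\<in>{Suc j..<m}. entropy_bound i) \<le> (\<Sum>i\<in>{j..<m}. entropy_bound i)"
        by (intro sum_mono2) auto
      then show ?thesis by (intro mult_left_mono) auto
    qed
    also have "\<dots> = exp (h j)" by (simp add: h_def exp_add[symmetric])
    finally show "real (card (T j)) \<le> exp (h j)" .
    have "entropy_bound j \<le> (\<Sum>i\<in>{j..<m}. entropy_bound i)"
      using that entropy_bound_ge_1 by (intro member_le_sum) (auto intro: order_trans[of 0 1])
    then show "0 < h j" using entropy_bound_ge_1[of j] unfolding h_def by linarith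
    show "0 < 3 * radius j" using radius_pos by simp
    show "L2_set t I \<le> 3 * radius j" if "t \<in> T j" for t using that by (auto simp: T_def)
  qed
  then have "\<forall>j. \<exists>\<Psi>. j < m \<longrightarrow> integrable \<Omega> \<Psi> \<and> (\<forall>\<omega>. \<forall>t\<in>T j. (\<Sum>i\<in>I. t i * g \<omega> i) \<le> \<Psi> \<omega>) \<and>
    (\<integral>\<omega>. \<Psi> \<omega> \<partial>\<Omega>) \<le> 2 * (3 * radius j) * sqrt (h j)" by blast
  from choice[OF this] obtain \<Psi> where \<Psi>: "\<And>j. j < m \<Longrightarrow> integrable \<Omega> (\<Psi> j)"
    "\<And>j \<omega> t. j < m \<Longrightarrow> t \<in> T j \<Longrightarrow> (\<Sum>i\<in>I. t i * g \<omega> i) \<le> \<Psi> j \<omega>"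
    "\<And>j. j < m \<Longrightarrow> (\<integral>\<omega>. \<Psi> j \<omega> \<partial>\<Omega>) \<le> 2 * (3 * radius j) * sqrt (h j)" by blast
  \<comment> \<open>The first summand covers what lies below \<open>base_scale\<close>. By the
    inequality of arithmetic and geometric means, the Euclidean norm there is replaced by an
    expression linear in the squares, so that only their means matter.\<close>
  define W where "W \<omega> = base_scale * ((sqrt n + (\<Sum>i\<in>I. \<Theta> i \<omega>) / sqrt n) / 2) + (\<Sum>j<m. \<Psi> j \<omega>)" for \<omega>
  have sn: "0 < sqrt n" using n_pos by simp
  have sums_integrable: "integrable \<Omega> (\<lambda>\<omega>. \<Sum>i\<in>I. \<Theta> i \<omega>)" "integrable \<Omega> (\<lambda>\<omega>. \<Sum>j<m. \<Psi> j \<omega>)"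
    using \<Theta>(1) \<Psi>(1) by (auto intro!: Bochner_Integration.integrable_sum)
  have intW: "integrable \<Omega> W"
    unfolding W_def using sums_integrable by simp
  have pointwise: "N (\<Sum>i\<in>I. g \<omega> i *\<^sub>R x i) \<le> W \<omega>" for \<omega>
  proof -
    define z where "z = (\<Sum>i\<in>I. g \<omega> i *\<^sub>R x i)"
    have z: "z \<in> V" unfolding z_def using x_in_V by (intro lincomb_in_V)
    have lin_z: "f z = (\<Sum>i\<in>I. f (x i) * g \<omega> i)" if "linear f" for f :: "'v \<Rightarrow> real"
      using that by (simp add: z_def linear_sum linear_cmul mult.commute)
    obtain f where f: "f \<in> dual_ball" "f z = N z"
      using norming_functional[OF basis(1,2) z] by blast
    have "\<forall>j. \<exists>e. j \<le> m \<longrightarrow> e \<in> E j \<and> ev_dist f e \<le> radius j" using E(5) f(1) by blast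
    from choice[OF this] obtain \<pi> where \<pi>: "\<And>j. j \<le> m \<Longrightarrow> \<pi> j \<in> E j"
      "\<And>j. j \<le> m \<Longrightarrow> ev_dist f (\<pi> j) \<le> radius j" by blast
    have lin: "linear (\<pi> j)" if "j \<le> m" for j using E(4)[OF that] \<pi>(1)[OF that] dual_ball_linear by blast
    have tele: "(\<Sum>j<k. \<pi> j z - \<pi> (Suc j) z) = \<pi> 0 z - \<pi> k z" for k
      by (induction k) auto
    have "\<pi> m z = 0" using \<pi>(1)[of m] E(1) by auto
    then have "N z = (f z - \<pi> 0 z) + (\<Sum>j<m. \<pi> j z - \<pi> (Suc j) z)" using tele[of m] f(2) by simp
    also have "\<dots> \<le> base_scale * ((sqrt n + (\<Sum>i\<in>I. \<Theta> i \<omega>) / sqrt n) / 2) + (\<Sum>j<m. \<Psi> j \<omega>)"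
    proof (intro add_mono sum_mono)
      fix j assume "j \<in> {..<m}"
      then have j: "j < m" by simp
      have "ev_dist (\<pi> j) (\<pi> (Suc j)) \<le> 3 * radius j"
      proof -
        have "ev_dist (\<pi> j) (\<pi> (Suc j)) = L2_set (\<lambda>i. (f (x i) - \<pi> (Suc j) (x i)) - (f (x i) - \<pi> j (x i))) I"
          by simp
        also have "\<dots> \<le> ev_dist f (\<pi> (Suc j)) + ev_dist f (\<pi> j)" by (rule L2_set_diff_le)
        also have "\<dots> \<le> radius (Suc j) + radius j" using \<pi>(2) j by (intro add_mono) auto
        also have "\<dots> = 3 * radius j" by (simp add: radius_def)
        finally show ?thesis .
      qed
      then have "(\<lambda>i. \<pi> j (x i) - \<pi> (Suc j) (x i)) \<in> T j"
        unfolding T_def mem_Collect_eq using \<pi>(1)[of j] \<pi>(1)[of "Suc j"] j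
        by (intro exI[of _ "\<pi> j"] exI[of _ "\<pi> (Suc j)"]) auto
      from \<Psi>(2)[OF j this, of \<omega>] show "\<pi> j z - \<pi> (Suc j) z \<le> \<Psi> j \<omega>"
        using lin[of j] lin[of "Suc j"] j by (simp add: lin_z left_diff_distrib sum_subtractf)
    next
      \<comment> \<open>The evaluation vector of k is fixed by the projection q, so it may be paired
        with the projected noise Y. The mean of |Y|^2 is at most 8n, independently of the number of
        vectors.\<close>
      define k where "k v = f v - \<pi> 0 v" for v
      have lk: "linear k" unfolding k_def using dual_ball_linear[OF f(1)] lin[of 0] by (simp add: linear_compose_sub)
      define Y where "Y i = (\<Sum>j\<in>I. q i j * g \<omega> j)" for i
      have "f z - \<pi> 0 z = (\<Sum>j\<in>I. k (x j) * g \<omega> j)" using lin_z[OF lk] by (simp add: k_def)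
      also have "\<dots> = (\<Sum>j\<in>I. (\<Sum>i\<in>I. k (x i) * q i j) * g \<omega> j)" using q(2)[OF lk] by simp
      also have "\<dots> = (\<Sum>j\<in>I. \<Sum>i\<in>I. k (x i) * (q i j * g \<omega> j))" by (simp add: sum_distrib_right mult.assoc)
      also have "\<dots> = (\<Sum>i\<in>I. k (x i) * Y i)"
        by (subst sum.swap) (simp add: Y_def sum_distrib_left)
      also have "\<dots> \<le> L2_set (\<lambda>i. k (x i)) I * L2_set Y I" by (rule sum_mult_le_L2_set)
      also have "\<dots> \<le> base_scale * L2_set Y I"
        using \<pi>(2)[of 0] by (intro mult_right_mono) (auto simp: k_def radius_def)
      also have "\<dots> \<le> base_scale * ((sqrt n + (\<Sum>i\<in>I. \<Theta> i \<omega>) / sqrt n) / 2)"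
      proof (intro mult_left_mono)
        have "(L2_set Y I)\<^sup>2 \<le> (\<Sum>i\<in>I. \<Theta> i \<omega>)"
          unfolding L2_set_sq Y_def by (intro sum_mono \<Theta>(2))
        then have "(L2_set Y I)\<^sup>2 / sqrt n \<le> (\<Sum>i\<in>I. \<Theta> i \<omega>) / sqrt n"
          using sn by (intro divide_right_mono) auto
        moreover have "2 * L2_set Y I \<le> sqrt n + (L2_set Y I)\<^sup>2 / sqrt n"
        proof -
          have "0 \<le> (sqrt n - L2_set Y I)\<^sup>2 / sqrt n" by simp
          also have "\<dots> = sqrt n - 2 * L2_set Y I + (L2_set Y I)\<^sup>2 / sqrt n"
          proof -
            have "(s - y)\<^sup>2 / s = s - 2 * y + y\<^sup>2 / s" if "0 < s" for s y :: real
              using that by (simp add: power2_eq_square field_simps)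
            then show ?thesis using sn by blast
          qed
          finally show ?thesis by linarith
        qed
        ultimately show "L2_set Y I \<le> (sqrt n + (\<Sum>i\<in>I. \<Theta> i \<omega>) / sqrt n) / 2" by argo
      qed (use base_scale_pos in auto)
      finally show "f z - \<pi> 0 z \<le> base_scale * ((sqrt n + (\<Sum>i\<in>I. \<Theta> i \<omega>) / sqrt n) / 2)" .
    qed
    finally show ?thesis by (simp add: z_def W_def)
  qed
  have sl: "0 < sqrt lam" using lam by simp
  have bs: "base_scale * sqrt n = 2048 * (J / sqrt lam)"
    using sn by (simp add: base_scale_def real_sqrt_mult)
  have "(\<integral>\<omega>. W \<omega> \<partial>\<Omega>)
      = base_scale * ((sqrt n + (\<Sum>i\<in>I. \<integral>\<omega>. \<Theta> i \<omega> \<partial>\<Omega>) / sqrt n) / 2) + (\<Sum>j<m. \<integral>\<omega>. \<Psi> j \<omega> \<partial>\<Omega>)"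
    unfolding W_def using sums_integrable \<Theta>(1) \<Psi>(1) by (simp add: prob_space)
  also have "\<dots> \<le> base_scale * ((sqrt n + 8 * real n / sqrt n) / 2) + (\<Sum>j<m. 2 * (3 * radius j) * sqrt (h j))"
  proof (intro add_mono mult_left_mono divide_right_mono sum_mono)
    have "(\<Sum>i\<in>I. \<integral>\<omega>. \<Theta> i \<omega> \<partial>\<Omega>) \<le> (\<Sum>i\<in>I. 8 * (\<Sum>j\<in>I. (q i j)\<^sup>2))" by (intro sum_mono \<Theta>(3))
    also have "\<dots> \<le> 8 * real n" using q(3) basis(3) by (simp flip: sum_distrib_left)
    finally show "(\<Sum>i\<in>I. \<integral>\<omega>. \<Theta> i \<omega> \<partial>\<Omega>) \<le> 8 * real n" .
  qed (use \<Psi>(3) base_scale_pos in auto)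
  also have "8 * real n / sqrt n = 8 * sqrt n"
    by (simp add: real_div_sqrt flip: times_divide_eq_right)
  also have "(\<Sum>j<m. 2 * (3 * radius j) * sqrt (h j))
      = 6 * base_scale * (\<Sum>j<m. 2 ^ j * sqrt (2 * (\<Sum>i\<in>{j..<m}. entropy_bound i)))"
    by (simp add: radius_def h_def sum_distrib_left algebra_simps)
  also have "\<dots> \<le> 6 * base_scale * (6000 * (2 ^ m + 8 * sqrt n + 4 * sqrt n * sqrt lam * (real m)\<^sup>2))"
    using base_scale_pos by (intro mult_left_mono entropy_sum_le) auto
  also have "base_scale * ((sqrt n + 8 * sqrt n) / 2) + 6 * base_scale * (6000 * (2 ^ m + 8 * sqrt n + 4 * sqrt n * sqrt lam * (real m)\<^sup>2))
      = 9 / 2 * (base_scale * sqrt n) + 36000 * (radius m + 8 * (base_scale * sqrt n) + 4 * (base_scale * sqrt n) * sqrt lam * (real m)\<^sup>2)"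
    by (simp add: radius_def algebra_simps)
  \<comment> \<open>\<open>radius m\<close> is at most 2 + \<open>base_scale\<close>; the 2 is
    absorbed by J / sqrt lam, which is at least 1.\<close>
  also have "\<dots> \<le> 9 / 2 * (base_scale * sqrt n) + 36000 * ((2 * (J / sqrt lam) + base_scale * sqrt n) + 8 * (base_scale * sqrt n) + 4 * (base_scale * sqrt n) * sqrt lam * (real m)\<^sup>2)"
  proof -
    have "sqrt lam \<le> 1" using lam by simp
    then have "sqrt lam \<le> J" using J1 by linarith
    then have "2 \<le> 2 * (J / sqrt lam)" using sl by (simp add: field_simps)
    moreover have "1 \<le> sqrt n" using basis(4) by simp
    then have "base_scale * 1 \<le> base_scale * sqrt n" using base_scale_pos by (intro mult_left_mono) auto
    ultimately have "radius m \<le> 2 * (J / sqrt lam) + base_scale * sqrt n"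
      using radius_levels_le unfolding m_def by linarith
    then show ?thesis by (intro add_left_mono mult_left_mono add_right_mono) auto
  qed
  also have "\<dots> = 663633216 * (J / sqrt lam) + 294912000 * (J * (real m)\<^sup>2)"
    unfolding bs using sl by (simp add: field_simps)
  also have "\<dots> \<le> 10 ^ 9 * (J / sqrt lam) + 10 ^ 9 * (J * (real m)\<^sup>2)"
    using J_pos sl by (intro add_mono mult_right_mono) auto
  finally have "(\<integral>\<omega>. W \<omega> \<partial>\<Omega>) \<le> 10 ^ 9 * (J * (1 / sqrt lam + (real levels)\<^sup>2))"
    by (simp add: m_def algebra_simps)
  with intW pointwise show thesis by (rule that)
qed

end

section \<open>Gaussian vectors and random signs\<close>

lemma std_normal_exp:
  fixes c :: real
  shows "integrable std_normal_distribution (\<lambda>y. exp (c * y))"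
    and "(\<integral>y. exp (c * y) \<partial>std_normal_distribution) = exp (c\<^sup>2 / 2)"
proof -
  have eq: "std_normal_density y * exp (c * y) = exp (c\<^sup>2 / 2) * normal_density c 1 y" for y
    by (simp add: normal_density_def exp_add[symmetric] power2_eq_square field_simps)
  have int: "integrable lborel (\<lambda>y. std_normal_density y * exp (c * y))"
    unfolding eq by (intro integrable_mult_right) simp
  then show "integrable std_normal_distribution (\<lambda>y. exp (c * y))"
    by (subst integrable_density) auto
  have "(\<integral>y. exp (c * y) \<partial>std_normal_distribution)
      = (\<integral>y. std_normal_density y * exp (c * y) \<partial>lborel)"
    by (subst integral_density) auto
  then show "(\<integral>y. exp (c * y) \<partial>std_normal_distribution) = exp (c\<^sup>2 / 2)"
    unfolding eq by simp
qed

lemma subgaussian_gaussian_vector: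
  assumes "finite I"
  shows "subgaussian_process (Pi\<^sub>M I (\<lambda>_. std_normal_distribution)) I (\<lambda>\<omega>. \<omega>)"
proof -
  interpret G: prob_space std_normal_distribution by (rule prob_space_normal_density) simp
  interpret P: product_sigma_finite "\<lambda>_. std_normal_distribution" ..
  have exp: "exp (\<Sum>i\<in>I. t i * \<omega> i) = (\<Prod>i\<in>I. exp (t i * \<omega> i))" for t \<omega> :: "'a \<Rightarrow> real"
    using assms by (simp add: exp_sum)
  show ?thesis
    unfolding subgaussian_process_def subgaussian_process_axioms_def
  proof (intro conjI allI)
    show "prob_space (Pi\<^sub>M I (\<lambda>_. std_normal_distribution))"
      by (intro prob_space_PiM prob_space_normal_density) simp
    fix t :: "'a \<Rightarrow> real"
    show "integrable (Pi\<^sub>M I (\<lambda>_. std_normal_distribution)) (\<lambda>\<omega>. exp (\<Sum>i\<in>I. t i * \<omega> i))"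
      unfolding exp using assms by (intro P.product_integrable_prod std_normal_exp(1)) auto
    have "(\<integral>\<omega>. exp (\<Sum>i\<in>I. t i * \<omega> i) \<partial>Pi\<^sub>M I (\<lambda>_. std_normal_distribution))
        = (\<Prod>i\<in>I. \<integral>y. exp (t i * y) \<partial>std_normal_distribution)"
      unfolding exp using assms by (intro P.product_integral_prod std_normal_exp(1)) auto
    also have "\<dots> = exp (\<Sum>i\<in>I. (t i)\<^sup>2 / 2)" using assms by (simp add: std_normal_exp(2) exp_sum)
    finally show "(\<integral>\<omega>. exp (\<Sum>i\<in>I. t i * \<omega> i) \<partial>Pi\<^sub>M I (\<lambda>_. std_normal_distribution))
        \<le> exp ((\<Sum>i\<in>I. (t i)\<^sup>2) / 2)"
      by (simp add: sum_divide_distrib)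
  qed (rule assms)
qed

text \<open>Hoeffding's lemma for the symmetric two-point distribution; the right half line suffices
  by symmetry.\<close>

lemma exp_average_le:
  fixes t :: real
  shows "(exp (- t) + exp t) / 2 \<le> exp (t\<^sup>2 / 2)"
proof -
  have *: "(exp (- t) + exp t) / 2 \<le> exp (t\<^sup>2 / 2)" if "0 \<le> t" for t :: real
  proof -
    define A where "A = 1 + 1 / 2 * (exp (2 * t) - 1)"
    have A: "A = (1 + exp (2 * t)) / 2" by (simp add: A_def field_simps)
    have "A > 0" unfolding A by (intro divide_pos_pos add_pos_pos) auto
    have "- (2 * t) * (1 / 2) + ln A \<le> (2 * t)\<^sup>2 / 8"
      using Hoeffdings_lemma_aux[of "2 * t" "1 / 2"] that by (simp add: A_def)
    then have "ln A \<le> t + t\<^sup>2 / 2" by (simp add: power2_eq_square)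
    then have "A \<le> exp (t + t\<^sup>2 / 2)" using \<open>A > 0\<close> by (metis exp_le_cancel_iff exp_ln)
    then have "exp (- t) * A \<le> exp (- t) * exp (t + t\<^sup>2 / 2)" by (intro mult_left_mono) auto
    moreover have "exp (- t) * A = (exp (- t) + exp t) / 2"
      by (simp add: A distrib_left exp_add[symmetric] field_simps)
    ultimately show ?thesis by (simp add: exp_add[symmetric])
  qed
  show ?thesis
    using *[of t] *[of "- t"] by (cases "0 \<le> t") (auto simp: add.commute)
qed

lemma subgaussian_random_signs:
  assumes "finite I"
  shows "subgaussian_process (measure_pmf (pmf_of_set (I \<rightarrow>\<^sub>E {-1, 1::real}))) I (\<lambda>\<omega>. \<omega>)"
proof -
  let ?S = "I \<rightarrow>\<^sub>E {-1, 1::real}"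
  have S: "finite ?S" "?S \<noteq> {}" using assms by (auto intro: finite_PiE simp: PiE_eq_empty_iff)
  show ?thesis
    unfolding subgaussian_process_def subgaussian_process_axioms_def
  proof (intro conjI allI)
    show "prob_space (measure_pmf (pmf_of_set ?S))" by (rule measure_pmf.prob_space_axioms)
    fix t :: "'a \<Rightarrow> real"
    show "integrable (measure_pmf (pmf_of_set ?S)) (\<lambda>\<omega>. exp (\<Sum>i\<in>I. t i * \<omega> i))"
      using S by (intro integrable_measure_pmf_finite) simp
    have "(\<integral>\<omega>. exp (\<Sum>i\<in>I. t i * \<omega> i) \<partial>measure_pmf (pmf_of_set ?S))
        = (\<Sum>\<omega>\<in>?S. \<Prod>i\<in>I. exp (t i * \<omega> i)) / card ?S"
      using S assms by (simp add: integral_pmf_of_set exp_sum)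
    also have "(\<Sum>\<omega>\<in>?S. \<Prod>i\<in>I. exp (t i * \<omega> i)) = (\<Prod>i\<in>I. \<Sum>y\<in>{-1, 1}. exp (t i * y))"
      using assms by (subst prod_sum_PiE) auto
    also have "\<dots> = (\<Prod>i\<in>I. exp (- t i) + exp (t i))" by simp
    also have "card ?S = 2 ^ card I" using assms by (simp add: card_PiE numeral_2_eq_2)
    also have "(\<Prod>i\<in>I. exp (- t i) + exp (t i)) / real (2 ^ card I)
        = (\<Prod>i\<in>I. (exp (- t i) + exp (t i)) / 2)"
      by (simp add: prod_dividef)
    also have "\<dots> \<le> (\<Prod>i\<in>I. exp ((t i)\<^sup>2 / 2))"
      by (intro prod_mono conjI exp_average_le) (auto intro!: add_nonneg_nonneg)
    also have "\<dots> = exp ((\<Sum>i\<in>I. (t i)\<^sup>2) / 2)"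
      using assms by (simp add: exp_sum sum_divide_distrib)
    finally show "(\<integral>\<omega>. exp (\<Sum>i\<in>I. t i * \<omega> i) \<partial>measure_pmf (pmf_of_set ?S))
        \<le> exp ((\<Sum>i\<in>I. (t i)\<^sup>2) / 2)" .
  qed (rule assms)
qed

context finite_infratype_space begin

definition "random_sum_bound = 10 ^ 9 * (J * (1 / sqrt lam + (real levels)\<^sup>2))"

lemma random_sum_bound_nonneg: "0 \<le> random_sum_bound"
  unfolding random_sum_bound_def using J_pos lam by simp

text \<open>The inequality is homogeneous, so the vectors are rescaled to satisfy
  \<open>normalized_vectors\<close>; only the case of all vectors being 0 falls outside.\<close>

lemma random_sum_majorant:
  fixes \<Omega> :: "'w measure" and x :: "'s \<Rightarrow> 'v"
  assumes sg: "subgaussian_process \<Omega> I g" and J1: "1 \<le> J" and x: "\<And>i. i \<in> I \<Longrightarrow> x i \<in> V"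
  shows "\<exists>W. integrable \<Omega> W \<and> (\<forall>\<omega>. N (\<Sum>i\<in>I. g \<omega> i *\<^sub>R x i) \<le> W \<omega>) \<and>
    (\<integral>\<omega>. W \<omega> \<partial>\<Omega>) \<le> random_sum_bound * sqrt (\<Sum>i\<in>I. (N (x i))\<^sup>2)"
proof -
  interpret sg: subgaussian_process \<Omega> I g by (rule sg)
  define \<sigma> where "\<sigma> = sqrt (\<Sum>i\<in>I. (N (x i))\<^sup>2)"
  have \<sigma>2: "\<sigma>\<^sup>2 = (\<Sum>i\<in>I. (N (x i))\<^sup>2)" by (simp add: \<sigma>_def sum_nonneg)
  show ?thesis
  proof (cases "\<sigma> = 0")
    case True
    have "x i = 0" if "i \<in> I" for i
    proof -
      have "(\<Sum>i\<in>I. (N (x i))\<^sup>2) = 0" using \<sigma>2 True by simp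
      then have "(N (x i))\<^sup>2 = 0" using that sg.finite_index by (simp add: sum_nonneg_eq_0_iff)
      then show ?thesis using N_eq_0_iff[OF x[OF that]] by simp
    qed
    then have "(\<Sum>i\<in>I. g \<omega> i *\<^sub>R x i) = 0" for \<omega> by simp
    then show ?thesis using True by (intro exI[of _ "\<lambda>_. 0"]) (auto simp: \<sigma>_def)
  next
    case False
    then have \<sigma>: "0 < \<sigma>" by (simp add: \<sigma>_def sum_nonneg order_less_le)
    define x' where "x' i = (1 / \<sigma>) *\<^sub>R x i" for i
    interpret normalized_vectors V N p J n B lam I x'
    proof
      show "finite I" by (rule sg.finite_index)
      show "x' i \<in> V" if "i \<in> I" for i
        unfolding x'_def using x[OF that] subspace_V by (rule subspace_scale[rotated])
      have "(N (x' i))\<^sup>2 = (N (x i))\<^sup>2 / \<sigma>\<^sup>2" if "i \<in> I" for i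
        using N_scaleR[OF x[OF that], of "1 / \<sigma>"] by (simp add: x'_def power_divide)
      then have "(\<Sum>i\<in>I. (N (x' i))\<^sup>2) = (\<Sum>i\<in>I. (N (x i))\<^sup>2) / \<sigma>\<^sup>2"
        by (simp add: sum_divide_distrib)
      then show "(\<Sum>i\<in>I. (N (x' i))\<^sup>2) = 1" using False unfolding \<sigma>2[symmetric] by simp
    qed
    obtain W where W: "integrable \<Omega> W" "\<And>\<omega>. N (\<Sum>i\<in>I. g \<omega> i *\<^sub>R x' i) \<le> W \<omega>"
      "(\<integral>\<omega>. W \<omega> \<partial>\<Omega>) \<le> 10 ^ 9 * (J * (1 / sqrt lam + (real levels)\<^sup>2))"
      using chaining_majorant[OF sg J1] by blast
    have "N (\<Sum>i\<in>I. g \<omega> i *\<^sub>R x i) \<le> \<sigma> * W \<omega>" for \<omega>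
    proof -
      have "(\<Sum>i\<in>I. g \<omega> i *\<^sub>R x i) = \<sigma> *\<^sub>R (\<Sum>i\<in>I. g \<omega> i *\<^sub>R x' i)"
        using False by (simp add: x'_def scaleR_sum_right)
      then have "N (\<Sum>i\<in>I. g \<omega> i *\<^sub>R x i) = \<sigma> * N (\<Sum>i\<in>I. g \<omega> i *\<^sub>R x' i)"
        using \<sigma> N_scaleR[OF lincomb_in_V[of I x' "g \<omega>"], of \<sigma>] x_in_V by simp
      also have "\<dots> \<le> \<sigma> * W \<omega>" using \<sigma> W(2) by (intro mult_left_mono) auto
      finally show ?thesis .
    qed
    moreover have "(\<integral>\<omega>. \<sigma> * W \<omega> \<partial>\<Omega>) \<le> random_sum_bound * \<sigma>"
    proof -
      have "\<sigma> * (\<integral>\<omega>. W \<omega> \<partial>\<Omega>) \<le> \<sigma> * random_sum_bound"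
        using W(3) \<sigma> unfolding random_sum_bound_def by (intro mult_left_mono) auto
      then show ?thesis using W(1) by (simp add: mult.commute)
    qed
    moreover have "integrable \<Omega> (\<lambda>\<omega>. \<sigma> * W \<omega>)" using W(1) by simp
    ultimately show ?thesis
      unfolding \<sigma>_def[symmetric] by (intro exI[of _ "\<lambda>\<omega>. \<sigma> * W \<omega>"]) simp
  qed
qed

lemma gauss_average_le:
  assumes "1 \<le> J" and x: "\<And>i. i < m \<Longrightarrow> x i \<in> V"
  shows "gauss_average N m x \<le> random_sum_bound * sqrt (\<Sum>i<m. (N (x i))\<^sup>2)"
proof -
  obtain W where W: "integrable (Pi\<^sub>M {..<m} (\<lambda>_. std_normal_distribution)) W"
    "\<And>\<omega>. N (\<Sum>i<m. \<omega> i *\<^sub>R x i) \<le> W \<omega>"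
    "(\<integral>\<omega>. W \<omega> \<partial>Pi\<^sub>M {..<m} (\<lambda>_. std_normal_distribution))
      \<le> random_sum_bound * sqrt (\<Sum>i<m. (N (x i))\<^sup>2)"
    using random_sum_majorant[OF subgaussian_gaussian_vector[of "{..<m}"] assms(1), of x] x by auto
  \<comment> \<open>With a nonnegative majorant, the comparison of integrals asks for integrability
    of W only.\<close>
  have "0 \<le> W \<omega>" for \<omega>
    using N_nonneg[OF lincomb_in_V[of "{..<m}" x \<omega>]] x W(2)[of \<omega>] by force
  then have "gauss_average N m x \<le> (\<integral>\<omega>. W \<omega> \<partial>Pi\<^sub>M {..<m} (\<lambda>_. std_normal_distribution))"
    unfolding gauss_average_def using W(1,2) by (intro integral_mono') auto
  then show ?thesis using W(3) by linarith
qed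

end

lemma finite_signs: "finite ({..<m::nat} \<rightarrow>\<^sub>E {-1, 1::real})" "({..<m::nat} \<rightarrow>\<^sub>E {-1, 1::real}) \<noteq> {}"
  by (auto intro: finite_PiE simp: PiE_eq_empty_iff)

lemma min_sign_norm_le:
  assumes "\<eta> \<in> {..<m} \<rightarrow>\<^sub>E {-1, 1}"
  shows "min_sign_norm N m x \<le> N (\<Sum>i<m. \<eta> i *\<^sub>R x i)"
  unfolding min_sign_norm_def using assms finite_signs(1)[of m] by (intro Min_le) auto

lemma min_sign_norm_attained:
  obtains \<eta> where "\<eta> \<in> {..<m} \<rightarrow>\<^sub>E {-1, 1}" "min_sign_norm N m x = N (\<Sum>i<m. \<eta> i *\<^sub>R x i)"
proof -
  have "min_sign_norm N m x \<in> (\<lambda>\<eta>. N (\<Sum>i<m. \<eta> i *\<^sub>R x i)) ` ({..<m} \<rightarrow>\<^sub>E {-1, 1})"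
    unfolding min_sign_norm_def using finite_signs[of m] by (intro Min_in) auto
  then show thesis using that by blast
qed

context finite_infratype_space begin

lemma min_sign_norm_le_random_sum_bound:
  assumes "1 \<le> J" and x: "\<And>i. i < m \<Longrightarrow> x i \<in> V"
  shows "min_sign_norm N m x \<le> random_sum_bound * sqrt (\<Sum>i<m. (N (x i))\<^sup>2)"
proof -
  let ?P = "measure_pmf (pmf_of_set ({..<m} \<rightarrow>\<^sub>E {-1, 1::real}))"
  obtain W where W: "integrable ?P W" "\<And>\<omega>. N (\<Sum>i<m. \<omega> i *\<^sub>R x i) \<le> W \<omega>"
    "(\<integral>\<omega>. W \<omega> \<partial>?P) \<le> random_sum_bound * sqrt (\<Sum>i<m. (N (x i))\<^sup>2)"
    using random_sum_majorant[OF subgaussian_random_signs[of "{..<m}"] assms(1), of x] x by auto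
  have "AE \<omega> in ?P. min_sign_norm N m x \<le> W \<omega>"
  proof (rule AE_pmfI)
    fix \<omega> :: "nat \<Rightarrow> real" assume "\<omega> \<in> set_pmf (pmf_of_set ({..<m} \<rightarrow>\<^sub>E {-1, 1}))"
    then have "\<omega> \<in> {..<m} \<rightarrow>\<^sub>E {-1, 1}" using finite_signs[of m] by (simp add: set_pmf_of_set)
    from min_sign_norm_le[OF this] show "min_sign_norm N m x \<le> W \<omega>" using W(2) by (rule order_trans)
  qed
  then have "min_sign_norm N m x \<le> (\<integral>\<omega>. W \<omega> \<partial>?P)"
    by (intro measure_pmf.integral_ge_const W(1))
  then show ?thesis using W(3) by linarith
qed

end

section \<open>The best constants\<close>

context normed_subspace begin

definition "infratype_admissible m =
  {M. 0 \<le> M \<and> (\<forall>x. (\<forall>i<m. x i \<in> V) \<longrightarrow> min_sign_norm N m x \<le> M * sqrt (\<Sum>i<m. (N (x i))\<^sup>2))}"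

lemma infratype2_const_on_eq: "infratype2_const_on m V N = Inf (infratype_admissible m)"
  by (simp add: infratype2_const_on_def infratype_admissible_def)

lemma sqrt_in_infratype_admissible: "sqrt (real m) \<in> infratype_admissible m"
  unfolding infratype_admissible_def
proof (intro CollectI conjI allI impI)
  fix x :: "nat \<Rightarrow> 'v" assume x: "\<forall>i<m. x i \<in> V"
  have "min_sign_norm N m x \<le> N (\<Sum>i<m. restrict (\<lambda>_. 1) {..<m} i *\<^sub>R x i)"
    by (rule min_sign_norm_le) (auto simp: PiE_iff extensional_def)
  also have "\<dots> \<le> (\<Sum>i<m. \<bar>restrict (\<lambda>_. 1) {..<m} i\<bar> * N (x i))" using x by (intro N_sum) auto
  also have "\<dots> = (\<Sum>i<m. 1 * N (x i))" by (intro sum.cong) auto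
  also have "\<dots> \<le> L2_set (\<lambda>_. 1) {..<m} * L2_set (\<lambda>i. N (x i)) {..<m}" by (rule sum_mult_le_L2_set)
  finally show "min_sign_norm N m x \<le> sqrt (real m) * sqrt (\<Sum>i<m. (N (x i))\<^sup>2)"
    by (simp add: L2_set_def)
qed auto

text \<open>Each instance of the inequality is a closed lower bound on M, obtained by dividing by
  the square sum; \<open>sqrt m\<close> is admissible and settles the instances where this sum is
  0.\<close>

lemma infratype2_const_on_admissible: "infratype2_const_on m V N \<in> infratype_admissible m"
proof -
  let ?A = "infratype_admissible m" and ?J = "infratype2_const_on m V N"
  have ne: "?A \<noteq> {}" using sqrt_in_infratype_admissible by blast
  have "0 \<le> ?J" unfolding infratype2_const_on_eq
    by (rule cInf_greatest[OF ne]) (auto simp: infratype_admissible_def)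
  moreover have "min_sign_norm N m x \<le> ?J * sqrt (\<Sum>i<m. (N (x i))\<^sup>2)" if x: "\<forall>i<m. x i \<in> V" for x
  proof (cases "sqrt (\<Sum>i<m. (N (x i))\<^sup>2) = 0")
    case True
    have "min_sign_norm N m x \<le> sqrt (real m) * sqrt (\<Sum>i<m. (N (x i))\<^sup>2)"
      using sqrt_in_infratype_admissible[of m] x by (auto simp: infratype_admissible_def)
    then show ?thesis unfolding True by simp
  next
    case False
    define s where "s = sqrt (\<Sum>i<m. (N (x i))\<^sup>2)"
    have "0 \<le> s" by (simp add: s_def sum_nonneg)
    then have s: "0 < s" using False by (simp add: s_def)
    have "min_sign_norm N m x / s \<le> ?J"
      unfolding infratype2_const_on_eq
    proof (rule cInf_greatest[OF ne])
      fix M assume "M \<in> ?A"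
      then have "min_sign_norm N m x \<le> M * s" using x by (simp add: infratype_admissible_def s_def)
      then show "min_sign_norm N m x / s \<le> M" using s by (simp add: pos_divide_le_eq)
    qed
    then show ?thesis using s by (simp add: pos_divide_le_eq flip: s_def)
  qed
  ultimately show ?thesis by (simp add: infratype_admissible_def)
qed

text \<open>Tested on one nonzero vector padded with zeros, where every choice of signs gives the
  same norm.\<close>

lemma one_le_infratype_admissible:
  assumes "v \<in> V" "v \<noteq> 0" "0 < m" "M \<in> infratype_admissible m"
  shows "1 \<le> M"
proof -
  define x where "x i = (if i = 0 then v else 0)" for i :: nat
  have x: "\<forall>i<m. x i \<in> V" using assms(1) subspace_0[OF subspace_V] by (simp add: x_def)
  have Nv: "0 < N v" using assms(1,2) N_nonneg N_eq_0_iff by (simp add: order_less_le)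
  obtain \<eta> where \<eta>: "\<eta> \<in> {..<m} \<rightarrow>\<^sub>E {-1, 1}" "min_sign_norm N m x = N (\<Sum>i<m. \<eta> i *\<^sub>R x i)"
    by (rule min_sign_norm_attained)
  have "(\<Sum>i<m. \<eta> i *\<^sub>R x i) = (\<Sum>i\<in>{0}. \<eta> i *\<^sub>R x i)"
    using assms(3) by (intro sum.mono_neutral_right) (auto simp: x_def)
  then have "(\<Sum>i<m. \<eta> i *\<^sub>R x i) = \<eta> 0 *\<^sub>R v" by (simp add: x_def)
  moreover have "\<eta> 0 \<in> {-1, 1}" using \<eta>(1) assms(3) by (auto simp: PiE_iff)
  ultimately have "min_sign_norm N m x = N v" using \<eta>(2) assms(1) by (auto simp: N_minus)
  moreover have "(\<Sum>i<m. (N (x i))\<^sup>2) = (\<Sum>i\<in>{0}. (N (x i))\<^sup>2)"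
    using assms(3) by (intro sum.mono_neutral_right) (auto simp: x_def)
  then have "sqrt (\<Sum>i<m. (N (x i))\<^sup>2) = N v" using Nv by (simp add: x_def)
  ultimately have "N v \<le> M * N v" using assms(4) x by (auto simp: infratype_admissible_def)
  then show ?thesis using Nv by simp
qed

lemma infratype_space_infratype2_const_on:
  assumes "v \<in> V" "v \<noteq> 0" "0 < m"
  shows "infratype_space V N m (infratype2_const_on m V N)"
proof
  show "0 < infratype2_const_on m V N"
    using one_le_infratype_admissible[OF assms infratype2_const_on_admissible] by linarith
  fix z :: "nat \<Rightarrow> 'v" assume z: "\<And>i. i < m \<Longrightarrow> z i \<in> V"
  obtain \<eta> where \<eta>: "\<eta> \<in> {..<m} \<rightarrow>\<^sub>E {-1, 1}" "min_sign_norm N m z = N (\<Sum>i<m. \<eta> i *\<^sub>R z i)"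
    by (rule min_sign_norm_attained)
  define \<theta> where "\<theta> i = (if i < m then \<eta> i else 1)" for i
  have "\<forall>i. \<theta> i \<in> {-1, 1}" using \<eta>(1) by (auto simp: \<theta>_def PiE_iff)
  moreover have "(\<Sum>i<m. \<theta> i *\<^sub>R z i) = (\<Sum>i<m. \<eta> i *\<^sub>R z i)" by (simp add: \<theta>_def)
  ultimately show "\<exists>\<eta>. (\<forall>i. \<eta> i \<in> {-1, 1::real}) \<and>
      N (\<Sum>i<m. \<eta> i *\<^sub>R z i) \<le> infratype2_const_on m V N * sqrt (\<Sum>i<m. (N (z i))\<^sup>2)"
  proof (intro exI[of _ \<theta>] conjI)
    have "min_sign_norm N m z \<le> infratype2_const_on m V N * sqrt (\<Sum>i<m. (N (z i))\<^sup>2)"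
      using infratype2_const_on_admissible[of m] z by (simp add: infratype_admissible_def)
    then show "N (\<Sum>i<m. \<theta> i *\<^sub>R z i) \<le> infratype2_const_on m V N * sqrt (\<Sum>i<m. (N (z i))\<^sup>2)"
      using \<eta>(2) \<open>(\<Sum>i<m. \<theta> i *\<^sub>R z i) = (\<Sum>i<m. \<eta> i *\<^sub>R z i)\<close> by simp
  qed
qed (rule assms(3))

end

section \<open>Absorbing the number of scales and conclusion\<close>

lemma lt_log_neg4_imp:
  assumes "ereal lam < log_neg4 u"
  shows "lam * ln u ^ 4 < 1"
\<comment> \<open>If the logarithm vanishes, the upper limit for lam is infinite, but the product is
  0.\<close>
proof (cases "ln u = 0")
  case False
  then have "0 < ln u ^ 4" by simp
  then show ?thesis using assms by (simp add: log_neg4_def field_simps inverse_eq_divide)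
qed auto

text \<open>
  The number k of scales enters the bound for I itself, so I is at most a power of k times J, while
  k is logarithmic in n/J^2; hence k is controlled by ln (n/I^2) up to a logarithm of k.
\<close>

lemma levels_absorbed:
  fixes lam J I n :: real and k :: nat
  assumes lam: "0 < lam" "lam \<le> 1" and J: "1 \<le> J" and I: "1 \<le> I" and n: "0 < n"
    and k: "0 < k \<Longrightarrow> 4 ^ (k - 1) * J\<^sup>2 < n"
    and le: "I \<le> 10 ^ 9 * (J * (1 / sqrt lam + (real k)\<^sup>2))"
    and ln: "lam * ln (n / I\<^sup>2) ^ 4 < 1"
  shows "1 / sqrt lam + (real k)\<^sup>2 \<le> 10 ^ 5 * (1 / sqrt lam)"
proof -
  \<comment> \<open>L = lam^(-1/4), so L^2 is the target and the hypothesis on lam turns into ln (n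
    / I^2) < L.\<close>
  define L where "L = 1 / sqrt (sqrt lam)"
  have sl: "0 < sqrt lam" "sqrt lam \<le> 1" using lam by auto
  then have "0 < sqrt (sqrt lam)" "sqrt (sqrt lam) \<le> 1" by auto
  then have L1: "1 \<le> L" by (simp add: L_def)
  have L2: "L\<^sup>2 = 1 / sqrt lam" using sl by (simp add: L_def power_divide)
  have "L ^ 4 = (L\<^sup>2)\<^sup>2" by (simp flip: power_mult)
  then have L4: "lam * L ^ 4 = 1" using lam unfolding L2 by (simp add: power_divide)
  show ?thesis
  proof (cases "(real k)\<^sup>2 \<le> 1 / sqrt lam")
    case True
    then have "1 / sqrt lam + (real k)\<^sup>2 \<le> 2 * (1 / sqrt lam)" by linarith
    also have "\<dots> \<le> 10 ^ 5 * (1 / sqrt lam)" using sl by (intro mult_right_mono) auto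
    finally show ?thesis .
  next
    case False
    then have k0: "0 < k" using sl by (cases k) auto
    have ln_lt: "ln (n / I\<^sup>2) < L"
    proof (rule ccontr)
      assume "\<not> ?thesis"
      then have "L ^ 4 \<le> ln (n / I\<^sup>2) ^ 4" using L1 by (intro power_mono) auto
      then have "lam * L ^ 4 \<le> lam * ln (n / I\<^sup>2) ^ 4" using lam by (intro mult_left_mono) auto
      then show False using ln L4 by linarith
    qed
    have "I \<le> 10 ^ 9 * (J * ((real k)\<^sup>2 + (real k)\<^sup>2))"
      using le False J by (smt (verit) mult_left_mono zero_le_power)
    \<comment> \<open>Powers of 2 keep the coming logarithm simple; 2 * 10^9 is below 2^31.\<close>
    also have "\<dots> \<le> 2 ^ 31 * (J * (real k)\<^sup>2)" using J by simp
    finally have "I\<^sup>2 \<le> (2 ^ 31 * (J * (real k)\<^sup>2))\<^sup>2" using I by (intro power_mono) auto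
    also have "\<dots> = 2 ^ 62 * real k ^ 4 * J\<^sup>2" by (simp add: power_mult_distrib flip: power_mult)
    finally have "4 ^ (k - 1) * I\<^sup>2 \<le> 4 ^ (k - 1) * (2 ^ 62 * real k ^ 4 * J\<^sup>2)"
      by (intro mult_left_mono) auto
    also have "\<dots> = 2 ^ 62 * real k ^ 4 * (4 ^ (k - 1) * J\<^sup>2)" by simp
    also have "\<dots> \<le> 2 ^ 62 * real k ^ 4 * n"
      using k[OF k0] by (intro mult_left_mono) auto
    finally have "4 ^ (k - 1) \<le> 2 ^ 62 * real k ^ 4 * (n / I\<^sup>2)"
      using I by (simp add: field_simps)
    then have "ln (4 ^ (k - 1)) \<le> ln (2 ^ 62 * real k ^ 4 * (n / I\<^sup>2))"
      using k0 n I by (subst ln_le_cancel_iff) auto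
    also have "\<dots> = 62 * ln 2 + 4 * ln (real k) + ln (n / I\<^sup>2)"
    proof -
      have "ln (c * real k ^ 4 * a) = ln c + 4 * ln (real k) + ln a" if "0 < c" "0 < a" for a c :: real
        using that k0 by (simp add: ln_mult ln_realpow)
      moreover have "ln (2 ^ 62) = 62 * ln (2 :: real)" using ln_realpow[of "2 :: real" 62] by simp
      moreover have "0 < n / I\<^sup>2" using n I by simp
      ultimately show ?thesis by (metis zero_less_numeral zero_less_power)
    qed
    finally have *: "(real k - 1) * ln 4 \<le> 62 * ln 2 + 4 * ln (real k) + ln (n / I\<^sup>2)"
      using k0 by (simp add: ln_realpow of_nat_diff)
    have "exp 1 \<le> (4::real)" using exp_le by simp
    then have "1 \<le> ln (4::real)" by (simp add: ln_ge_iff)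
    then have "real k - 1 \<le> (real k - 1) * ln 4"
      using k0 mult_left_mono[of 1 "ln 4" "real k - 1"] by simp
    moreover have ln2: "ln (2::real) \<le> 1" using ln_2_less_1 by simp
    \<comment> \<open>The tangent at k = 8 has slope 1/2, so half of k remains on the left: k is
      then at most 2L + 142.\<close>
    moreover have "4 * ln (real k) \<le> real k / 2 + 8"
    proof -
      have "ln (8::real) = 3 * ln 2" using ln_realpow[of "2::real" 3] by simp
      moreover have "ln (real k / 8) \<le> real k / 8 - 1" using k0 by (intro ln_le_minus_one) auto
      ultimately show ?thesis using k0 ln2 by (simp add: ln_div)
    qed
    ultimately have "real k \<le> 2 * L + 142" using * ln_lt by linarith
    then have "real k \<le> 144 * L" using L1 by linarith
    then have "(real k)\<^sup>2 \<le> (144 * L)\<^sup>2" by (intro power_mono) auto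
    also have "\<dots> = 20736 * (1 / sqrt lam)" by (simp add: power_mult_distrib L2)
    finally have "1 / sqrt lam + (real k)\<^sup>2 \<le> 20737 * (1 / sqrt lam)" by argo
    also have "\<dots> \<le> 10 ^ 5 * (1 / sqrt lam)" using sl by (intro mult_right_mono) auto
    finally show ?thesis .
  qed
qed

text \<open>The constant is 10^14 = 10^9 * 10^5, from \<open>random_sum_bound\<close> and
  \<open>levels_absorbed\<close>. With m = lam n read as the ceiling, p is at least lam n and at
  least 1.\<close>

theorem corollary4p5:
  shows "\<exists>C::real. 0 < C \<and>
    (\<forall>(n::nat) (V :: (nat \<Rightarrow>\<^sub>0 real) set) (N :: (nat \<Rightarrow>\<^sub>0 real) \<Rightarrow> real) (lam::real).
       banach_space_of_dim n V N \<longrightarrow>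
       0 < lam \<longrightarrow> lam \<le> 1 \<longrightarrow>
       ereal lam < log_neg4 (real n / (infratype2_const V N)\<^sup>2) \<longrightarrow>
       type2_const V N
         \<le> C * lam powr (-1/2) * infratype2_const_on (nat \<lceil>lam * real n\<rceil>) V N)"
proof (intro exI[of _ "10 ^ 14"] conjI allI impI)
  fix n :: nat and V :: "(nat \<Rightarrow>\<^sub>0 real) set" and N :: "(nat \<Rightarrow>\<^sub>0 real) \<Rightarrow> real" and lam :: real
  assume space: "banach_space_of_dim n V N" and lam: "0 < lam" "lam \<le> 1"
    and lt: "ereal lam < log_neg4 (real n / (infratype2_const V N)\<^sup>2)"
  have n: "1 \<le> n" "dim V = n" and V: "subspace V" and norm: "norm_on V N"
    using space by (auto simp: banach_space_of_dim_def)
  define p where "p = nat \<lceil>lam * real n\<rceil>"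
  define J where "J = infratype2_const_on p V N"
  interpret normed_subspace V N by unfold_locales (use V norm in auto)
  obtain B where B: "B \<subseteq> V" "independent B" "V \<subseteq> span B" "card B = dim V"
    by (rule basis_exists[of V])
  have finB: "finite B" using B(4) n by (intro card_ge_0_finite) simp
  have spanB: "V = span B" using B(1,3) V by (simp add: span_subspace)
  have "B \<noteq> {}" using B(4) n by auto
  then obtain v where v: "v \<in> V" "v \<noteq> 0" using B(1,2) dependent_zero by blast
  have lp: "lam * real n \<le> real p" unfolding p_def by (rule real_nat_ceiling_ge)
  have "0 < lam * real n" using lam n by simp
  then have p: "0 < p" using lp by (cases p) auto
  interpret infratype_space V N p J
    unfolding J_def by (rule infratype_space_infratype2_const_on[OF v p])
  interpret finite_infratype_space V N p J n B lam
    by unfold_locales (use finB spanB B(4) n lam lp in auto)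
  have J1: "1 \<le> J" unfolding J_def
    by (rule one_le_infratype_admissible[OF v p infratype2_const_on_admissible])
  have "type2_const V N \<le> random_sum_bound"
    unfolding type2_const_def
    using random_sum_bound_nonneg gauss_average_le[OF J1] by (intro cInf_lower bdd_belowI[of _ 0]) auto
  define A where "A = {M. 0 \<le> M \<and> (\<forall>m x. (\<forall>i<m. x i \<in> V) \<longrightarrow>
    min_sign_norm N m x \<le> M * sqrt (\<Sum>i<m. (N (x i))\<^sup>2))}"
  have bound_in_A: "random_sum_bound \<in> A"
    unfolding A_def using random_sum_bound_nonneg min_sign_norm_le_random_sum_bound[OF J1] by auto
  have I: "infratype2_const V N = Inf A" by (simp add: infratype2_const_def A_def)
  have "infratype2_const V N \<le> random_sum_bound"
    unfolding I using bound_in_A by (intro cInf_lower bdd_belowI[of _ 0]) (auto simp: A_def)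
  moreover have "1 \<le> infratype2_const V N"
    unfolding I
  proof (rule cInf_greatest)
    show "A \<noteq> {}" using bound_in_A by blast
    fix M assume "M \<in> A"
    \<comment> \<open>A constant valid for all lengths is valid for single vectors, which already
      force it to be at least 1.\<close>
    then have "M \<in> infratype_admissible 1" unfolding A_def infratype_admissible_def mem_Collect_eq by blast
    then show "1 \<le> M" using one_le_infratype_admissible[OF v, of 1] by simp
  qed
  ultimately have "1 / sqrt lam + (real levels)\<^sup>2 \<le> 10 ^ 5 * (1 / sqrt lam)"
    using lam J1 n_pos levels_bound lt_log_neg4_imp[OF lt]
    by (intro levels_absorbed[of lam J "infratype2_const V N" "real n" levels])
      (auto simp: random_sum_bound_def)
  then have "10 ^ 9 * (J * (1 / sqrt lam + (real levels)\<^sup>2)) \<le> 10 ^ 9 * (J * (10 ^ 5 * (1 / sqrt lam)))"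
    using J1 by (intro mult_left_mono) auto
  then have "random_sum_bound \<le> 10 ^ 14 * (1 / sqrt lam) * J"
    by (simp add: random_sum_bound_def)
  moreover have "1 / sqrt lam = lam powr (-1/2)"
    using lam by (simp add: powr_minus_divide powr_half_sqrt)
  ultimately show "type2_const V N
      \<le> 10 ^ 14 * lam powr (-1/2) * infratype2_const_on (nat \<lceil>lam * real n\<rceil>) V N"
    using \<open>type2_const V N \<le> random_sum_bound\<close> unfolding J_def p_def by simp
qed simp

end
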